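(* Let $T\in(0,\infty)$ and $\gamma,\xi\in[0,1)$, and assume that $f\in C\big([0,T]\times E_\xi,E_\gamma\big)$ is such that there is a constant $C>0$ with $$\|f(t,u)\|_\gamma\le C\big(1+\|u\|_\xi\big),\qquad t\in[0,T],\quad u\in E_\xi.$$ If $\gamma=0$, assume additionally that there exists $\vartheta_0\in(0,1)$ such that for each $R>0$ there is a constant $K(R)>0$ with $$\|f(t,u)-f(s,v)\|_0\le K(R)\big(|t-s|^{\vartheta_0}+\|u-v\|_\xi^{\vartheta_0}\big),\qquad t,s\in[0,T],\quad u,v\in\bar{\mathbb{B}}_{E_\xi}(0,R).$$ Then, if $u^0\in E_\alpha$ for some $\alpha\in[\xi,1)$, the Cauchy problem $$u'=Au+f(t,u),\quad t\in(0,T],\qquad u(0)=u^0,$$ admits a solution $$u\in C^1\big((0,T],E_0\big)\cap C\big((0,T],E_1\big)\cap C\big([0,T],E_\alpha\big).$$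
   Context: $E_0$ and $E_1$ are Banach spaces over $\mathbb{K}\in\{\mathbb{R},\mathbb{C}\}$ such that $E_1$ is continuously, densely and compactly embedded in $E_0$. For each $\theta\in(0,1)$, $(\cdot,\cdot)_\theta$ is an arbitrary admissible interpolation functor of exponent $\theta$ (admissible meaning that $E_1$ is dense in $(E_0,E_1)_\theta$ whenever $E_1$ is densely embedded in $E_0$), and $E_\theta:=(E_0,E_1)_\theta$ is the corresponding interpolation space with norm $\|\cdot\|_\theta$; $\|\cdot\|_0$ is the norm of $E_0$. Then for $0<\vartheta<\theta<1$ the embeddings $E_1\hookrightarrow E_\theta\hookrightarrow E_\vartheta\hookrightarrow E_0$ are all dense and compact. $A:E_1\to E_0$ is the infinitesimal generator (with domain $E_1$) of a strongly continuous analytic semigroup $\{e^{tA}:t\ge0\}\subset\mathcal{L}(E_0)$. $\bar{\mathbb{B}}_X(0,R)$ denotes the closed ball in $X$ with center $0$ and radius $R$. A solution is a function $u$ with the stated regularity satisfying $u'(t)=Au(t)+f(t,u(t))$ in $E_0$ for all $t\in(0,T]$ and $u(0)=u^0$. *)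

theory Defs
  imports "HOL-Analysis.Analysis"
begin

text \<open>
  The scalar field \<open>K\<close> is represented as a subset of the complex numbers, either \<open>\<real>\<close> or
  \<open>UNIV\<close>; scalar multiplication is a map \<open>sm\<close> that is only constrained for scalars in \<open>K\<close>
  and extends the real scaling of the type.
\<close>

locale scalar_action =
  fixes K :: "complex set" and sm :: "complex \<Rightarrow> 'a::real_vector \<Rightarrow> 'a"
  assumes field: "K = \<real> \<or> K = UNIV"
    and sm_of_real: "\<And>r x. sm (of_real r) x = r *\<^sub>R x"
    and sm_add_right: "\<And>c x y. c \<in> K \<Longrightarrow> sm c (x + y) = sm c x + sm c y"
    and sm_add_left: "\<And>c d x. c \<in> K \<Longrightarrow> d \<in> K \<Longrightarrow> sm (c + d) x = sm c x + sm d x"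
    and sm_mult: "\<And>c d x. c \<in> K \<Longrightarrow> d \<in> K \<Longrightarrow> sm (c * d) x = sm c (sm d x)"


section \<open>Normed spaces inside an ambient vector space\<close>

text \<open>
  A normed space is a set of vectors of the ambient type together with its own norm, so that
  \<open>E\<^sub>0\<close>, \<open>E\<^sub>1\<close> and the interpolation spaces live in one type and the embeddings are
  inclusions. Values of \<open>nrm\<close> outside \<open>pts\<close> carry no meaning.
\<close>

record 'a nspace =
  pts :: "'a set"
  nrm :: "'a \<Rightarrow> real"

text \<open>The guard makes this a metric in the sense of \<open>Metric_space\<close>, whose nonnegativity and
  symmetry axioms range over the whole type.\<close>

definition ndist :: "'a::real_vector nspace \<Rightarrow> 'a \<Rightarrow> 'a \<Rightarrow> real" where
  "ndist X x y = (if x \<in> pts X \<and> y \<in> pts X then nrm X (x - y) else 0)"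

definition ntop :: "'a::real_vector nspace \<Rightarrow> 'a topology" where
  "ntop X = Metric_space.mtopology (pts X) (ndist X)"

definition banach_space ::
    "complex set \<Rightarrow> (complex \<Rightarrow> 'a \<Rightarrow> 'a) \<Rightarrow> 'a::real_vector nspace \<Rightarrow> bool" where
  "banach_space K sm X \<longleftrightarrow>
     0 \<in> pts X \<and>
     (\<forall>x\<in>pts X. \<forall>y\<in>pts X. x + y \<in> pts X) \<and>
     (\<forall>c\<in>K. \<forall>x\<in>pts X. sm c x \<in> pts X) \<and>
     (\<forall>x\<in>pts X. 0 \<le> nrm X x \<and> (nrm X x = 0 \<longleftrightarrow> x = 0)) \<and>
     (\<forall>c\<in>K. \<forall>x\<in>pts X. nrm X (sm c x) = cmod c * nrm X x) \<and>
     (\<forall>x\<in>pts X. \<forall>y\<in>pts X. nrm X (x + y) \<le> nrm X x + nrm X y) \<and>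
     Metric_space.mcomplete (pts X) (ndist X)"

definition whole_space :: "'a::real_normed_vector nspace" where
  "whole_space = \<lparr>pts = UNIV, nrm = norm\<rparr>"

definition cont_embedded :: "'a::real_vector nspace \<Rightarrow> 'a nspace \<Rightarrow> bool" where
  "cont_embedded X Y \<longleftrightarrow>
     pts X \<subseteq> pts Y \<and> (\<exists>C. \<forall>x\<in>pts X. nrm Y x \<le> C * nrm X x)"

definition dense_in :: "'a::real_vector nspace \<Rightarrow> 'a nspace \<Rightarrow> bool" where
  "dense_in X Y \<longleftrightarrow> pts X \<subseteq> pts Y \<and> ntop Y closure_of pts X = pts Y"

definition compactly_embedded :: "'a::real_vector nspace \<Rightarrow> 'a nspace \<Rightarrow> bool" where
  "compactly_embedded X Y \<longleftrightarrow>
     cont_embedded X Y \<and>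
     compactin (ntop Y) (ntop Y closure_of {x \<in> pts X. nrm X x \<le> 1})"


section \<open>Interpolation functors\<close>

definition bounded_op :: "complex set \<Rightarrow> (complex \<Rightarrow> 'a \<Rightarrow> 'a) \<Rightarrow>
    'a::real_vector nspace \<Rightarrow> 'a nspace \<Rightarrow> ('a \<Rightarrow> 'a) \<Rightarrow> bool" where
  "bounded_op K sm X Y T \<longleftrightarrow>
     T ` pts X \<subseteq> pts Y \<and>
     (\<forall>x\<in>pts X. \<forall>y\<in>pts X. T (x + y) = T x + T y) \<and>
     (\<forall>c\<in>K. \<forall>x\<in>pts X. T (sm c x) = sm c (T x)) \<and>
     (\<exists>C. \<forall>x\<in>pts X. nrm Y (T x) \<le> C * nrm X x)"

definition opnorm :: "'a::real_vector nspace \<Rightarrow> 'a nspace \<Rightarrow> ('a \<Rightarrow> 'a) \<Rightarrow> real" where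
  "opnorm X Y T = (SUP x\<in>{x \<in> pts X. nrm X x \<le> 1}. nrm Y (T x))"

definition inter_space :: "'a::real_vector nspace \<Rightarrow> 'a nspace \<Rightarrow> 'a nspace" where
  "inter_space X Y = \<lparr>pts = pts X \<inter> pts Y, nrm = (\<lambda>x. max (nrm X x) (nrm Y x))\<rparr>"

definition sum_space :: "'a::real_vector nspace \<Rightarrow> 'a nspace \<Rightarrow> 'a nspace" where
  "sum_space X Y =
     \<lparr>pts = {x + y |x y. x \<in> pts X \<and> y \<in> pts Y},
      nrm = (\<lambda>z. Inf {nrm X x + nrm Y y |x y. x \<in> pts X \<and> y \<in> pts Y \<and> z = x + y})\<rparr>"

text \<open>An interpolation couple: both spaces embed continuously in one Hausdorff topological
  vector space.\<close>

definition banach_couple :: "complex set \<Rightarrow> (complex \<Rightarrow> 'a \<Rightarrow> 'a) \<Rightarrow>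
    'a::real_vector nspace \<Rightarrow> 'a nspace \<Rightarrow> bool" where
  "banach_couple K sm X0 X1 \<longleftrightarrow>
     banach_space K sm X0 \<and> banach_space K sm X1 \<and>
     (\<exists>\<tau>. topspace \<tau> = UNIV \<and> Hausdorff_space \<tau> \<and>
          continuous_map (prod_topology \<tau> \<tau>) \<tau> (\<lambda>(x, y). x + y) \<and>
          continuous_map (prod_topology (top_of_set K) \<tau>) \<tau> (\<lambda>(c, x). sm c x) \<and>
          continuous_map (ntop X0) \<tau> id \<and> continuous_map (ntop X1) \<tau> id)"

definition couple_morphism :: "complex set \<Rightarrow> (complex \<Rightarrow> 'a \<Rightarrow> 'a) \<Rightarrow>
    'a::real_vector nspace \<Rightarrow> 'a nspace \<Rightarrow> 'a nspace \<Rightarrow> 'a nspace \<Rightarrow> ('a \<Rightarrow> 'a) \<Rightarrow> bool" where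
  "couple_morphism K sm X0 X1 Y0 Y1 T \<longleftrightarrow>
     bounded_op K sm (sum_space X0 X1) (sum_space Y0 Y1) T \<and>
     bounded_op K sm X0 Y0 T \<and> bounded_op K sm X1 Y1 T"

text \<open>
  HOL has no quantification over types, so the objects of the category are the couples of
  Banach spaces carried by subspaces of the ambient type. On morphisms a functor acts by
  restriction, hence only its object part \<open>F\<close> is data.
\<close>

definition interpolation_functor :: "complex set \<Rightarrow> (complex \<Rightarrow> 'a \<Rightarrow> 'a) \<Rightarrow>
    ('a::real_vector nspace \<Rightarrow> 'a nspace \<Rightarrow> 'a nspace) \<Rightarrow> bool" where
  "interpolation_functor K sm F \<longleftrightarrow>
     (\<forall>X0 X1. banach_couple K sm X0 X1 \<longrightarrow>
        banach_space K sm (F X0 X1) \<and>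
        cont_embedded (inter_space X0 X1) (F X0 X1) \<and>
        cont_embedded (F X0 X1) (sum_space X0 X1)) \<and>
     (\<forall>X0 X1 Y0 Y1 T. banach_couple K sm X0 X1 \<longrightarrow> banach_couple K sm Y0 Y1 \<longrightarrow>
        couple_morphism K sm X0 X1 Y0 Y1 T \<longrightarrow>
        bounded_op K sm (F X0 X1) (F Y0 Y1) T)"

text \<open>The constant may depend on the two couples, but not on the operator.\<close>

definition of_exponent :: "complex set \<Rightarrow> (complex \<Rightarrow> 'a \<Rightarrow> 'a) \<Rightarrow> real \<Rightarrow>
    ('a::real_vector nspace \<Rightarrow> 'a nspace \<Rightarrow> 'a nspace) \<Rightarrow> bool" where
  "of_exponent K sm \<theta> F \<longleftrightarrow>
     (\<forall>X0 X1 Y0 Y1. banach_couple K sm X0 X1 \<longrightarrow> banach_couple K sm Y0 Y1 \<longrightarrow>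
        (\<exists>C. \<forall>T. couple_morphism K sm X0 X1 Y0 Y1 T \<longrightarrow>
           opnorm (F X0 X1) (F Y0 Y1) T
             \<le> C * opnorm X0 Y0 T powr (1 - \<theta>) * opnorm X1 Y1 T powr \<theta>))"

definition admissible_functor :: "complex set \<Rightarrow> (complex \<Rightarrow> 'a \<Rightarrow> 'a) \<Rightarrow>
    ('a::real_vector nspace \<Rightarrow> 'a nspace \<Rightarrow> 'a nspace) \<Rightarrow> bool" where
  "admissible_functor K sm F \<longleftrightarrow>
     (\<forall>X0 X1. banach_couple K sm X0 X1 \<longrightarrow> cont_embedded X1 X0 \<longrightarrow> dense_in X1 X0 \<longrightarrow>
        dense_in X1 (F X0 X1))"

definition interp_scale :: "(real \<Rightarrow> 'a nspace \<Rightarrow> 'a nspace \<Rightarrow> 'a nspace) \<Rightarrow>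
    'a nspace \<Rightarrow> 'a nspace \<Rightarrow> real \<Rightarrow> 'a nspace" where
  "interp_scale F E0 E1 \<theta> = (if \<theta> = 0 then E0 else F \<theta> E0 E1)"


section \<open>Analytic semigroups\<close>

definition C0_semigroup :: "(real \<Rightarrow> 'a::real_normed_vector \<Rightarrow>\<^sub>L 'a) \<Rightarrow> bool" where
  "C0_semigroup U \<longleftrightarrow>
     U 0 = id_blinfun \<and>
     (\<forall>s\<ge>0. \<forall>t\<ge>0. U (s + t) = U s o\<^sub>L U t) \<and>
     (\<forall>x. continuous_on {0..} (\<lambda>t. blinfun_apply (U t) x))"

definition infinitesimal_generator :: "(real \<Rightarrow> 'a::real_normed_vector \<Rightarrow>\<^sub>L 'a) \<Rightarrow>
    'a set \<Rightarrow> ('a \<Rightarrow> 'a) \<Rightarrow> bool" where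
  "infinitesimal_generator U D A \<longleftrightarrow>
     D = {x. \<exists>y. ((\<lambda>t. (blinfun_apply (U t) x - x) /\<^sub>R t) \<longlongrightarrow> y) (at_right 0)} \<and>
     (\<forall>x\<in>D. ((\<lambda>t. (blinfun_apply (U t) x - x) /\<^sub>R t) \<longlongrightarrow> A x) (at_right 0))"

definition sector :: "real \<Rightarrow> complex set" where
  "sector \<delta> = {z. z \<noteq> 0 \<and> \<bar>Arg z\<bar> < \<delta>}"

text \<open>Here \<open>csm\<close> is a complex scalar multiplication; complex differentiability in the operator
  norm is real differentiability with a derivative of the form \<open>h \<mapsto> h \<cdot> L\<close>.\<close>

definition analytic_extension :: "(complex \<Rightarrow> 'b \<Rightarrow> 'b) \<Rightarrow>
    (real \<Rightarrow> 'b::real_normed_vector \<Rightarrow>\<^sub>L 'b) \<Rightarrow> bool" where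
  "analytic_extension csm U \<longleftrightarrow>
     (\<exists>\<delta> S. 0 < \<delta> \<and> \<delta> \<le> pi / 2 \<and>
        (\<forall>t>0. S (of_real t) = U t) \<and>
        (\<forall>z\<in>sector \<delta>. \<forall>c x. blinfun_apply (S z) (csm c x) = csm c (blinfun_apply (S z) x)) \<and>
        (\<forall>z\<in>sector \<delta>. \<forall>w\<in>sector \<delta>. S (z + w) = S z o\<^sub>L S w) \<and>
        (\<forall>z\<in>sector \<delta>. \<exists>L. (S has_derivative (\<lambda>h. Blinfun (csm h) o\<^sub>L L)) (at z)) \<and>
        (\<forall>x. ((\<lambda>z. blinfun_apply (S z) x) \<longlongrightarrow> x) (at 0 within sector \<delta>)))"

definition complexify_sm :: "complex \<Rightarrow> 'a::real_vector \<times> 'a \<Rightarrow> 'a \<times> 'a" where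
  "complexify_sm c p =
     (Re c *\<^sub>R fst p - Im c *\<^sub>R snd p, Re c *\<^sub>R snd p + Im c *\<^sub>R fst p)"

definition complexify_op :: "('a::real_normed_vector \<Rightarrow>\<^sub>L 'a) \<Rightarrow> ('a \<times> 'a) \<Rightarrow>\<^sub>L ('a \<times> 'a)" where
  "complexify_op B = Blinfun (map_prod (blinfun_apply B) (blinfun_apply B))"

text \<open>
  Over the reals, analyticity means analyticity of the complexified semigroup. The norm of the
  product type is not complex homogeneous, but it is equivalent to a complex norm, which is all
  that matters for the limits involved.
\<close>

definition analytic_semigroup :: "complex set \<Rightarrow> (complex \<Rightarrow> 'a \<Rightarrow> 'a) \<Rightarrow>
    (real \<Rightarrow> 'a::real_normed_vector \<Rightarrow>\<^sub>L 'a) \<Rightarrow> bool" where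
  "analytic_semigroup K sm U \<longleftrightarrow>
     C0_semigroup U \<and>
     (\<forall>t\<ge>0. \<forall>c\<in>K. \<forall>x. blinfun_apply (U t) (sm c x) = sm c (blinfun_apply (U t) x)) \<and>
     (if K = UNIV then analytic_extension sm U
      else analytic_extension complexify_sm (\<lambda>t. complexify_op (U t)))"

definition generates_analytic_semigroup :: "complex set \<Rightarrow> (complex \<Rightarrow> 'a \<Rightarrow> 'a) \<Rightarrow>
    'a::real_normed_vector set \<Rightarrow> ('a \<Rightarrow> 'a) \<Rightarrow> bool" where
  "generates_analytic_semigroup K sm D A \<longleftrightarrow>
     (\<exists>U. analytic_semigroup K sm U \<and> infinitesimal_generator U D A)"

end

theory Submission
  imports Defs
begin

text \<open>
  Solutions are obtained from the variation of constants formula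
  \<open>u t = U t u\<^sub>0 + (\<integral>\<^sub>0\<^sup>t U (t - s) (f s (u s)) ds)\<close>. Interpolating \<open>U t : E\<^sub>0 \<rightarrow> E\<^sub>0\<close> and
  \<open>U t : E\<^sub>0 \<rightarrow> E\<^sub>1\<close>, the latter of norm \<open>O(1/t)\<close> by Cauchy's estimate on a disc inside the sector, shows
  that \<open>U t\<close> maps \<open>E\<^sub>0\<close> into \<open>E\<^sub>\<theta>\<close> with norm \<open>O(t\<^sup>-\<^sup>\<theta>)\<close>, which is integrable at \<open>0\<close>. Schauder's
  theorem is avoided: with \<open>u (s - h)\<close> in place of \<open>u s\<close> on the right-hand side Picard iteration
  terminates after finitely many steps, linear growth bounds these delayed solutions independently
  of \<open>h\<close> in a weighted norm, and since \<open>U \<epsilon>\<close> is compact and their convolution parts are uniformly Hoelder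
  continuous, a subsequence converges for \<open>h \<rightarrow> 0\<close>. For \<open>g s = f s (u s)\<close> both hypotheses on \<open>f\<close> give
  \<open>\<parallel>A U (t - s) (g s - g t)\<parallel> \<le> H (t - s)\<^sup>\<kappa>\<^sup>-\<^sup>1\<close> with \<open>\<kappa> > 0\<close>: for \<open>\<gamma> > 0\<close> by interpolation, for \<open>\<gamma> = 0\<close>
  because \<open>u\<close> and hence \<open>g\<close> is Hoelder continuous away from \<open>0\<close>. So \<open>A\<close> may be applied under the integral.
\<close>

subsection \<open>Banach spaces inside an ambient Banach space\<close>

text \<open>The functors for different exponents are unrelated, so neither reiteration nor an
  inclusion between interpolation spaces can be quoted. Each space is known only through the
  semigroup: \<open>U t\<close> maps \<open>E\<^sub>0\<close> into it at a rate, and its elements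
  are approximated by \<open>U t x\<close> at a rate. Even the inclusion of
  \<open>E\<^sub>\<alpha>\<close> in \<open>E\<^sub>\<xi>\<close> is recovered in this way. All
  spaces are subsets of the type of \<open>E\<^sub>0\<close>, so integrals are taken in
  \<open>E\<^sub>0\<close> only. A convolution is placed in a smaller space by a series that
  converges absolutely there; this is the origin of the dyadic sums. Compactness is found in
  \<open>E\<^sub>0\<close> and then transferred to \<open>E\<^sub>\<xi>\<close>: a convolution that
  is uniformly small in \<open>E\<^sub>0\<close> and has a bounded forcing is small in
  \<open>E\<^sub>\<xi>\<close> too. Baire's theorem enters once, as the boundedness of inclusions
  between Banach spaces. It yields the uniform boundedness principle and the equivalence of the norm
  of \<open>E\<^sub>1\<close> with the graph norm of \<open>A\<close>.\<close>

locale banach_sub =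
  fixes Y :: "'a::real_normed_vector nspace"
  assumes zero_mem: "0 \<in> pts Y"
    and add_mem: "\<And>x y. x \<in> pts Y \<Longrightarrow> y \<in> pts Y \<Longrightarrow> x + y \<in> pts Y"
    and scale_mem: "\<And>r x. x \<in> pts Y \<Longrightarrow> r *\<^sub>R x \<in> pts Y"
    and nrm_scale: "\<And>r x. x \<in> pts Y \<Longrightarrow> nrm Y (r *\<^sub>R x) = \<bar>r\<bar> * nrm Y x"
    and nrm_add: "\<And>x y. x \<in> pts Y \<Longrightarrow> y \<in> pts Y \<Longrightarrow> nrm Y (x + y) \<le> nrm Y x + nrm Y y"
    and complete: "\<And>y. (\<And>n. y n \<in> pts Y) \<Longrightarrow>
        (\<And>e. e > 0 \<Longrightarrow> \<exists>N. \<forall>m\<ge>N. \<forall>n\<ge>N. nrm Y (y m - y n) < e) \<Longrightarrow>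
        \<exists>l\<in>pts Y. (\<lambda>n. nrm Y (y n - l)) \<longlonglongrightarrow> 0"
    and embed: "\<exists>c>0. \<forall>x\<in>pts Y. norm x \<le> c * nrm Y x"
begin

lemma minus_mem: "x \<in> pts Y \<Longrightarrow> - x \<in> pts Y"
  using scale_mem[of x "-1"] by simp

lemma diff_mem: "x \<in> pts Y \<Longrightarrow> y \<in> pts Y \<Longrightarrow> x - y \<in> pts Y"
  using add_mem[of x "-y"] minus_mem by simp

lemma sum_mem: "(\<And>i. i \<in> I \<Longrightarrow> f i \<in> pts Y) \<Longrightarrow> sum f I \<in> pts Y"
  by (induction I rule: infinite_finite_induct) (auto intro: zero_mem add_mem)

lemma nrm_zero [simp]: "nrm Y 0 = 0"
  using nrm_scale[of 0 0] zero_mem by simp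

lemma nrm_minus: "x \<in> pts Y \<Longrightarrow> nrm Y (- x) = nrm Y x"
  using nrm_scale[of x "-1"] by simp

lemma nrm_nonneg: "x \<in> pts Y \<Longrightarrow> 0 \<le> nrm Y x"
  using nrm_add[of x "-x"] minus_mem[of x] by (simp add: nrm_minus)

lemma nrm_eq_zero: "x \<in> pts Y \<Longrightarrow> nrm Y x = 0 \<Longrightarrow> x = 0"
  using embed by force

lemma nrm_diff: "x \<in> pts Y \<Longrightarrow> y \<in> pts Y \<Longrightarrow> nrm Y (x - y) \<le> nrm Y x + nrm Y y"
  using nrm_add[of x "-y"] by (simp add: nrm_minus minus_mem)

lemma nrm_diff_commute: "x \<in> pts Y \<Longrightarrow> y \<in> pts Y \<Longrightarrow> nrm Y (x - y) = nrm Y (y - x)"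
  using nrm_minus[of "x - y"] diff_mem by simp

lemma nrm_triangle: "x \<in> pts Y \<Longrightarrow> y \<in> pts Y \<Longrightarrow> z \<in> pts Y \<Longrightarrow>
    nrm Y (x - z) \<le> nrm Y (x - y) + nrm Y (y - z)"
  using nrm_add[of "x - y" "y - z"] diff_mem by simp

lemma nrm_triangle4: "x \<in> pts Y \<Longrightarrow> y \<in> pts Y \<Longrightarrow> z \<in> pts Y \<Longrightarrow> w \<in> pts Y \<Longrightarrow>
    nrm Y (x - w) \<le> nrm Y (x - y) + nrm Y (y - z) + nrm Y (z - w)"
  using nrm_triangle[of x y w] nrm_triangle[of y z w] by simp

lemma nrm_sum: "(\<And>i. i \<in> I \<Longrightarrow> f i \<in> pts Y) \<Longrightarrow> nrm Y (sum f I) \<le> (\<Sum>i\<in>I. nrm Y (f i))"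
proof (induction I rule: infinite_finite_induct)
  case (insert x F)
  then have "nrm Y (f x + sum f F) \<le> nrm Y (f x) + nrm Y (sum f F)"
    by (intro nrm_add sum_mem) auto
  with insert show ?case by force
qed auto

lemma tendsto_of_nrm:
  assumes "\<And>n. y n \<in> pts Y" "l \<in> pts Y" "(\<lambda>n. nrm Y (y n - l)) \<longlonglongrightarrow> 0"
  shows "y \<longlonglongrightarrow> l"
proof -
  obtain c where c: "c > 0" "\<forall>x\<in>pts Y. norm x \<le> c * nrm Y x" using embed by blast
  have "(\<lambda>n. c * nrm Y (y n - l)) \<longlonglongrightarrow> 0" using tendsto_mult_right_zero[OF assms(3)] .
  then have "(\<lambda>n. norm (y n - l)) \<longlonglongrightarrow> 0"
    by (rule Lim_null_comparison[rotated]) (use c assms diff_mem in auto)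
  then show ?thesis by (simp add: tendsto_norm_zero_iff LIM_zero_iff)
qed

text \<open>Absolute convergence yields a sum in the complete space \<open>Y\<close>, and the
  embedding forces it to equal the ambient sum \<open>z\<close>. Convolutions and elements of other
  interpolation spaces are placed in \<open>Y\<close> by writing them as such series.\<close>

lemma sums_in_space:
  assumes mem: "\<And>k. y k \<in> pts Y" and bd: "\<And>k. nrm Y (y k) \<le> b k" and sm: "summable b"
    and lim: "y sums z"
  shows "z \<in> pts Y" "nrm Y z \<le> suminf b"
proof -
  have b0: "b k \<ge> 0" for k using nrm_nonneg[OF mem] bd order_trans by blast
  define s where "s n = (\<Sum>k<n. y k)" for n
  have smem: "s n \<in> pts Y" for n unfolding s_def by (intro sum_mem mem)
  have diff: "nrm Y (s m - s n) \<le> norm (sum b {n..<m})" if "n \<le> m" for m n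
  proof -
    have "s m - s n = sum y {n..<m}"
      unfolding s_def using that by (simp add: sum_diff_nat_ivl lessThan_atLeast0)
    then show ?thesis using nrm_sum[of "{n..<m}" y] mem sum_mono[of "{n..<m}" "\<lambda>k. nrm Y (y k)" b] bd
      by (smt (verit) real_norm_def)
  qed
  have "\<exists>N. \<forall>m\<ge>N. \<forall>n\<ge>N. nrm Y (s m - s n) < e" if e: "e > 0" for e
  proof -
    obtain N where N: "\<And>m n. m \<ge> N \<Longrightarrow> norm (sum b {m..<n}) < e"
      using sm e unfolding summable_Cauchy by blast
    have "nrm Y (s m - s n) < e" if "m \<ge> N" "n \<ge> N" for m n
    proof (cases "n \<le> m")
      case True then show ?thesis using diff[OF True] N[OF that(2), of m] by simp
    next
      case False
      then show ?thesis using diff[of m n] N[OF that(1), of n] nrm_diff_commute[OF smem smem, of m n]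
        by simp
    qed
    then show ?thesis by blast
  qed
  then obtain l where l: "l \<in> pts Y" "(\<lambda>n. nrm Y (s n - l)) \<longlonglongrightarrow> 0"
    using complete[of s] smem by blast
  have "s \<longlonglongrightarrow> l" using tendsto_of_nrm[OF smem l] .
  moreover have "s \<longlonglongrightarrow> z" using lim unfolding sums_def s_def .
  ultimately have zl: "z = l" using LIMSEQ_unique by blast
  then show z: "z \<in> pts Y" using l by simp
  have "nrm Y z \<le> nrm Y (s n - l) + suminf b" for n
  proof -
    have "nrm Y z \<le> nrm Y (z - s n) + nrm Y (s n)"
      using nrm_add[of "z - s n" "s n"] diff_mem smem z by simp
    also have "nrm Y (s n) \<le> sum b {..<n}"
      unfolding s_def using nrm_sum[of "{..<n}" y] mem sum_mono[of "{..<n}" "\<lambda>k. nrm Y (y k)" b] bd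
      by (smt (verit))
    also have "sum b {..<n} \<le> suminf b" using sm b0 by (intro sum_le_suminf) auto
    finally show ?thesis using nrm_diff_commute[OF z smem] zl by simp
  qed
  moreover have "(\<lambda>n. nrm Y (s n - l) + suminf b) \<longlonglongrightarrow> 0 + suminf b"
    using l by (intro tendsto_intros)
  ultimately show "nrm Y z \<le> suminf b"
    using LIMSEQ_le_const by (metis (lifting) add_0)
qed

sublocale M: Metric_space "pts Y" "ndist Y"
proof
  fix x y z
  show "0 \<le> ndist Y x y" by (simp add: ndist_def nrm_nonneg diff_mem)
  show "ndist Y x y = ndist Y y x" by (simp add: ndist_def nrm_diff_commute)
  assume xy: "x \<in> pts Y" "y \<in> pts Y"
  show "(ndist Y x y = 0) = (x = y)"
    using xy nrm_eq_zero[of "x - y"] diff_mem by (auto simp: ndist_def)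
  assume "z \<in> pts Y"
  then show "ndist Y x z \<le> ndist Y x y + ndist Y y z"
    using xy nrm_triangle by (simp add: ndist_def)
qed

lemma ntop_eq: "ntop Y = M.mtopology"
  by (simp add: ntop_def)

lemma limitin_iff: "limitin (ntop Y) y l sequentially \<longleftrightarrow>
    l \<in> pts Y \<and> (\<exists>N. \<forall>n\<ge>N. y n \<in> pts Y) \<and> (\<lambda>n. nrm Y (y n - l)) \<longlonglongrightarrow> 0"
proof
  assume lim: "limitin (ntop Y) y l sequentially"
  then have l: "l \<in> pts Y" and ex: "\<And>e. e > 0 \<Longrightarrow> \<exists>N. \<forall>n\<ge>N. y n \<in> pts Y \<and> ndist Y (y n) l < e"
    unfolding ntop_eq M.limit_metric_sequentially by auto
  have "(\<lambda>n. nrm Y (y n - l)) \<longlonglongrightarrow> 0"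
  proof (rule LIMSEQ_I)
    fix r :: real assume "r > 0"
    then obtain N where "\<forall>n\<ge>N. y n \<in> pts Y \<and> ndist Y (y n) l < r" using ex by blast
    then show "\<exists>no. \<forall>n\<ge>no. norm (nrm Y (y n - l) - 0) < r"
      using l nrm_nonneg diff_mem by (intro exI[of _ N]) (auto simp: ndist_def)
  qed
  with l ex[of 1] show "l \<in> pts Y \<and> (\<exists>N. \<forall>n\<ge>N. y n \<in> pts Y) \<and> (\<lambda>n. nrm Y (y n - l)) \<longlonglongrightarrow> 0"
    by auto
next
  assume a: "l \<in> pts Y \<and> (\<exists>N. \<forall>n\<ge>N. y n \<in> pts Y) \<and> (\<lambda>n. nrm Y (y n - l)) \<longlonglongrightarrow> 0"
  then obtain N where N: "\<forall>n\<ge>N. y n \<in> pts Y" by blast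
  have "\<exists>N. \<forall>n\<ge>N. y n \<in> pts Y \<and> ndist Y (y n) l < e" if "e > 0" for e
  proof -
    from a have "(\<lambda>n. nrm Y (y n - l)) \<longlonglongrightarrow> 0" by blast
    from LIMSEQ_D[OF this that] obtain N' where "\<forall>n\<ge>N'. norm (nrm Y (y n - l) - 0) < e" ..
    then show ?thesis using N a by (intro exI[of _ "max N N'"]) (auto simp: ndist_def)
  qed
  then show "limitin (ntop Y) y l sequentially"
    unfolding ntop_eq M.limit_metric_sequentially using a by auto
qed

lemma mcomplete: "M.mcomplete"
  unfolding M.mcomplete_def
proof (intro allI impI)
  fix \<sigma> assume s: "M.MCauchy \<sigma>"
  then have mem: "\<And>n. \<sigma> n \<in> pts Y" unfolding M.MCauchy_def by auto
  have "\<exists>l\<in>pts Y. (\<lambda>n. nrm Y (\<sigma> n - l)) \<longlonglongrightarrow> 0"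
    by (rule complete[OF mem]) (use s mem in \<open>auto simp: M.MCauchy_def ndist_def\<close>)
  then show "\<exists>x. limitin M.mtopology \<sigma> x sequentially"
    using limitin_iff mem unfolding ntop_eq by blast
qed

lemma closure_of_D:
  assumes "x \<in> ntop Y closure_of S" "e > 0"
  obtains y where "y \<in> S" "y \<in> pts Y" "nrm Y (x - y) < e"
proof -
  obtain y where "y \<in> S" "y \<in> M.mball x e"
    using assms unfolding ntop_eq M.metric_closure_of by blast
  then show ?thesis using that by (auto simp: ndist_def M.in_mball)
qed

lemma topspace_ntop [simp]: "topspace (ntop Y) = pts Y"
  by (simp add: ntop_eq)

lemma continuous_map_iff:
  fixes S :: "real set"
  shows "continuous_map (top_of_set S) (ntop Y) u \<longleftrightarrow>
    (\<forall>t\<in>S. u t \<in> pts Y) \<and>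
    (\<forall>t\<in>S. \<forall>e>0. \<exists>d>0. \<forall>s\<in>S. \<bar>s - t\<bar> < d \<longrightarrow> nrm Y (u s - u t) < e)" (is "?L \<longleftrightarrow> ?R")
proof
  assume L: ?L
  then have mem: "\<forall>t\<in>S. u t \<in> pts Y" unfolding continuous_map_def by auto
  have "\<exists>d>0. \<forall>s\<in>S. \<bar>s - t\<bar> < d \<longrightarrow> nrm Y (u s - u t) < e" if "t \<in> S" "e > 0" for t e
  proof -
    have "\<exists>W. openin (top_of_set S) W \<and> t \<in> W \<and> (\<forall>s\<in>W. u s \<in> M.mball (u t) e)"
      using L that unfolding ntop_eq M.continuous_map_to_metric topspace_euclidean_subtopology by simp
    then obtain W where W: "openin (top_of_set S) W" "t \<in> W" "\<forall>s\<in>W. u s \<in> M.mball (u t) e"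
      by blast
    then obtain d where d: "d > 0" "ball t d \<inter> S \<subseteq> W"
      unfolding openin_contains_ball by auto
    show ?thesis
    proof (intro exI[of _ d] conjI ballI impI d)
      fix s assume "s \<in> S" "\<bar>s - t\<bar> < d"
      then have "s \<in> W" using d by (auto simp: dist_real_def)
      then show "nrm Y (u s - u t) < e"
        using W mem \<open>s \<in> S\<close> that nrm_diff_commute by (auto simp: M.in_mball ndist_def)
    qed
  qed
  with mem show ?R by blast
next
  assume R: ?R
  show ?L unfolding ntop_eq M.continuous_map_to_metric
  proof (intro ballI allI impI)
    fix t e :: real assume "t \<in> topspace (top_of_set S)" "e > 0"
    then have t: "t \<in> S" by simp
    then obtain d where d: "d > 0" "\<forall>s\<in>S. \<bar>s - t\<bar> < d \<longrightarrow> nrm Y (u s - u t) < e"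
      using R \<open>e > 0\<close> by blast
    show "\<exists>U. openin (top_of_set S) U \<and> t \<in> U \<and> (\<forall>y\<in>U. u y \<in> M.mball (u t) e)"
      using d R t nrm_diff_commute
      by (intro exI[of _ "S \<inter> ball t d"])
         (auto simp: M.in_mball ndist_def dist_real_def openin_open abs_minus_commute)
  qed
qed

end

text \<open>The closed graph theorem for the inclusion: its graph is closed because both spaces are
  continuously embedded in the ambient space.\<close>

theorem inclusion_bounded:
  fixes X Y :: "'a::real_normed_vector nspace"
  assumes X: "banach_sub X" and Y: "banach_sub Y" and sub: "pts X \<subseteq> pts Y"
  shows "\<exists>C>0. \<forall>x\<in>pts X. nrm Y x \<le> C * nrm X x"
proof -
  interpret X: banach_sub X by fact
  interpret Y: banach_sub Y by fact
  \<comment> \<open>Baire category: the closures of the sublevel sets of \<open>nrm Y\<close> cover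
    the complete space \<open>X\<close>, so one of them has interior.\<close>
  define W where "W n = {x \<in> pts X. nrm Y x \<le> real n}" for n
  define G where "G = range (\<lambda>n. ntop X closure_of W n)"
  have un: "\<Union>G = pts X"
  proof
    show "\<Union>G \<subseteq> pts X" unfolding G_def using closure_of_subset_topspace[of "ntop X"] by auto
    show "pts X \<subseteq> \<Union>G"
    proof
      fix x assume x: "x \<in> pts X"
      obtain n where "nrm Y x \<le> real n" using real_arch_simple by blast
      then have "x \<in> W n" using x by (simp add: W_def)
      then have "x \<in> ntop X closure_of W n"
        using closure_of_subset[of "W n" "ntop X"] by (auto simp: W_def)
      then show "x \<in> \<Union>G" by (auto simp: G_def)
    qed
  qed
  have "\<exists>n. ntop X interior_of (ntop X closure_of W n) \<noteq> {}"
  proof (rule ccontr)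
    assume "\<nexists>n. ntop X interior_of (ntop X closure_of W n) \<noteq> {}"
    then have "ntop X interior_of \<Union>G = {}"
      unfolding X.ntop_eq by (intro X.M.metric_Baire_category_alt X.mcomplete) (auto simp: G_def X.ntop_eq)
    then have "pts X = {}" using un interior_of_topspace[of "ntop X"] by simp
    then show False using X.zero_mem by auto
  qed
  then obtain n x0 where "x0 \<in> ntop X interior_of (ntop X closure_of W n)" by blast
  then obtain r where x0: "x0 \<in> pts X" and r: "r > 0"
      "X.M.mball x0 r \<subseteq> ntop X closure_of W n"
    unfolding X.ntop_eq X.M.in_interior_of_mball by blast
  define K where "K = 4 * real n / r"
  have K0: "K \<ge> 0" using r by (simp add: K_def)
  have near: "x \<in> ntop X closure_of W n" if "x \<in> pts X" "nrm X (x0 - x) < r" for x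
    using r that x0 by (auto simp: X.M.in_mball ndist_def)
  \<comment> \<open>Taking differences of two approximants moves the centre from \<open>x0\<close>
    to the origin and doubles the level \<open>n\<close>. So far this only approximates
    \<open>x\<close>; it does not bound \<open>nrm Y x\<close>.\<close>
  have ball: "\<exists>y\<in>pts X. nrm Y y \<le> 2 * real n \<and> nrm X (x - y) < e"
    if x: "x \<in> pts X" "nrm X x < r" and e: "e > 0" for x e
  proof -
    have "x0 + x \<in> ntop X closure_of W n"
      using near[of "x0 + x"] x x0 X.add_mem by (simp add: X.nrm_minus)
    then obtain a where a: "a \<in> W n" "nrm X (x0 + x - a) < e / 2"
      using X.closure_of_D e by (metis half_gt_zero)
    have "x0 \<in> ntop X closure_of W n"
      using near[of x0] x0 r by simp
    then obtain b where b: "b \<in> W n" "nrm X (x0 - b) < e / 2"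
      using X.closure_of_D e by (metis half_gt_zero)
    have m: "a \<in> pts X" "b \<in> pts X" "a \<in> pts Y" "b \<in> pts Y"
      and nn: "nrm Y a \<le> n" "nrm Y b \<le> n" using a b sub by (auto simp: W_def)
    have "nrm Y (a - b) \<le> 2 * real n" using Y.nrm_diff[OF m(3,4)] nn by simp
    moreover have "nrm X (x - (a - b)) \<le> nrm X (x0 + x - a) + nrm X (x0 - b)"
      using X.nrm_diff[of "x0 + x - a" "x0 - b"] x x0 m X.diff_mem X.add_mem
      by (simp add: algebra_simps)
    ultimately show ?thesis using a b m X.diff_mem by (intro bexI[of _ "a - b"]) auto
  qed
  \<comment> \<open>Scale \<open>x\<close> to norm \<open>r / 2\<close>, approximate it within
    \<open>r / 4\<close> and scale back: the error is half of the norm of \<open>x\<close>, and the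
    level \<open>2 * n\<close> becomes \<open>K\<close> times that norm.\<close>
  have step: "\<exists>y\<in>pts X. nrm Y y \<le> K * nrm X x \<and> nrm X (x - y) \<le> nrm X x / 2"
    if x: "x \<in> pts X" for x
  proof (cases "x = 0")
    case True
    then show ?thesis using X.zero_mem by (intro bexI[of _ 0]) auto
  next
    case False
    then have p: "nrm X x > 0" using X.nrm_eq_zero X.nrm_nonneg x by force
    define s where "s = r / (2 * nrm X x)"
    have s: "s > 0" using p r by (simp add: s_def)
    have sx: "s *\<^sub>R x \<in> pts X" "nrm X (s *\<^sub>R x) = r / 2"
      using x s p X.scale_mem X.nrm_scale[of x s] r by (auto simp: s_def)
    then obtain y where y: "y \<in> pts X" "nrm Y y \<le> 2 * real n" "nrm X (s *\<^sub>R x - y) < r / 4"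
      using ball[of "s *\<^sub>R x" "r/4"] r by auto
    define z where "z = (1/s) *\<^sub>R y"
    have zx: "x - z = (1/s) *\<^sub>R (s *\<^sub>R x - y)" using s by (simp add: z_def algebra_simps)
    have "nrm Y z = nrm Y y / s" using Y.nrm_scale[of y "1/s"] y sub s by (auto simp: z_def)
    also have "\<dots> \<le> 2 * real n / s" using y s by (simp add: divide_right_mono)
    also have "\<dots> = K * nrm X x" using p r by (simp add: s_def K_def)
    finally have 1: "nrm Y z \<le> K * nrm X x" .
    have "nrm X (x - z) = nrm X (s *\<^sub>R x - y) / s"
      unfolding zx using X.nrm_scale[of "s *\<^sub>R x - y" "1/s"] X.diff_mem sx y s by auto
    also have "\<dots> \<le> (r/4) / s" using y s by (intro divide_right_mono) auto
    also have "\<dots> = nrm X x / 2" using p r by (simp add: s_def)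
    finally have 2: "nrm X (x - z) \<le> nrm X x / 2" .
    show ?thesis using 1 2 y X.scale_mem by (intro bexI[of _ z]) (auto simp: z_def)
  qed
  then obtain P where P: "\<And>x. x \<in> pts X \<Longrightarrow> P x \<in> pts X \<and> nrm Y (P x) \<le> K * nrm X x \<and>
      nrm X (x - P x) \<le> nrm X x / 2" by metis
  \<comment> \<open>Approximating the remainder again and again expands \<open>x\<close> into a
    series whose bounds in \<open>nrm Y\<close> halve. Completeness of \<open>Y\<close> sums it, and
    the geometric series contributes the factor \<open>2\<close>.\<close>
  have main: "nrm Y x \<le> 2 * K * nrm X x" if x: "x \<in> pts X" for x
  proof -
    define R where "R k = ((\<lambda>z. z - P z) ^^ k) x" for k
    have R0: "R 0 = x" and RS: "R (Suc k) = R k - P (R k)" for k by (auto simp: R_def)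
    have Rm: "R k \<in> pts X" for k by (induction k) (auto simp: R0 RS x P X.diff_mem)
    have Rn: "nrm X (R k) \<le> nrm X x * (1/2)^k" for k
    proof (induction k)
      case (Suc k)
      have "nrm X (R (Suc k)) \<le> nrm X (R k) / 2" using P[OF Rm] by (simp add: RS)
      with Suc show ?case by simp
    qed (simp add: R0)
    have part: "(\<Sum>i<k. P (R i)) = x - R k" for k
      by (induction k) (auto simp: R0 RS)
    have "(\<lambda>k. nrm X (R k - 0)) \<longlonglongrightarrow> 0"
    proof (rule Lim_null_comparison)
      show "\<forall>\<^sub>F k in sequentially. norm (nrm X (R k - 0)) \<le> nrm X x * (1/2)^k"
        using Rn Rm X.nrm_nonneg by auto
      show "(\<lambda>k. nrm X x * (1/2)^k) \<longlonglongrightarrow> 0"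
        by (intro tendsto_mult_right_zero LIMSEQ_power_zero) auto
    qed
    then have "R \<longlonglongrightarrow> 0" using X.tendsto_of_nrm[of R 0] Rm X.zero_mem by blast
    then have "(\<lambda>k. P (R k)) sums x"
      unfolding sums_def part using tendsto_diff[of "\<lambda>_. x" x sequentially R 0] by auto
    moreover have "nrm Y (P (R k)) \<le> K * nrm X x * (1/2)^k" for k
    proof -
      have "nrm Y (P (R k)) \<le> K * nrm X (R k)" using P[OF Rm] by blast
      also have "\<dots> \<le> K * (nrm X x * (1/2)^k)" using Rn K0 by (intro mult_left_mono)
      finally show ?thesis by simp
    qed
    moreover have "(\<lambda>k. K * nrm X x * (1/2)^k) sums (K * nrm X x * 2)"
      using sums_mult[OF geometric_sums[of "1/2::real"]] by simp
    ultimately show ?thesis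
      using Y.sums_in_space(2)[of "\<lambda>k. P (R k)" "\<lambda>k. K * nrm X x * (1/2)^k" x] P Rm sub
      by (auto simp: sums_iff mult_ac)
  qed
  show ?thesis
  proof (intro exI[of _ "2 * K + 1"] conjI ballI)
    show "2 * K + 1 > 0" using K0 by simp
    fix x assume "x \<in> pts X"
    then show "nrm Y x \<le> (2 * K + 1) * nrm X x"
      using main[of x] X.nrm_nonneg[of x] by (simp add: algebra_simps)
  qed
qed

text \<open>Adding the supremum \<open>p\<close> of the seminorms to the norm gives a second
  complete norm on the same space. The bounded inclusion theorem compares the two, and the
  comparison is the uniform bound.\<close>

theorem uniform_boundedness:
  fixes B :: "'i \<Rightarrow> 'a::banach \<Rightarrow>\<^sub>L 'b::real_normed_vector"
  assumes pt: "\<And>x. bdd_above ((\<lambda>i. norm (B i x)) ` I)"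
  shows "\<exists>M>0. \<forall>i\<in>I. norm (B i) \<le> M"
proof (cases "I = {}")
  case True then show ?thesis by (auto intro: exI[of _ 1])
next
  case False
  define p where "p x = (SUP i\<in>I. norm (B i x))" for x
  have le: "norm (B i x) \<le> p x" if "i \<in> I" for i x
    unfolding p_def using that pt by (intro cSUP_upper)
  have leI: "p x \<le> b" if "\<And>i. i \<in> I \<Longrightarrow> norm (B i x) \<le> b" for x b
    unfolding p_def using that False by (intro cSUP_least)
  have p0: "p x \<ge> 0" for x using False le[of _ x] norm_ge_zero order_trans by (metis ex_in_conv)
  have padd: "p (x + y) \<le> p x + p y" for x y
    by (rule leI) (smt (verit) blinfun.add_right norm_triangle_ineq le)
  have pscale: "p (r *\<^sub>R x) = \<bar>r\<bar> * p x" for r x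
  proof (cases "r = 0")
    case True
    have "p 0 \<le> 0" by (rule leI) (simp add: blinfun.zero_right)
    with True p0[of 0] show ?thesis by simp
  next
    case r: False
    have 1: "p (r *\<^sub>R x) \<le> \<bar>r\<bar> * p x" for r x
      by (rule leI) (simp add: blinfun.scaleR_right mult_left_mono le)
    have "p x \<le> \<bar>1/r\<bar> * p (r *\<^sub>R x)" using 1[of "1/r" "r *\<^sub>R x"] r by simp
    then have "\<bar>r\<bar> * p x \<le> \<bar>r\<bar> * (\<bar>1/r\<bar> * p (r *\<^sub>R x))" by (intro mult_left_mono) auto
    with r 1[of r x] show ?thesis by (simp add: abs_divide)
  qed
  define X where "X = \<lparr>pts = (UNIV::'a set), nrm = norm\<rparr>"
  define Y where "Y = \<lparr>pts = (UNIV::'a set), nrm = (\<lambda>x. norm x + p x)\<rparr>"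
  have X: "banach_sub X"
  proof
    fix y :: "nat \<Rightarrow> 'a" assume "\<And>e. e > 0 \<Longrightarrow> \<exists>N. \<forall>m\<ge>N. \<forall>n\<ge>N. nrm X (y m - y n) < e"
    then have "Cauchy y" by (auto simp: X_def intro!: CauchyI)
    then obtain l where "y \<longlonglongrightarrow> l" using Cauchy_convergent convergent_def by blast
    then show "\<exists>l\<in>pts X. (\<lambda>n. nrm X (y n - l)) \<longlonglongrightarrow> 0"
      by (intro bexI[of _ l]) (auto simp: X_def tendsto_norm_zero_iff LIM_zero_iff)
  qed (auto simp: X_def norm_triangle_ineq intro: exI[of _ 1])
  have Y: "banach_sub Y"
  proof
    fix y :: "nat \<Rightarrow> 'a" assume C: "\<And>e. e > 0 \<Longrightarrow> \<exists>N. \<forall>m\<ge>N. \<forall>n\<ge>N. nrm Y (y m - y n) < e"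
    have "Cauchy y"
    proof (rule CauchyI)
      fix e :: real assume "e > 0"
      then obtain N where N: "\<forall>m\<ge>N. \<forall>n\<ge>N. norm (y m - y n) + p (y m - y n) < e"
        using C[of e] by (auto simp: Y_def)
      show "\<exists>M. \<forall>m\<ge>M. \<forall>n\<ge>M. norm (y m - y n) < e"
        using N p0 by (intro exI[of _ N]) (smt (verit))
    qed
    then obtain l where l: "y \<longlonglongrightarrow> l" using Cauchy_convergent convergent_def by blast
    \<comment> \<open>\<open>p\<close> is not known to be continuous, but it is a supremum of
      continuous seminorms: for each index the bound on \<open>y m - y n\<close> passes to the limit
      in \<open>n\<close>, and only then is the supremum taken.\<close>
    have "(\<lambda>n. p (y n - l)) \<longlonglongrightarrow> 0"
    proof (rule LIMSEQ_I)
      fix r :: real assume "r > 0"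
      then obtain N where N: "\<forall>m\<ge>N. \<forall>n\<ge>N. norm (y m - y n) + p (y m - y n) < r / 2"
        using C[of "r/2"] by (auto simp: Y_def)
      have "p (y m - l) \<le> r / 2" if m: "m \<ge> N" for m
      proof (rule leI)
        fix i assume i: "i \<in> I"
        have "(\<lambda>n. norm (B i (y m - y n))) \<longlonglongrightarrow> norm (B i (y m - l))"
          by (intro tendsto_intros l)
        moreover have "\<forall>n\<ge>N. norm (B i (y m - y n)) \<le> r / 2"
          using N m le[OF i] by (smt (verit) norm_ge_zero)
        ultimately show "norm (B i (y m - l)) \<le> r / 2"
          by (meson LIMSEQ_le_const2)
      qed
      then show "\<exists>no. \<forall>n\<ge>no. norm (p (y n - l) - 0) < r"
        using p0 \<open>r > 0\<close> by (intro exI[of _ N]) (smt (verit) field_sum_of_halves real_norm_def)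
    qed
    moreover have "(\<lambda>n. norm (y n - l)) \<longlonglongrightarrow> 0" using l by (simp add: tendsto_norm_zero_iff LIM_zero_iff)
    ultimately show "\<exists>l\<in>pts Y. (\<lambda>n. nrm Y (y n - l)) \<longlonglongrightarrow> 0"
      using tendsto_add[of _ 0 _ _ 0] by (intro bexI[of _ l]) (fastforce simp: Y_def)+
  next
    show "nrm Y (x + y) \<le> nrm Y x + nrm Y y" for x y
      using norm_triangle_ineq[of x y] padd[of x y] by (simp add: Y_def)
    show "\<exists>c>0. \<forall>x\<in>pts Y. norm x \<le> c * nrm Y x"
      by (rule exI[of _ 1]) (auto simp: Y_def p0)
  qed (auto simp: Y_def pscale distrib_left)
  obtain C where C: "C > 0" "\<And>x. norm x + p x \<le> C * norm x"
    using inclusion_bounded[OF X Y] by (auto simp: X_def Y_def)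
  have "norm (B i) \<le> C" if "i \<in> I" for i
    using C le[OF that] by (intro norm_blinfun_bound) (smt (verit) norm_ge_zero)+
  with C show ?thesis by blast
qed

subsection \<open>Derivative estimate for analytic semigroups\<close>

lemma has_vector_derivative_cis [derivative_intros]:
  "(cis has_vector_derivative \<i> * cis x) (at x within S)"
  unfolding has_vector_derivative_def by (auto intro!: derivative_eq_intros)

text \<open>The scalar multiplication is bounded bilinear, and the norm may fail to be complex
  homogeneous, because a complexified real space carries the product norm. The constant this costs
  is the \<open>K\<close> of the Cauchy estimate.\<close>

locale complex_action = bounded_bilinear csm
  for csm :: "complex \<Rightarrow> 'b::banach \<Rightarrow> 'b" +
  assumes csm_one: "csm 1 x = x"
    and csm_mult: "csm (a * b) x = csm a (csm b x)"
begin

lemma csm_inverse: "c \<noteq> 0 \<Longrightarrow> csm (1 / c) (csm c x) = x"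
  using csm_mult[of "1/c" c x] by (simp add: csm_one)

lemma csm_eq_0: "c \<noteq> 0 \<Longrightarrow> csm c x = 0 \<Longrightarrow> x = 0"
  using csm_inverse[of c x] zero_right by metis

lemma has_vector_derivative_circle:
  assumes "(F has_derivative (\<lambda>h. csm h y)) (at (a + of_real r * cis \<phi>))"
  shows "((\<lambda>\<phi>. F (a + of_real r * cis \<phi>)) has_vector_derivative csm (\<i> * of_real r * cis \<phi>) y)
           (at \<phi> within S)"
proof -
  have "((\<lambda>\<phi>. a + of_real r * cis \<phi>) has_vector_derivative (of_real r * (\<i> * cis \<phi>))) (at \<phi> within S)"
    by (auto intro!: derivative_eq_intros has_vector_derivative_mult_right)
  from vector_derivative_diff_chain_within[OF this, of F "\<lambda>h. csm h y"] assms
  show ?thesis by (simp add: o_def mult_ac has_derivative_at_withinI)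
qed

text \<open>The integral over the circle of radius \<open>s * \<rho>\<close> is differentiated in
  \<open>s\<close>. The derivative vanishes, and \<open>s = 1\<close> is compared with
  \<open>s = 0\<close>, where the circle is the point \<open>a\<close>.\<close>

lemma mean_value:
  assumes \<rho>: "\<rho> > 0"
    and F: "\<And>z. z \<in> cball a \<rho> \<Longrightarrow> (F has_derivative (\<lambda>h. csm h (G z))) (at z)"
    and G: "continuous_on (cball a \<rho>) G"
  shows "integral {0..2*pi} (\<lambda>\<phi>. F (a + of_real \<rho> * cis \<phi>)) = (2 * pi) *\<^sub>R F a"
proof -
  define p where "p s \<phi> = a + of_real (s * \<rho>) * cis \<phi>" for s \<phi>
  have pin: "p s \<phi> \<in> cball a \<rho>" if "s \<in> {0..1}" for s \<phi>
    using that \<rho> by (auto simp: p_def dist_norm norm_mult mult_le_cancel_right1)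
  have Fcont: "continuous_on (cball a \<rho>) F"
    using F has_derivative_continuous continuous_at_imp_continuous_on by blast
  define fx where "fx s \<phi> = csm (of_real \<rho> * cis \<phi>) (G (p s \<phi>))" for s \<phi>
  have pcont: "continuous_on A (\<lambda>(s,\<phi>). p s \<phi>)" for A
    unfolding p_def split_def by (intro continuous_intros)
  have d1: "((\<lambda>s. F (p s \<phi>)) has_vector_derivative fx s \<phi>) (at s within {0..1})" if "s \<in> {0..1}" for s \<phi>
  proof -
    have "((\<lambda>s. p s \<phi>) has_vector_derivative (of_real \<rho> * cis \<phi>)) (at s within {0..1})"
      unfolding has_vector_derivative_def p_def
      by (auto intro!: derivative_eq_intros simp: scaleR_conv_of_real mult_ac)
    from vector_derivative_diff_chain_within[OF this, of F "\<lambda>h. csm h (G (p s \<phi>))"] F[OF pin[OF that]]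
    show ?thesis by (simp add: o_def fx_def has_derivative_at_withinI)
  qed
  have int: "(\<lambda>\<phi>. F (p s \<phi>)) integrable_on cbox 0 (2*pi)" if "s \<in> {0..1}" for s
  proof -
    have "continuous_on {0..2*pi} (\<lambda>\<phi>. F (p s \<phi>))"
      by (rule continuous_on_compose2[OF Fcont])
         (use pin that in \<open>auto simp: p_def intro!: continuous_intros\<close>)
    then show ?thesis by (simp add: integrable_continuous_real)
  qed
  have fxc: "continuous_on ({0..1} \<times> cbox 0 (2*pi)) (\<lambda>(s,\<phi>). fx s \<phi>)"
    unfolding fx_def split_def
    by (intro continuous_on continuous_on_compose2[OF G] continuous_intros
          pcont[unfolded split_def]) (use pin in auto)
  \<comment> \<open>Multiplied by \<open>\<i> * s\<close>, the radial derivative becomes the angular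
    one, which integrates to zero over a full turn. At \<open>s = 0\<close> this factor is not
    invertible, but the integrand is then a fixed vector scaled by a multiple of
    \<open>cis \<phi>\<close> and has a periodic primitive.\<close>
  have zero: "integral {0..2*pi} (fx s) = 0" if s: "s \<in> {0..1}" for s
  proof (cases "s = 0")
    case True
    have "(fx s has_integral (csm (- \<i> * of_real \<rho> * cis (2*pi)) (G a) - csm (- \<i> * of_real \<rho> * cis 0) (G a))) {0..2*pi}"
    proof (rule fundamental_theorem_of_calculus)
      fix \<phi> :: real
      have "((\<lambda>\<phi>. - \<i> * of_real \<rho> * cis \<phi>) has_vector_derivative (of_real \<rho> * cis \<phi>)) (at \<phi> within {0..2*pi})"
        using has_vector_derivative_mult_right[OF has_vector_derivative_cis, of "- \<i> * of_real \<rho>" \<phi>]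
        by (simp add: mult_ac)
      from bounded_linear.has_vector_derivative[OF bounded_linear_left this]
      show "((\<lambda>\<phi>. csm (- \<i> * of_real \<rho> * cis \<phi>) (G a)) has_vector_derivative fx s \<phi>) (at \<phi> within {0..2*pi})"
        using True by (simp add: fx_def p_def)
    qed simp
    then show ?thesis by (simp add: integral_unique)
  next
    case False
    have "((\<lambda>\<phi>. csm (\<i> * of_real s) (fx s \<phi>)) has_integral (F (p s (2*pi)) - F (p s 0))) {0..2*pi}"
    proof (rule fundamental_theorem_of_calculus)
      fix \<phi> :: real
      have "((\<lambda>\<phi>. F (p s \<phi>)) has_vector_derivative csm (\<i> * of_real (s * \<rho>) * cis \<phi>) (G (p s \<phi>))) (at \<phi> within {0..2*pi})"
        unfolding p_def
        by (rule has_vector_derivative_circle) (use F[OF pin[OF s]] in \<open>simp add: p_def\<close>)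
      then show "((\<lambda>\<phi>. F (p s \<phi>)) has_vector_derivative csm (\<i> * of_real s) (fx s \<phi>)) (at \<phi> within {0..2*pi})"
        unfolding fx_def csm_mult[symmetric] by (simp add: mult_ac)
    qed simp
    then have 0: "integral {0..2*pi} (\<lambda>\<phi>. csm (\<i> * of_real s) (fx s \<phi>)) = 0"
      by (simp add: p_def integral_unique)
    have "continuous_on {0..2*pi} (fx s)"
      by (rule continuous_on_compose2[OF fxc, of _ "\<lambda>\<phi>. (s, \<phi>)", simplified])
         (use s in \<open>auto intro!: continuous_intros\<close>)
    then have "fx s integrable_on {0..2*pi}" by (rule integrable_continuous_real)
    from integral_linear[OF this bounded_linear_right, of "\<i> * of_real s"] 0
    have "csm (\<i> * of_real s) (integral {0..2*pi} (fx s)) = 0" by (simp add: o_def)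
    then show ?thesis using csm_eq_0[of "\<i> * of_real s"] False by simp
  qed
  have "\<exists>c. \<forall>s\<in>{0..1}. integral {0..2*pi} (\<lambda>\<phi>. F (p s \<phi>)) = c"
  proof -
    have "((\<lambda>s. integral {0..2*pi} (\<lambda>\<phi>. F (p s \<phi>))) has_vector_derivative 0) (at s within {0..1})"
      if s: "s \<in> {0..1}" for s
      using leibniz_rule_vector_derivative[of "{0..1}" 0 "2*pi" "\<lambda>s \<phi>. F (p s \<phi>)" fx s, OF d1 int fxc s]
        zero[OF s] by simp
    then show ?thesis
      using has_vector_derivative_zero_constant[of "{0..1::real}" "\<lambda>s. integral {0..2*pi} (\<lambda>\<phi>. F (p s \<phi>))"]
      by (metis convex_real_interval(5))
  qed
  then obtain c where c: "\<And>s. s \<in> {0..1} \<Longrightarrow> integral {0..2*pi} (\<lambda>\<phi>. F (p s \<phi>)) = c" by blast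
  from c[of 0] c[of 1] show ?thesis by (simp add: p_def)
qed

text \<open>\<open>F a\<close> is the mean of \<open>F\<close> over the circle. There
  \<open>F\<close> is the angular derivative of the bounded function \<open>Q\<close>, up to
  \<open>cis (- \<phi>)\<close> and the radius, so integration by parts removes the derivative and
  leaves a division by \<open>\<rho>\<close>. One factor \<open>K\<close> comes from bounding the
  integrand, the other from inverting the multiplication by \<open>\<i> * \<rho>\<close>.\<close>

lemma cauchy_estimate:
  assumes K: "K > 0" "\<And>c x. norm (csm c x) \<le> cmod c * norm x * K"
    and \<rho>: "\<rho> > 0"
    and Q: "\<And>z. z \<in> cball a \<rho> \<Longrightarrow> (Q has_derivative (\<lambda>h. csm h (F z))) (at z)"
    and F: "\<And>z. z \<in> cball a \<rho> \<Longrightarrow> (F has_derivative (\<lambda>h. csm h (G z))) (at z)"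
    and G: "continuous_on (cball a \<rho>) G"
    and bd: "\<And>z. z \<in> cball a \<rho> \<Longrightarrow> norm (Q z) \<le> B"
  shows "norm (F a) \<le> K^2 * B / \<rho>"
proof -
  define p where "p \<phi> = a + of_real \<rho> * cis \<phi>" for \<phi>
  have pin: "p \<phi> \<in> cball a \<rho>" for \<phi> using \<rho> by (auto simp: p_def dist_norm norm_mult)
  have Fcont: "continuous_on (cball a \<rho>) F" and Qcont: "continuous_on (cball a \<rho>) Q"
    by (meson F Q has_derivative_continuous continuous_at_imp_continuous_on)+
  have pc: "continuous_on S p" for S unfolding p_def by (intro continuous_intros)
  have Fp: "continuous_on S (\<lambda>\<phi>. F (p \<phi>))" and Qp: "continuous_on S (\<lambda>\<phi>. Q (p \<phi>))" for S
    using pin by (auto intro!: continuous_on_compose2[OF Fcont pc] continuous_on_compose2[OF Qcont pc])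
  have iF: "(\<lambda>\<phi>. F (p \<phi>)) integrable_on {0..2*pi}"
    by (intro integrable_continuous_real Fp)
  have iFc: "(\<lambda>\<phi>. csm (\<i> * of_real \<rho>) (F (p \<phi>))) integrable_on {0..2*pi}"
    by (intro integrable_continuous_real continuous_on Fp continuous_intros)
  have iQ: "(\<lambda>\<phi>. csm (\<i> * cis (- \<phi>)) (Q (p \<phi>))) integrable_on {0..2*pi}"
    by (intro integrable_continuous_real continuous_on Qp continuous_intros)
  \<comment> \<open>Product rule for \<open>cis (- \<phi>)\<close> and \<open>Q (p \<phi>)\<close>;
    the boundary terms agree because both factors have period \<open>2 * pi\<close>.\<close>
  have "((\<lambda>\<phi>. csm (\<i> * of_real \<rho>) (F (p \<phi>)) - csm (\<i> * cis (- \<phi>)) (Q (p \<phi>)))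
      has_integral (csm (cis (- (2*pi))) (Q (p (2*pi))) - csm (cis (- 0)) (Q (p 0)))) {0..2*pi}"
  proof (rule fundamental_theorem_of_calculus)
    fix \<phi> :: real
    have 1: "((\<lambda>\<phi>. cis (- \<phi>)) has_vector_derivative (- \<i> * cis (- \<phi>))) (at \<phi> within {0..2*pi})"
      unfolding has_vector_derivative_def by (auto intro!: derivative_eq_intros)
    have 2: "((\<lambda>\<phi>. Q (p \<phi>)) has_vector_derivative csm (\<i> * of_real \<rho> * cis \<phi>) (F (p \<phi>))) (at \<phi> within {0..2*pi})"
      unfolding p_def
      by (rule has_vector_derivative_circle) (use Q[OF pin] in \<open>simp add: p_def\<close>)
    have 3: "csm (cis (- \<phi>)) (csm (\<i> * of_real \<rho> * cis \<phi>) (F (p \<phi>))) = csm (\<i> * of_real \<rho>) (F (p \<phi>))"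
    proof -
      have "cis (- \<phi>) * (\<i> * of_real \<rho> * cis \<phi>) = \<i> * of_real \<rho> * (cis (- \<phi>) * cis \<phi>)" by (simp add: mult_ac)
      also have "\<dots> = \<i> * of_real \<rho>" by (simp add: cis_mult)
      finally show ?thesis by (simp only: csm_mult[symmetric])
    qed
    have 4: "csm (- \<i> * cis (- \<phi>)) y = - csm (\<i> * cis (- \<phi>)) y" for y
      using minus_left[of "\<i> * cis (- \<phi>)" y] by simp
    from has_vector_derivative[OF 1 2]
    show "((\<lambda>\<phi>. csm (cis (- \<phi>)) (Q (p \<phi>))) has_vector_derivative
        csm (\<i> * of_real \<rho>) (F (p \<phi>)) - csm (\<i> * cis (- \<phi>)) (Q (p \<phi>))) (at \<phi> within {0..2*pi})"
      by (simp only: 3 4 add_uminus_conv_diff)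
  qed simp
  then have "integral {0..2*pi} (\<lambda>\<phi>. csm (\<i> * of_real \<rho>) (F (p \<phi>)) - csm (\<i> * cis (- \<phi>)) (Q (p \<phi>))) = 0"
    by (simp add: integral_unique p_def complex_eq_iff[of "cis _" 1] flip: cis_cnj)
  then have "integral {0..2*pi} (\<lambda>\<phi>. csm (\<i> * of_real \<rho>) (F (p \<phi>)))
      = integral {0..2*pi} (\<lambda>\<phi>. csm (\<i> * cis (- \<phi>)) (Q (p \<phi>)))"
    using Henstock_Kurzweil_Integration.integral_diff[OF iFc iQ] by simp
  moreover have "integral {0..2*pi} (\<lambda>\<phi>. csm (\<i> * of_real \<rho>) (F (p \<phi>)))
     = csm (\<i> * of_real \<rho>) (integral {0..2*pi} (\<lambda>\<phi>. F (p \<phi>)))"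
    using integral_linear[OF iF bounded_linear_right] by (simp add: o_def)
  moreover have "integral {0..2*pi} (\<lambda>\<phi>. F (p \<phi>)) = (2 * pi) *\<^sub>R F a"
    unfolding p_def using mean_value[OF \<rho> F G] by blast
  ultimately have eq: "csm (\<i> * of_real \<rho>) ((2 * pi) *\<^sub>R F a)
     = integral {0..2*pi} (\<lambda>\<phi>. csm (\<i> * cis (- \<phi>)) (Q (p \<phi>)))" by simp
  have "norm (integral {0..2*pi} (\<lambda>\<phi>. csm (\<i> * cis (- \<phi>)) (Q (p \<phi>)))) \<le> (B * K) * (2 * pi - 0)"
  proof (rule integral_bound)
    show "norm (csm (\<i> * cis (- \<phi>)) (Q (p \<phi>))) \<le> B * K" for \<phi>
      using K(2)[of "\<i> * cis (- \<phi>)" "Q (p \<phi>)"]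
        mult_right_mono[OF bd[OF pin, of \<phi>] less_imp_le[OF K(1)]]
      by (simp add: norm_mult)
  qed (auto intro!: continuous_on Qp continuous_intros)
  with eq have n: "norm (csm (\<i> * of_real \<rho>) ((2 * pi) *\<^sub>R F a)) \<le> B * K * (2 * pi)" by simp
  have "norm ((2 * pi) *\<^sub>R F a) = norm (csm (1 / (\<i> * of_real \<rho>)) (csm (\<i> * of_real \<rho>) ((2 * pi) *\<^sub>R F a)))"
    by (subst csm_inverse) (use \<rho> in auto)
  also have "\<dots> \<le> cmod (1 / (\<i> * of_real \<rho>)) * norm (csm (\<i> * of_real \<rho>) ((2 * pi) *\<^sub>R F a)) * K"
    by (rule K)
  also have "cmod (1 / (\<i> * of_real \<rho>)) = 1 / \<rho>" using \<rho> by (simp add: norm_divide norm_mult)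
  also have "1 / \<rho> * norm (csm (\<i> * of_real \<rho>) ((2 * pi) *\<^sub>R F a)) * K \<le> 1 / \<rho> * (B * K * (2 * pi)) * K"
    using n \<rho> K(1) by (intro mult_right_mono mult_left_mono) auto
  finally have "2 * pi * norm (F a) \<le> 2 * pi * (K^2 * B / \<rho>)"
    by (simp add: power2_eq_square mult_ac)
  then show ?thesis by (rule mult_left_le_imp_le) simp
qed

text \<open>Around \<open>t\<close> there is a disc of radius proportional to \<open>t\<close>
  inside the sector on which the semigroup is bounded, so Cauchy's estimate gives the factor
  \<open>1 / t\<close>. That estimate asks for a derivative which is itself continuously
  differentiable; the semigroup law provides it.\<close>

theorem analytic_extension_derivative:
  fixes V :: "real \<Rightarrow> 'b \<Rightarrow>\<^sub>L 'b"
  assumes "analytic_extension csm V"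
  obtains L where "\<And>t. t > 0 \<Longrightarrow> (V has_vector_derivative L t) (at t)"
    and "\<And>T. T > 0 \<Longrightarrow> \<exists>M>0. \<forall>t\<in>{0<..T}. norm (L t) \<le> M / t"
proof -
  obtain \<delta> S where \<delta>: "0 < \<delta>" "\<delta> \<le> pi / 2"
    and SV: "\<And>t. t > 0 \<Longrightarrow> S (of_real t) = V t"
    and Scomm: "\<And>z c x. z \<in> sector \<delta> \<Longrightarrow> S z (csm c x) = csm c (S z x)"
    and Sadd: "\<And>z w. z \<in> sector \<delta> \<Longrightarrow> w \<in> sector \<delta> \<Longrightarrow> S (z + w) = S z o\<^sub>L S w"
    and Sder: "\<And>z. z \<in> sector \<delta> \<Longrightarrow> \<exists>L. (S has_derivative (\<lambda>h. Blinfun (csm h) o\<^sub>L L)) (at z)"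
    and Slim: "\<And>x. ((\<lambda>z. S z x) \<longlongrightarrow> x) (at 0 within sector \<delta>)"
    using assms unfolding analytic_extension_def by blast
  obtain D where D: "\<And>z. z \<in> sector \<delta> \<Longrightarrow> (S has_derivative (\<lambda>h. Blinfun (csm h) o\<^sub>L D z)) (at z)"
    using Sder by metis
  obtain K where K: "K > 0" "\<And>c x. norm (csm c x) \<le> cmod c * norm x * K"
    using pos_bounded by blast
  have Bcsm: "blinfun_apply (Blinfun (csm c)) = csm c" for c
    by (rule bounded_linear_Blinfun_apply) (rule bounded_linear_right)
  \<comment> \<open>Half the angle: the closed cone \<open>\<bar>Im z\<bar> \<le> c * Re z\<close>
    without its vertex lies in the open sector, and its truncations are compact once the vertex is
    included.\<close>
  define c where "c = tan (\<delta> / 2)"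
  have c: "c > 0" "arctan c = \<delta> / 2"
    using \<delta> by (auto simp: c_def arctan_tan intro!: tan_gt_zero)
  have secI: "z \<in> sector \<delta>" if "Re z > 0" "\<bar>Im z\<bar> \<le> c * Re z" for z
  proof -
    have "\<bar>Im z / Re z\<bar> \<le> c" using that by (simp add: abs_divide divide_le_eq)
    then have "arctan (- c) \<le> arctan (Im z / Re z)" "arctan (Im z / Re z) \<le> arctan c"
      unfolding arctan_le_iff by linarith+
    then have "\<bar>Arg z\<bar> \<le> \<delta> / 2"
      using c that by (simp add: arg_conv_arctan arctan_minus)
    then show ?thesis using \<delta> that by (auto simp: sector_def)
  qed
  have Sx: "((\<lambda>z. S z x) has_derivative (\<lambda>h. csm h (D z x))) (at z)" if "z \<in> sector \<delta>" for z x
    using bounded_linear.has_derivative[OF blinfun.bounded_linear_left D[OF that], of x]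
    by (simp add: Bcsm)
  have Scont: "isCont (\<lambda>z. S z x) z" if "z \<in> sector \<delta>" for z x
    using Sx[OF that] has_derivative_continuous by blast
  \<comment> \<open>Extended by the identity at the vertex, each orbit is continuous on the compact
    truncated cone and hence bounded; uniform boundedness removes the dependence on
    \<open>x\<close>.\<close>
  have bound: "\<exists>M>0. \<forall>z. 0 < Re z \<and> Re z \<le> R \<and> \<bar>Im z\<bar> \<le> c * Re z \<longrightarrow> norm (S z) \<le> M" for R
  proof -
    define G where "G = {z. 0 \<le> Re z \<and> Re z \<le> R \<and> \<bar>Im z\<bar> \<le> c * Re z}"
    have sec: "z \<in> sector \<delta>" if "z \<in> G" "z \<noteq> 0" for z
    proof -
      have "Re z \<noteq> 0" using that by (auto simp: G_def complex_eq_iff)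
      then show ?thesis using that secI by (auto simp: G_def)
    qed
    have Geq: "G = {z. 0 \<le> Re z} \<inter> {z. Re z \<le> R} \<inter> {z. \<bar>Im z\<bar> \<le> c * Re z}" by (auto simp: G_def)
    have "closed G" unfolding Geq
      by (intro closed_Int closed_Collect_le continuous_intros)
    moreover have "bounded G"
    proof (rule boundedI)
      fix z assume z: "z \<in> G"
      then have "c * Re z \<le> c * R" using c by (auto simp: G_def)
      then show "cmod z \<le> R + c * R" using z cmod_le[of z] by (auto simp: G_def)
    qed
    ultimately have "compact G" using compact_eq_bounded_closed by blast
    have "bdd_above ((\<lambda>z. norm (S z x)) ` (G - {0}))" for x
    proof -
      define q where "q z = (if z = 0 then x else S z x)" for z
      have "continuous_on G q"
      proof (rule continuous_on_eq_continuous_within[THEN iffD2], intro ballI)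
        fix z assume z: "z \<in> G"
        show "continuous (at z within G) q"
        proof (cases "z = 0")
          case True
          have "((\<lambda>z. S z x) \<longlongrightarrow> x) (at 0 within (G - {0}))"
            by (rule tendsto_within_subset[OF Slim]) (use sec in auto)
          moreover have "at 0 within (G - {0}) = at 0 within G" by (simp add: at_within_def)
          ultimately have "((\<lambda>z. S z x) \<longlongrightarrow> x) (at 0 within G)" by simp
          then have "(q \<longlongrightarrow> x) (at 0 within G)"
            by (rule Lim_transform_eventually) (auto simp: eventually_at q_def intro!: exI[of _ 1])
          then show ?thesis unfolding True continuous_within by (simp add: q_def)
        next
          case False
          have "continuous (at z) q"
          proof (rule isCont_cong[THEN iffD1, OF _ Scont[OF sec[OF z False], of x]])
            show "\<forall>\<^sub>F w in nhds z. S w x = q w"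
              by (rule eventually_mono[OF eventually_nhds_in_open[of "- {0}" z]])
                 (use False in \<open>auto simp: q_def\<close>)
          qed
          then show ?thesis by (rule continuous_at_imp_continuous_at_within)
        qed
      qed
      then have "bounded (q ` G)" using \<open>compact G\<close> compact_continuous_image compact_imp_bounded by blast
      then obtain B where "\<forall>y\<in>q ` G. norm y \<le> B" using bounded_iff by blast
      then show ?thesis by (intro bdd_aboveI[of _ B]) (auto simp: q_def)
    qed
    from uniform_boundedness[of S "G - {0}", OF this]
    obtain M where "M > 0" "\<forall>z\<in>G - {0}. norm (S z) \<le> M" by blast
    then show ?thesis by (intro exI[of _ M]) (auto simp: G_def)
  qed
  \<comment> \<open>Differentiate the semigroup law in its second argument. The derivative at a
    later point is thereby \<open>S\<close> applied to a fixed vector, and it inherits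
    differentiability from \<open>S\<close>.\<close>
  have Dadd: "D (z + w) x = S z (D w x)"
    if z: "Re z > 0" "\<bar>Im z\<bar> < c * Re z" and w: "Re w > 0" "\<bar>Im w\<bar> < c * Re w" for z w x
  proof -
    define Om where "Om = {w. Re w > 0} \<inter> {w. \<bar>Im w\<bar> < c * Re w}"
    have Om: "open Om" "w \<in> Om" "Om \<subseteq> sector \<delta>"
      using w secI unfolding Om_def
      by (auto intro!: open_Int open_Collect_less continuous_intros)
    have zs: "z \<in> sector \<delta>" using z secI by simp
    have "z + w \<in> sector \<delta>" using z w by (intro secI) (auto simp: algebra_simps)
    then have "((\<lambda>w. S (z + w) x) has_derivative (\<lambda>h. csm h (D (z + w) x))) (at w)"
      by (intro has_derivative_compose[of "\<lambda>w. z + w" "\<lambda>h. h" w UNIV "\<lambda>v. S v x" "\<lambda>h. csm h (D (z + w) x)"] Sx)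
         (auto intro!: derivative_eq_intros)
    then have 1: "((\<lambda>w. S z (S w x)) has_derivative (\<lambda>h. csm h (D (z + w) x))) (at w)"
      by (rule has_derivative_transform_within_open[OF _ Om(1,2)])
         (use Om(3) Sadd zs in auto)
    have "((\<lambda>w. S z (S w x)) has_derivative (\<lambda>h. S z (csm h (D w x)))) (at w)"
      using Om by (intro bounded_linear.has_derivative[OF blinfun.bounded_linear_right] Sx) auto
    from has_derivative_unique[OF 1 this]
    have "csm 1 (D (z + w) x) = S z (csm 1 (D w x))" by metis
    then show ?thesis by (simp add: csm_one)
  qed
  show thesis
  proof
    fix t :: real assume t: "t > 0"
    have ts: "of_real t \<in> sector \<delta>" using t c by (intro secI) auto
    have one: "Blinfun (csm 1) = id_blinfun"
      by (rule blinfun_eqI) (simp add: Bcsm csm_one)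
    have lin: "bounded_linear (\<lambda>h. Blinfun (csm h) o\<^sub>L D (of_real t))"
      using D[OF ts] has_derivative_bounded_linear by blast
    have "((\<lambda>t. S (of_real t)) has_derivative (\<lambda>h. Blinfun (csm (of_real h)) o\<^sub>L D (of_real t))) (at t)"
      by (rule has_derivative_compose[of of_real of_real t UNIV S "\<lambda>h. Blinfun (csm h) o\<^sub>L D (of_real t)", OF _ D[OF ts]])
         (auto intro!: derivative_eq_intros)
    moreover have "Blinfun (csm (of_real h)) o\<^sub>L D (of_real t) = h *\<^sub>R D (of_real t)" for h
    proof -
      have "id_blinfun o\<^sub>L D (of_real t) = D (of_real t)" by (rule blinfun_eqI) simp
      then show ?thesis
        using linear_scale[OF bounded_linear.linear[OF lin], of h 1] by (simp add: one scaleR_conv_of_real)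
    qed
    ultimately have "((\<lambda>t. S (of_real t)) has_vector_derivative D (of_real t)) (at t)"
      by (simp add: has_vector_derivative_def)
    then show "(V has_vector_derivative D (of_real t)) (at t)"
      by (rule has_vector_derivative_transform_within_open[of _ _ _ "{0<..}"])
         (use t SV in auto)
  next
    fix T :: real assume T: "T > 0"
    obtain M where M: "M > 0" "\<And>z. 0 < Re z \<Longrightarrow> Re z \<le> 2 * T \<Longrightarrow> \<bar>Im z\<bar> \<le> c * Re z \<Longrightarrow> norm (S z) \<le> M"
      using bound[of "2 * T"] by blast
    \<comment> \<open>Chosen so that \<open>r * (1 + c) = c / 4\<close>: a disc of radius
      \<open>r * t\<close> around \<open>t\<close> stays in the open cone even after a shift to the
      left by \<open>5 * t / 8\<close>.\<close>
    define r where "r = c / (4 * (1 + c))"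
    have r: "r > 0" "r * (1 + c) = c / 4" "r \<le> 1/4" using c by (auto simp: r_def field_simps)
    show "\<exists>M>0. \<forall>t\<in>{0<..T}. norm (D (of_real t)) \<le> M / t"
    proof (intro exI[of _ "K\<^sup>2 * M / r"] conjI ballI)
      show "0 < K\<^sup>2 * M / r" using K M r by simp
      fix t :: real assume t: "t \<in> {0<..T}"
      then have t0: "t > 0" "t \<le> T" by auto
      define \<rho> where "\<rho> = r * t"
      have \<rho>: "\<rho> > 0" "\<rho> \<le> t / 4" using t0 r by (auto simp: \<rho>_def)
      have disc: "Re z - e > 0 \<and> \<bar>Im z\<bar> < c * (Re z - e) \<and> Re z \<le> 2 * T"
        if z: "z \<in> cball (of_real t) \<rho>" and e: "e \<le> 5 * t / 8" for z e
      proof -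
        have n: "cmod (z - of_real t) \<le> \<rho>" using z by (simp add: dist_norm norm_minus_commute)
        have re: "\<bar>Re z - t\<bar> \<le> \<rho>" using n abs_Re_le_cmod[of "z - of_real t"] by simp
        have im: "\<bar>Im z\<bar> \<le> \<rho>" using n abs_Im_le_cmod[of "z - of_real t"] by simp
        have "\<rho> + c * \<rho> = t * (r * (1 + c))" by (simp add: \<rho>_def algebra_simps)
        also have "\<dots> < c * (3 * t / 8)" unfolding r(2) using c t0 by simp
        also have "c * (3 * t / 8) \<le> c * (t - e)" using c e by (intro mult_left_mono) auto
        finally have "\<rho> < c * (t - \<rho> - e)" by (simp add: algebra_simps)
        also have "\<dots> \<le> c * (Re z - e)" using c re by (intro mult_left_mono) auto
        finally show ?thesis using im re \<rho> e t0 by auto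
      qed
      have disc': "Re z > 0 \<and> \<bar>Im z\<bar> < c * Re z \<and> Re z \<le> 2 * T" if "z \<in> cball (of_real t) \<rho>" for z
        using disc[OF that, of 0] t0 by simp
      show "norm (D (of_real t)) \<le> K\<^sup>2 * M / r / t"
      proof (rule norm_blinfun_bound)
        show "0 \<le> K\<^sup>2 * M / r / t" using K M r t0 by simp
        fix x
        have sh: "D z x = S (z - of_real e) (D (of_real e) x)"
          if z: "z \<in> cball (of_real t) \<rho>" and e: "0 < e" "e \<le> t / 2" for z e x
          using Dadd[of "z - of_real e" "of_real e" x] disc[OF z, of e] e c by simp
        have QD: "((\<lambda>z. S z x) has_derivative (\<lambda>h. csm h (D z x))) (at z)"
          if "z \<in> cball (of_real t) \<rho>" for z
          using disc'[OF that] by (intro Sx secI) auto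
        \<comment> \<open>On the disc \<open>D z x\<close> equals \<open>S (z - t/2) y\<close>,
          which identifies its derivative \<open>G\<close>. Splitting off a further
          \<open>t / 8\<close> shows that \<open>G\<close> is continuous; hence the shift
          \<open>5 * t / 8 = t / 2 + t / 8\<close>.\<close>
        define y where "y = D (of_real (t/2)) x"
        define G where "G z = D (z - of_real (t/2)) y" for z
        have FG: "((\<lambda>z. D z x) has_derivative (\<lambda>h. csm h (G z))) (at z)"
          if z: "z \<in> cball (of_real t) \<rho>" for z
        proof -
          define U where "U = {w. Re w - t/2 > 0} \<inter> {w. \<bar>Im w\<bar> < c * (Re w - t/2)}"
          have U: "open U" "z \<in> U"
            using disc[OF z, of "t/2"] t0 unfolding U_def
            by (auto intro!: open_Int open_Collect_less continuous_intros)
          have "z - of_real (t/2) \<in> sector \<delta>"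
            using disc[OF z, of "t/2"] t0 by (intro secI) auto
          then have "((\<lambda>w. S (w - of_real (t/2)) y) has_derivative (\<lambda>h. csm h (G z))) (at z)"
            unfolding G_def
            by (intro has_derivative_compose[of "\<lambda>w. w - of_real (t/2)" "\<lambda>h. h" z UNIV "\<lambda>v. S v y"
                "\<lambda>h. csm h (D (z - of_real (t/2)) y)"] Sx)
               (auto intro!: derivative_eq_intros)
          then show ?thesis
          proof (rule has_derivative_transform_within_open[OF _ U])
            fix w assume "w \<in> U"
            then show "S (w - of_real (t/2)) y = D w x"
              using Dadd[of "w - of_real (t/2)" "of_real (t/2)" x] t0 c
              by (simp add: U_def y_def)
          qed
        qed
        have Gc: "continuous_on (cball (of_real t) \<rho>) G"
        proof (rule continuous_on_eq)
          show "S (z - of_real (5*t/8)) (D (of_real (t/8)) y) = G z" if z: "z \<in> cball (of_real t) \<rho>" for z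
            using Dadd[of "z - of_real (5*t/8)" "of_real (t/8)" y] disc[OF z, of "5*t/8"] t0 c
            by (simp add: G_def flip: of_real_diff)
          show "continuous_on (cball (of_real t) \<rho>) (\<lambda>z. S (z - of_real (5*t/8)) (D (of_real (t/8)) y))"
          proof (rule continuous_at_imp_continuous_on, intro ballI)
            fix z :: complex assume z: "z \<in> cball (of_real t) \<rho>"
            have "z - of_real (5*t/8) \<in> sector \<delta>"
              using disc[OF z, of "5*t/8"] t0 by (intro secI) auto
            then show "isCont (\<lambda>z. S (z - of_real (5*t/8)) (D (of_real (t/8)) y)) z"
              by (intro isCont_o2[OF _ Scont] continuous_intros)
          qed
        qed
        have "norm (D (of_real t) x) \<le> K\<^sup>2 * (M * norm x) / \<rho>"
        proof (rule cauchy_estimate[OF K \<rho>(1) QD FG Gc])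
          fix z :: complex assume z: "z \<in> cball (of_real t) \<rho>"
          have "norm (S z) \<le> M" using disc'[OF z] by (intro M) auto
          then show "norm (S z x) \<le> M * norm x"
            by (meson mult_right_mono norm_blinfun norm_ge_zero order_trans)
        qed
        also have "\<dots> = K\<^sup>2 * M / r / t * norm x" by (simp add: \<rho>_def)
        finally show "norm (D (of_real t) x) \<le> K\<^sup>2 * M / r / t * norm x" .
      qed
    qed
  qed
qed

end

section \<open>Real and complex scalar fields\<close>

lemma complex_action_scalar_action:
  fixes sm :: "complex \<Rightarrow> 'a::banach \<Rightarrow> 'a"
  assumes "scalar_action UNIV sm" and nrm: "\<And>c x. norm (sm c x) = cmod c * norm x"
  shows "complex_action sm"
proof -
  interpret scalar_action UNIV sm by fact
  have r: "r *\<^sub>R x = sm (of_real r) x" for r x by (simp add: sm_of_real)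
  show ?thesis
  proof
    fix a b :: complex and x y :: 'a and r :: real
    show "sm (a + b) x = sm a x + sm b x" "sm a (x + y) = sm a x + sm a y" "sm (a * b) x = sm a (sm b x)"
      by (simp_all add: sm_add_left sm_add_right sm_mult)
    show "sm (r *\<^sub>R a) x = r *\<^sub>R sm a x"
      by (simp add: r sm_mult[symmetric] scaleR_conv_of_real)
    show "sm a (r *\<^sub>R x) = r *\<^sub>R sm a x"
      by (simp add: r sm_mult[symmetric] mult.commute)
    show "sm 1 x = x" using sm_of_real[of 1 x] by simp
    show "\<exists>K. \<forall>a x. norm (sm a x) \<le> norm a * norm x * K" using nrm by (intro exI[of _ 1]) simp
  qed
qed

lemma complex_action_complexify: "complex_action (complexify_sm :: complex \<Rightarrow> 'a::banach \<times> 'a \<Rightarrow> 'a \<times> 'a)"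
proof
  fix a b c :: complex and p q :: "'a \<times> 'a" and r :: real
  show "complexify_sm (a + b) p = complexify_sm a p + complexify_sm b p"
    and "complexify_sm a (p + q) = complexify_sm a p + complexify_sm a q"
    and "complexify_sm (r *\<^sub>R a) p = r *\<^sub>R complexify_sm a p"
    and "complexify_sm a (r *\<^sub>R p) = r *\<^sub>R complexify_sm a p"
    and "complexify_sm 1 p = p"
    and "complexify_sm (a * b) p = complexify_sm a (complexify_sm b p)"
    by (auto simp: complexify_sm_def algebra_simps)
  show "\<exists>K. \<forall>a p. norm (complexify_sm a (p::'a \<times> 'a)) \<le> norm a * norm p * K"
  proof (intro exI[of _ 4] allI)
    fix a and p :: "'a \<times> 'a"
    have 1: "norm (r *\<^sub>R v) \<le> cmod a * norm p" if "\<bar>r\<bar> \<le> cmod a" "norm v \<le> norm p" for r and v :: 'a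
      using that by (auto intro: mult_mono)
    have f: "norm (fst p) \<le> norm p" "norm (snd p) \<le> norm p"
      by (cases p, simp add: norm_fst_le norm_snd_le)+
    have "norm (complexify_sm a p) \<le> norm (Re a *\<^sub>R fst p - Im a *\<^sub>R snd p) + norm (Re a *\<^sub>R snd p + Im a *\<^sub>R fst p)"
      unfolding complexify_sm_def by (rule norm_Pair_le)
    also have "\<dots> \<le> (norm (Re a *\<^sub>R fst p) + norm (Im a *\<^sub>R snd p)) + (norm (Re a *\<^sub>R snd p) + norm (Im a *\<^sub>R fst p))"
      by (intro add_mono norm_triangle_ineq4 norm_triangle_ineq)
    also have "\<dots> \<le> cmod a * norm p * 4"
      using 1[OF abs_Re_le_cmod f(1)] 1[OF abs_Re_le_cmod f(2)]
        1[OF abs_Im_le_cmod f(1)] 1[OF abs_Im_le_cmod f(2)] by linarith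
    finally show "norm (complexify_sm a p) \<le> norm a * norm p * 4" .
  qed
qed

text \<open>Over the reals the complexified semigroup is differentiated, and the derivative is
  recovered as the first component of its action on \<open>(x, 0)\<close>; inserting and projecting
  do not increase norms.\<close>

theorem analytic_semigroup_derivative:
  fixes sm :: "complex \<Rightarrow> 'a::banach \<Rightarrow> 'a"
  assumes sa: "scalar_action K sm" and nrm: "\<And>c x. c \<in> K \<Longrightarrow> norm (sm c x) = cmod c * norm x"
    and an: "analytic_semigroup K sm U"
  obtains L :: "real \<Rightarrow> 'a \<Rightarrow>\<^sub>L 'a"
  where "\<And>t x. t > 0 \<Longrightarrow> ((\<lambda>t. U t x) has_vector_derivative L t x) (at t)"
    and "\<And>T. T > 0 \<Longrightarrow> \<exists>M>0. \<forall>t\<in>{0<..T}. norm (L t) \<le> M / t"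
proof (cases "K = UNIV")
  case True
  interpret complex_action sm
    using complex_action_scalar_action[of sm] sa nrm True by simp
  have "analytic_extension sm U" using an True by (simp add: analytic_semigroup_def)
  then obtain L where L: "\<And>t. t > 0 \<Longrightarrow> (U has_vector_derivative L t) (at t)"
    "\<And>T. T > 0 \<Longrightarrow> \<exists>M>0. \<forall>t\<in>{0<..T}. norm (L t) \<le> M / t"
    using analytic_extension_derivative by blast
  show thesis
    by (rule that[OF bounded_linear.has_vector_derivative[OF blinfun.bounded_linear_left L(1)] L(2)])
next
  case False
  interpret complex_action "complexify_sm :: complex \<Rightarrow> 'a \<times> 'a \<Rightarrow> 'a \<times> 'a"
    by (rule complex_action_complexify)
  have "analytic_extension complexify_sm (\<lambda>t. complexify_op (U t))"
    using an False by (simp add: analytic_semigroup_def)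
  then obtain L0 where L0: "\<And>t. t > 0 \<Longrightarrow> ((\<lambda>t. complexify_op (U t)) has_vector_derivative L0 t) (at t)"
    "\<And>T. T > 0 \<Longrightarrow> \<exists>M>0. \<forall>t\<in>{0<..T}. norm (L0 t) \<le> M / t"
    using analytic_extension_derivative by blast
  have op: "complexify_op B (x, y) = (B x, B y)" for B :: "'a \<Rightarrow>\<^sub>L 'a" and x y
  proof -
    have "bounded_linear (map_prod (blinfun_apply B) (blinfun_apply B))"
      unfolding map_prod_def split_def
      by (intro bounded_linear_Pair bounded_linear_compose[OF blinfun.bounded_linear_right]
          bounded_linear_fst bounded_linear_snd)
    then show ?thesis unfolding complexify_op_def by (simp add: bounded_linear_Blinfun_apply)
  qed
  define L where "L t = Blinfun (\<lambda>x. fst (L0 t (x, 0)))" for t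
  have bl: "bounded_linear (\<lambda>x. fst (L0 t (x, 0)))" for t
    by (intro bounded_linear_compose[OF bounded_linear_fst] bounded_linear_compose[OF blinfun.bounded_linear_right]
          bounded_linear_Pair bounded_linear_ident bounded_linear_zero)
  have La: "L t x = fst (L0 t (x, 0))" for t x
    unfolding L_def by (simp add: bounded_linear_Blinfun_apply[OF bl])
  have Ln: "norm (L t) \<le> norm (L0 t)" for t
  proof (rule norm_blinfun_bound)
    fix x
    have "norm (L t x) \<le> norm (L0 t (x, 0))" unfolding La by (metis norm_fst_le prod.collapse)
    also have "\<dots> \<le> norm (L0 t) * norm (x, 0::'a)" by (rule norm_blinfun)
    finally show "norm (L t x) \<le> norm (L0 t) * norm x" by simp
  qed simp
  show thesis
  proof
    fix t :: real and x assume "t > 0"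
    from bounded_linear.has_vector_derivative[OF bounded_linear_compose[OF bounded_linear_fst blinfun.bounded_linear_left] L0(1)[OF this], of "(x, 0)"]
    show "((\<lambda>t. U t x) has_vector_derivative L t x) (at t)"
      by (simp add: op La)
  next
    fix T :: real assume "T > 0"
    then show "\<exists>M>0. \<forall>t\<in>{0<..T}. norm (L t) \<le> M / t"
      using L0(2) Ln order_trans by meson
  qed
qed

subsection \<open>Generator and smoothing\<close>

lemma has_vector_derivative_quotient:
  assumes "(f has_vector_derivative f') (at x within S)"
  shows "((\<lambda>y. (f y - f x) /\<^sub>R (y - x)) \<longlongrightarrow> f') (at x within S)"
proof -
  have "((\<lambda>y. norm (f y - f x - (y - x) *\<^sub>R f') / norm (y - x)) \<longlongrightarrow> 0) (at x within S)"
    using assms unfolding has_vector_derivative_def has_derivative_iff_norm by auto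
  then have "((\<lambda>y. (f y - f x) /\<^sub>R (y - x) - f') \<longlongrightarrow> 0) (at x within S)"
  proof (rule Lim_null_comparison[rotated])
    show "\<forall>\<^sub>F y in at x within S. norm ((f y - f x) /\<^sub>R (y - x) - f') \<le> norm (f y - f x - (y - x) *\<^sub>R f') / norm (y - x)"
      unfolding eventually_at_filter
    proof (intro always_eventually allI impI)
      fix y assume y: "y \<noteq> x"
      have "(f y - f x) /\<^sub>R (y - x) - f' = (f y - f x - (y - x) *\<^sub>R f') /\<^sub>R (y - x)"
        using y by (simp add: scaleR_diff_right)
      then show "norm ((f y - f x) /\<^sub>R (y - x) - f') \<le> norm (f y - f x - (y - x) *\<^sub>R f') / norm (y - x)"
        by (simp add: divide_inverse mult.commute)
    qed
  qed
  then show ?thesis by (simp add: LIM_zero_iff)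
qed

text \<open>\<open>L t\<close> is the composition of \<open>A\<close> with \<open>U t\<close>, a
  bounded operator for \<open>t > 0\<close>. Estimates and integrals are carried out with
  \<open>L\<close>; the unbounded \<open>A\<close> comes back through its closedness.\<close>

locale smoothing_semigroup =
  fixes U L :: "real \<Rightarrow> 'a::banach \<Rightarrow>\<^sub>L 'a" and D :: "'a set" and A :: "'a \<Rightarrow> 'a"
  assumes C0: "C0_semigroup U" and gen: "infinitesimal_generator U D A"
    and deriv: "\<And>t x. t > 0 \<Longrightarrow> ((\<lambda>t. U t x) has_vector_derivative L t x) (at t)"
begin

lemma U_0 [simp]: "U 0 x = x"
  using C0 by (simp add: C0_semigroup_def)

lemma U_add: "s \<ge> 0 \<Longrightarrow> t \<ge> 0 \<Longrightarrow> U (s + t) x = U s (U t x)"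
  using C0 by (simp add: C0_semigroup_def)

lemma U_comm: "s \<ge> 0 \<Longrightarrow> t \<ge> 0 \<Longrightarrow> U s (U t x) = U t (U s x)"
  using U_add[of s t x] U_add[of t s x] by (simp add: add.commute)

lemma U_cont: "continuous_on {0..} (\<lambda>t. U t x)"
  using C0 by (simp add: C0_semigroup_def)

lemma U_bounded: "\<exists>M>0. \<forall>t\<in>{0..T}. norm (U t) \<le> M"
proof (rule uniform_boundedness)
  fix x
  have "bounded ((\<lambda>t. U t x) ` {0..T})"
    by (intro compact_imp_bounded compact_continuous_image continuous_on_subset[OF U_cont]) auto
  then obtain B where "\<forall>y\<in>(\<lambda>t. U t x) ` {0..T}. norm y \<le> B" using bounded_iff by blast
  then show "bdd_above ((\<lambda>t. norm (U t x)) ` {0..T})" by (intro bdd_aboveI[of _ B]) auto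
qed

text \<open>Strong continuity and a local bound on the operator norms give joint continuity in time
  and vector, as integrands such as \<open>U (t - r) (g r)\<close> require.\<close>

lemma U_tendsto:
  assumes h: "(h \<longlongrightarrow> a) F" and h0: "\<forall>\<^sub>F s in F. 0 \<le> h s" and a: "a \<ge> 0" and g: "(g \<longlongrightarrow> b) F"
  shows "((\<lambda>s. U (h s) (g s)) \<longlongrightarrow> U a b) F"
proof -
  obtain M where M: "M > 0" "\<forall>t\<in>{0..a+1}. norm (U t) \<le> M" using U_bounded by blast
  have "((\<lambda>s. U (h s) b) \<longlongrightarrow> U a b) F"
    using continuous_on_tendsto_compose[OF U_cont h, of b] a h0 by simp
  moreover have "((\<lambda>s. U (h s) (g s - b)) \<longlongrightarrow> 0) F"
  proof (rule Lim_null_comparison)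
    have "\<forall>\<^sub>F s in F. h s < a + 1" using h by (rule order_tendstoD) simp
    then show "\<forall>\<^sub>F s in F. norm (U (h s) (g s - b)) \<le> M * norm (g s - b)"
      using h0
    proof eventually_elim
      case (elim s)
      then have "norm (U (h s)) \<le> M" using M by auto
      then show ?case by (meson mult_right_mono norm_blinfun norm_ge_zero order_trans)
    qed
    show "((\<lambda>s. M * norm (g s - b)) \<longlongrightarrow> 0) F"
      using g by (intro tendsto_mult_right_zero tendsto_norm_zero) (simp add: LIM_zero_iff)
  qed
  ultimately have "((\<lambda>s. U (h s) b + U (h s) (g s - b)) \<longlongrightarrow> U a b + 0) F"
    by (rule tendsto_add)
  then show ?thesis by (simp add: blinfun.diff_right)
qed

lemma U_continuous_on:
  assumes "continuous_on S h" "continuous_on S g" "\<And>s. s \<in> S \<Longrightarrow> h s \<ge> 0"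
  shows "continuous_on S (\<lambda>s. U (h s) (g s))"
  unfolding continuous_on_def
proof
  fix s assume s: "s \<in> S"
  show "((\<lambda>s. U (h s) (g s)) \<longlongrightarrow> U (h s) (g s)) (at s within S)"
    using assms s by (intro U_tendsto) (auto simp: continuous_on_def eventually_at_topological)
qed

lemma L_add:
  assumes "s \<ge> 0" "t > 0"
  shows "L (t + s) x = U s (L t x)" "L (t + s) x = L t (U s x)"
proof -
  have d: "((\<lambda>r. U (r + s) x) has_vector_derivative L (t + s) x) (at t)"
  proof -
    have "((\<lambda>r. r + s) has_vector_derivative 1) (at t)"
      unfolding has_vector_derivative_def by (auto intro!: derivative_eq_intros)
    from vector_diff_chain_at[OF this, of "\<lambda>r. U r x" "L (t + s) x"] deriv[of "t + s" x] assms
    show ?thesis by (simp add: o_def)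
  qed
  have "((\<lambda>r. U s (U r x)) has_vector_derivative U s (L t x)) (at t)"
    by (rule bounded_linear.has_vector_derivative[OF blinfun.bounded_linear_right deriv[OF assms(2)]])
  then have "((\<lambda>r. U (r + s) x) has_vector_derivative U s (L t x)) (at t)"
    by (rule has_vector_derivative_transform_within_open[of _ _ _ "{0<..}"])
       (use assms U_add[of s _ x] in \<open>auto simp: add.commute\<close>)
  with d show "L (t + s) x = U s (L t x)" by (rule vector_derivative_unique_at)
  have "((\<lambda>r. U (r + s) x) has_vector_derivative L t (U s x)) (at t)"
    by (rule has_vector_derivative_transform_within_open[of "\<lambda>r. U r (U s x)" _ _ "{0<..}"])
       (use assms U_add deriv in auto)
  with d show "L (t + s) x = L t (U s x)" by (rule vector_derivative_unique_at)
qed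

lemma generator_iff: "((\<lambda>h. (U h x - x) /\<^sub>R h) \<longlongrightarrow> y) (at_right 0) \<longleftrightarrow> x \<in> D \<and> A x = y"
proof
  assume a: "((\<lambda>h. (U h x - x) /\<^sub>R h) \<longlongrightarrow> y) (at_right 0)"
  then have x: "x \<in> D" using gen unfolding infinitesimal_generator_def by blast
  then have "((\<lambda>h. (U h x - x) /\<^sub>R h) \<longlongrightarrow> A x) (at_right 0)"
    using gen unfolding infinitesimal_generator_def by blast
  then show "x \<in> D \<and> A x = y" using x a tendsto_unique trivial_limit_at_right_real by blast
next
  assume "x \<in> D \<and> A x = y"
  then show "((\<lambda>h. (U h x - x) /\<^sub>R h) \<longlongrightarrow> y) (at_right 0)"
    using gen unfolding infinitesimal_generator_def by blast
qed

lemma U_in_D: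
  assumes t: "t > 0"
  shows "U t x \<in> D" "A (U t x) = L t x"
proof -
  have "((\<lambda>h. (U (t + h) x - U t x) /\<^sub>R h) \<longlongrightarrow> L t x) (at 0)"
    using LIM_offset_zero[OF has_vector_derivative_quotient[OF deriv[OF t, of x]]] by simp
  then have "((\<lambda>h. (U (t + h) x - U t x) /\<^sub>R h) \<longlongrightarrow> L t x) (at_right 0)"
    by (rule filterlim_mono) (auto simp: at_le)
  then have "((\<lambda>h. (U h (U t x) - U t x) /\<^sub>R h) \<longlongrightarrow> L t x) (at_right 0)"
    by (rule Lim_transform_eventually)
       (use t U_add in \<open>auto simp: eventually_at_filter add.commute\<close>)
  then show "U t x \<in> D" "A (U t x) = L t x" unfolding generator_iff by auto
qed

lemma L_eq_U_A:
  assumes x: "x \<in> D" and t: "t > 0"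
  shows "L t x = U t (A x)"
proof -
  have "((\<lambda>h. (U h x - x) /\<^sub>R h) \<longlongrightarrow> A x) (at_right 0)" using x generator_iff by blast
  from bounded_linear.tendsto[OF blinfun.bounded_linear_right this, of "U t"]
  have "((\<lambda>h. (U t (U h x) - U t x) /\<^sub>R h) \<longlongrightarrow> U t (A x)) (at_right 0)"
    by (simp add: blinfun.scaleR_right blinfun.diff_right)
  then have "((\<lambda>h. (U h (U t x) - U t x) /\<^sub>R h) \<longlongrightarrow> U t (A x)) (at_right 0)"
    by (rule Lim_transform_eventually)
       (use t U_comm in \<open>auto simp: eventually_at_filter\<close>)
  then show ?thesis using U_in_D[OF t] unfolding generator_iff by auto
qed

lemma U_integral_L:
  assumes "0 < s" "s \<le> t"
  shows "((\<lambda>r. L r x) has_integral (U t x - U s x)) {s..t}"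
  by (rule fundamental_theorem_of_calculus)
     (use assms deriv in \<open>auto intro: has_vector_derivative_at_within\<close>)

lemma U_integral_A:
  assumes x: "x \<in> D" and t: "0 \<le> t"
  shows "((\<lambda>r. U r (A x)) has_integral (U t x - x)) {0..t}"
proof -
  have "((\<lambda>r. U r (A x)) has_integral (U t x - U 0 x)) {0..t}"
  proof (rule fundamental_theorem_of_calculus_interior[OF t])
    show "continuous_on {0..t} (\<lambda>t. U t x)" by (rule continuous_on_subset[OF U_cont]) auto
    show "((\<lambda>t. U t x) has_vector_derivative U r (A x)) (at r)" if "r \<in> {0<..<t}" for r
      using deriv[of r x] L_eq_U_A[OF x] that by simp
  qed
  then show ?thesis by simp
qed

lemma A_add: "x \<in> D \<Longrightarrow> y \<in> D \<Longrightarrow> x + y \<in> D \<and> A (x + y) = A x + A y"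
  unfolding generator_iff[symmetric]
proof -
  assume x: "x \<in> D" and y: "y \<in> D"
  then have "((\<lambda>h. (U h x - x) /\<^sub>R h + (U h y - y) /\<^sub>R h) \<longlongrightarrow> A x + A y) (at_right 0)"
    by (intro tendsto_add) (auto simp: generator_iff)
  then show "((\<lambda>h. (U h (x + y) - (x + y)) /\<^sub>R h) \<longlongrightarrow> A x + A y) (at_right 0)"
    by (simp add: blinfun.add_right algebra_simps)
qed

lemma A_scale: "x \<in> D \<Longrightarrow> r *\<^sub>R x \<in> D \<and> A (r *\<^sub>R x) = r *\<^sub>R A x"
  unfolding generator_iff[symmetric]
proof -
  assume x: "x \<in> D"
  then have "((\<lambda>h. r *\<^sub>R ((U h x - x) /\<^sub>R h)) \<longlongrightarrow> r *\<^sub>R A x) (at_right 0)"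
    by (intro tendsto_intros) (auto simp: generator_iff)
  then show "((\<lambda>h. (U h (r *\<^sub>R x) - r *\<^sub>R x) /\<^sub>R h) \<longlongrightarrow> r *\<^sub>R A x) (at_right 0)"
    by (simp add: blinfun.scaleR_right algebra_simps)
qed

lemma A_diff: "x \<in> D \<Longrightarrow> y \<in> D \<Longrightarrow> x - y \<in> D \<and> A (x - y) = A x - A y"
  using A_add[of x "-1 *\<^sub>R y"] A_scale[of y "-1"] by auto

lemma zero_in_D: "0 \<in> D" "A 0 = 0"
  using A_scale[OF U_in_D(1)[of 1 0], of 0] by auto

lemma integral_U_quotient:
  "((\<lambda>h. integral {0..h} (\<lambda>r. U r y) /\<^sub>R h) \<longlongrightarrow> y) (at_right 0)"
proof -
  have "((\<lambda>h. integral {0..h} (\<lambda>r. U r y)) has_vector_derivative U 0 y) (at 0 within {0..1})"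
    by (rule integral_has_vector_derivative) (auto intro: continuous_on_subset[OF U_cont])
  then have "((\<lambda>h. (integral {0..h} (\<lambda>r. U r y)) /\<^sub>R h) \<longlongrightarrow> y) (at 0 within {0..1})"
    by (auto dest: has_vector_derivative_quotient)
  moreover have "at 0 within {0..1} = at_right (0::real)"
    by (rule at_within_Icc_at_right) simp
  ultimately show ?thesis by simp
qed

lemma A_closed:
  assumes x: "\<And>n. x n \<in> D" and l: "x \<longlonglongrightarrow> l" and y: "(\<lambda>n. A (x n)) \<longlonglongrightarrow> y"
  shows "l \<in> D \<and> A l = y"
proof -
  \<comment> \<open>The generator identity is passed to the limit in integrated form, where only
    bounded operators occur; dividing by \<open>h\<close> afterwards recovers membership in the
    domain.\<close>
  have eq: "U h l - l = integral {0..h} (\<lambda>r. U r y)" if h: "h > 0" for h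
  proof -
    obtain M where M: "M > 0" "\<forall>t\<in>{0..h}. norm (U t) \<le> M" using U_bounded by blast
    have ic: "(\<lambda>r. U r z) integrable_on {0..h}" for z
      by (intro integrable_continuous_real continuous_on_subset[OF U_cont]) auto
    have "(\<lambda>n. integral {0..h} (\<lambda>r. U r (A (x n))) - integral {0..h} (\<lambda>r. U r y)) \<longlonglongrightarrow> 0"
    proof (rule Lim_null_comparison)
      show "\<forall>\<^sub>F n in sequentially. norm (integral {0..h} (\<lambda>r. U r (A (x n))) - integral {0..h} (\<lambda>r. U r y))
          \<le> (M * norm (A (x n) - y)) * (h - 0)"
      proof (intro always_eventually allI)
        fix n
        have "integral {0..h} (\<lambda>r. U r (A (x n))) - integral {0..h} (\<lambda>r. U r y)
            = integral {0..h} (\<lambda>r. U r (A (x n) - y))"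
          by (simp add: blinfun.diff_right ic integral_diff)
        also have "norm \<dots> \<le> (M * norm (A (x n) - y)) * (h - 0)"
        proof (rule integral_bound)
          show "continuous_on {0..h} (\<lambda>r. U r (A (x n) - y))" by (rule continuous_on_subset[OF U_cont]) auto
          show "norm (U r (A (x n) - y)) \<le> M * norm (A (x n) - y)" if "r \<in> {0..h}" for r
            using M that by (meson mult_right_mono norm_blinfun norm_ge_zero order_trans)
        qed (use h in auto)
        finally show "norm (integral {0..h} (\<lambda>r. U r (A (x n))) - integral {0..h} (\<lambda>r. U r y))
          \<le> (M * norm (A (x n) - y)) * (h - 0)" .
      qed
      show "(\<lambda>n. (M * norm (A (x n) - y)) * (h - 0)) \<longlonglongrightarrow> 0"
        using y by (intro tendsto_mult_left_zero tendsto_mult_right_zero tendsto_norm_zero) (simp add: LIM_zero_iff)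
    qed
    moreover have "integral {0..h} (\<lambda>r. U r (A (x n))) = U h (x n) - x n" for n
      using U_integral_A[OF x] h by (simp add: integral_unique)
    ultimately have "(\<lambda>n. U h (x n) - x n) \<longlonglongrightarrow> integral {0..h} (\<lambda>r. U r y)"
      by (simp add: LIM_zero_iff)
    moreover have "(\<lambda>n. U h (x n) - x n) \<longlonglongrightarrow> U h l - l" by (intro tendsto_intros l)
    ultimately show ?thesis using LIMSEQ_unique by blast
  qed
  have "((\<lambda>h. (U h l - l) /\<^sub>R h) \<longlongrightarrow> y) (at_right 0)"
    by (rule Lim_transform_eventually[OF integral_U_quotient])
       (auto simp: eventually_at_filter eq)
  then show ?thesis by (simp add: generator_iff)
qed

end

subsection \<open>The convolution integral\<close>

lemma half_power_powr: "((1/2)^n) powr a = ((1/2::real) powr a)^n"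
  by (induction n) (simp_all add: powr_mult powr_divide)

locale smoothing_semigroup_on = smoothing_semigroup U L D A
  for U L :: "real \<Rightarrow> 'a::banach \<Rightarrow>\<^sub>L 'a" and D :: "'a set" and A :: "'a \<Rightarrow> 'a" +
  fixes T M :: real
  assumes T: "T > 0" and M: "M \<ge> 1"
    and norm_U: "\<And>t. 0 \<le> t \<Longrightarrow> t \<le> T \<Longrightarrow> norm (U t) \<le> M"
    and norm_L: "\<And>t. 0 < t \<Longrightarrow> t \<le> T \<Longrightarrow> norm (L t) \<le> M / t"
begin

lemma norm_U_apply: "0 \<le> t \<Longrightarrow> t \<le> T \<Longrightarrow> norm (U t x) \<le> M * norm x"
  by (meson mult_right_mono norm_blinfun norm_ge_zero norm_U order_trans)

lemma norm_L_apply: "0 < t \<Longrightarrow> t \<le> T \<Longrightarrow> norm (L t x) \<le> M / t * norm x"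
  by (meson mult_right_mono norm_blinfun norm_ge_zero norm_L order_trans)

lemma conv_continuous:
  "continuous_on {a..b} g \<Longrightarrow> b \<le> t \<Longrightarrow> continuous_on {a..b} (\<lambda>r. U (t - r) (g r))"
  by (rule U_continuous_on) (auto intro!: continuous_intros)

lemma conv_integrable:
  "continuous_on {a..b} g \<Longrightarrow> b \<le> t \<Longrightarrow> (\<lambda>r. U (t - r) (g r)) integrable_on {a..b}"
  by (intro integrable_continuous_real conv_continuous)

text \<open>Pulling \<open>U (t - s)\<close> out of an integral that ends before \<open>s\<close> is
  what later converts an ambient bound for the integral into a bound in a smaller space.\<close>

lemma conv_shift:
  assumes "continuous_on {a..b} g" "b \<le> s" "s \<le> t"
  shows "integral {a..b} (\<lambda>r. U (t - r) (g r)) = U (t - s) (integral {a..b} (\<lambda>r. U (s - r) (g r)))"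
proof -
  have "integral {a..b} (\<lambda>r. U (t - r) (g r)) = integral {a..b} (\<lambda>r. U (t - s) (U (s - r) (g r)))"
  proof (rule integral_cong)
    fix r assume "r \<in> {a..b}"
    then show "U (t - r) (g r) = U (t - s) (U (s - r) (g r))"
      using assms U_add[of "t - s" "s - r"] by simp
  qed
  also have "\<dots> = U (t - s) (integral {a..b} (\<lambda>r. U (s - r) (g r)))"
    using integral_linear[OF conv_integrable[OF assms(1,2)] blinfun.bounded_linear_right, of "U (t - s)"]
    by (simp add: o_def)
  finally show ?thesis .
qed

lemma conv_norm:
  assumes "continuous_on {a..b} g" "a \<le> b" "b \<le> t" "t \<le> T + a"
    and "\<And>s. s \<in> {a..b} \<Longrightarrow> norm (g s) \<le> G"
  shows "norm (integral {a..b} (\<lambda>r. U (t - r) (g r))) \<le> M * G * (b - a)"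
proof (rule integral_bound[OF assms(2) conv_continuous[OF assms(1,3)]])
  fix r assume r: "r \<in> {a..b}"
  have "norm (U (t - r) (g r)) \<le> M * norm (g r)" using r assms by (intro norm_U_apply) auto
  also have "\<dots> \<le> M * G" using assms(5)[OF r] M by (intro mult_left_mono) auto
  finally show "norm (U (t - r) (g r)) \<le> M * G" .
qed

text \<open>The Duhamel term without the orbit of the initial value. They are kept apart because the
  convolution has a modulus of continuity depending only on a bound for the forcing, while the orbit
  is merely continuous.\<close>

definition mild :: "(real \<Rightarrow> 'a) \<Rightarrow> real \<Rightarrow> 'a" where
  "mild g t = integral {0..t} (\<lambda>r. U (t - r) (g r))"

lemma mild_0 [simp]: "mild g 0 = 0"
  by (simp add: mild_def)

lemma mild_split:
  assumes g: "continuous_on {0..t} g" and s: "0 \<le> s" "s \<le> t"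
  shows "mild g t = U (t - s) (mild g s) + integral {s..t} (\<lambda>r. U (t - r) (g r))"
    and "mild g t = U (t - s) (mild g s) + mild (\<lambda>r. g (s + r)) (t - s)"
proof -
  have g': "continuous_on {0..s} g" using g by (rule continuous_on_subset) (use s in auto)
  have "mild g t = integral {0..s} (\<lambda>r. U (t - r) (g r)) + integral {s..t} (\<lambda>r. U (t - r) (g r))"
    unfolding mild_def
    by (rule Henstock_Kurzweil_Integration.integral_combine[symmetric]) (use s g conv_integrable in auto)
  then show 1: "mild g t = U (t - s) (mild g s) + integral {s..t} (\<lambda>r. U (t - r) (g r))"
    using conv_shift[OF g', of s t] s by (simp add: mild_def)
  have "integral {s..t} (\<lambda>r. U (t - r) (g r)) = mild (\<lambda>r. g (s + r)) (t - s)"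
    using integral_shift_Icc_real[of 0 "t - s" "\<lambda>r. U (t - r) (g r)" s]
    by (simp add: mild_def o_def algebra_simps)
  with 1 show "mild g t = U (t - s) (mild g s) + mild (\<lambda>r. g (s + r)) (t - s)" by simp
qed

lemma mild_cong: "(\<And>s. s \<in> {0..t} \<Longrightarrow> g s = g' s) \<Longrightarrow> mild g t = mild g' t"
  unfolding mild_def by (rule integral_cong) auto

lemma mild_diff:
  "continuous_on {0..t} g \<Longrightarrow> continuous_on {0..t} g' \<Longrightarrow> mild g t - mild g' t = mild (\<lambda>s. g s - g' s) t"
  unfolding mild_def by (simp add: blinfun.diff_right integral_diff conv_integrable)

text \<open>Discrete replacement for the integral of \<open>r powr (- b)\<close> over the unit
  interval: the piece of length \<open>(1/2) ^ Suc k\<close> lies at least that far from the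
  singularity.\<close>

definition dyadic_sum :: "real \<Rightarrow> real" where
  "dyadic_sum b = (\<Sum>k. ((1/2) powr (1 - b)) ^ Suc k)"

lemma dyadic_sum_summable: "b < 1 \<Longrightarrow> summable (\<lambda>k. ((1/2::real) powr (1 - b)) ^ Suc k)"
  unfolding power_Suc
  using powr_less_mono2[of "1 - b" "1/2" "1::real"]
  by (intro summable_mult summable_geometric) auto

lemma dyadic_sum_nonneg: "b < 1 \<Longrightarrow> dyadic_sum b \<ge> 0"
  unfolding dyadic_sum_def by (intro suminf_nonneg dyadic_sum_summable) auto

text \<open>The dyadic pieces of the convolution integral are \<open>U \<delta> w\<close> with \<open>w\<close> an integral in the ambient
  space, so that no integral with values in \<open>Y\<close> is needed.\<close>

lemma mild_in_subspace:
  assumes Y: "banach_sub Y" and b: "b < 1" and N: "N \<ge> 0"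
    and BU: "\<And>\<tau> x. 0 < \<tau> \<Longrightarrow> \<tau> \<le> T \<Longrightarrow> blinfun_apply B (U \<tau> x) \<in> pts Y \<and> nrm Y (B (U \<tau> x)) \<le> N * \<tau> powr (- b) * norm x"
    and t: "0 \<le> t" "t \<le> T" and g: "continuous_on {0..t} g"
    and G: "\<And>s. s \<in> {0..t} \<Longrightarrow> norm (g s) \<le> G"
  shows "blinfun_apply B (mild g t) \<in> pts Y" 
    and "nrm Y (B (mild g t)) \<le> M * N * dyadic_sum b * t powr (1 - b) * G"
proof -
  interpret Y: banach_sub Y by fact
  have "B (mild g t) \<in> pts Y \<and> nrm Y (B (mild g t)) \<le> M * N * dyadic_sum b * t powr (1 - b) * G"
  proof (cases "t = 0")
    case True
    then show ?thesis by (simp add: blinfun.zero_right Y.zero_mem)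
  next
    case False
    then have t0: "t > 0" using t by simp
    \<comment> \<open>The piece from \<open>t - \<delta> k\<close> to
      \<open>t - \<delta> (Suc k)\<close> has length \<open>\<delta> (Suc k)\<close>, and
      \<open>U (\<delta> (Suc k))\<close> is what can be factored out of it.\<close>
    define \<delta> where "\<delta> k = t * (1/2)^k" for k
    have d: "\<delta> k > 0" "\<delta> k \<le> t" "\<delta> k = 2 * \<delta> (Suc k)" for k
      using t0 by (auto simp: \<delta>_def power_le_one)
    have d0: "\<delta> 0 = t" by (simp add: \<delta>_def)
    have G0: "G \<ge> 0" using order_trans[OF norm_ge_zero G[of 0]] t by simp
    define a where "a k = integral {t - \<delta> k..t - \<delta> (Suc k)} (\<lambda>r. U (t - r) (g r))" for k
    define w where "w k = integral {t - \<delta> k..t - \<delta> (Suc k)} (\<lambda>r. U (t - \<delta> (Suc k) - r) (g r))" for k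
    have sub: "continuous_on {c..e} g" if "0 \<le> c" "e \<le> t" for c e
      using g by (rule continuous_on_subset) (use that in auto)
    have le: "0 \<le> t - \<delta> k" "t - \<delta> k \<le> t - \<delta> (Suc k)" "t - \<delta> (Suc k) \<le> t" for k
      using d[of k] d[of "Suc k"] by auto
    have gk: "continuous_on {t - \<delta> k..t - \<delta> (Suc k)} g" for k using le[of k] by (intro sub) auto
    have aw: "a k = U (\<delta> (Suc k)) (w k)" for k
      unfolding a_def w_def using conv_shift[OF gk[of k], of "t - \<delta> (Suc k)" t] le[of k] by simp
    have wn: "norm (w k) \<le> M * G * \<delta> (Suc k)" for k
    proof -
      have "norm (w k) \<le> M * G * (t - \<delta> (Suc k) - (t - \<delta> k))"
        unfolding w_def
        by (rule conv_norm[OF gk]) (use le[of k] t d[of "Suc k"] G in auto)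
      then show ?thesis using d(3)[of k] by simp
    qed
    have part: "(\<Sum>k<n. a k) = integral {0..t - \<delta> n} (\<lambda>r. U (t - r) (g r))" for n
    proof (induction n)
      case 0 then show ?case by (simp add: d0)
    next
      case (Suc n)
      have "integral {0..t - \<delta> n} (\<lambda>r. U (t - r) (g r)) + a n = integral {0..t - \<delta> (Suc n)} (\<lambda>r. U (t - r) (g r))"
        unfolding a_def
        by (rule Henstock_Kurzweil_Integration.integral_combine)
           (use le[of n] conv_integrable[OF sub] in auto)
      with Suc show ?case by simp
    qed
    have "a sums mild g t"
    proof -
      have ic: "continuous_on {0..t} (\<lambda>s. integral {0..s} (\<lambda>r. U (t - r) (g r)))"
        by (rule indefinite_integral_continuous_1[OF conv_integrable[OF g]]) simp
      have "\<delta> \<longlonglongrightarrow> 0" unfolding \<delta>_def by (intro tendsto_mult_right_zero LIMSEQ_power_zero) simp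
      then have "(\<lambda>n. t - \<delta> n) \<longlonglongrightarrow> t" by (auto intro!: tendsto_eq_intros)
      then have "(\<lambda>n. integral {0..t - \<delta> n} (\<lambda>r. U (t - r) (g r))) \<longlonglongrightarrow> integral {0..t} (\<lambda>r. U (t - r) (g r))"
        by (rule continuous_on_tendsto_compose[OF ic]) (use d(1,2) t in \<open>auto intro!: always_eventually simp: less_imp_le\<close>)
      then show ?thesis unfolding sums_def part mild_def .
    qed
    then have sums: "(\<lambda>k. B (a k)) sums B (mild g t)"
      by (rule bounded_linear.sums[OF blinfun.bounded_linear_right])
    \<comment> \<open>The singularity \<open>\<delta> powr (- b)\<close> times the length
      \<open>\<delta>\<close> of the piece leaves \<open>\<delta> powr (1 - b)\<close>, a geometric
      sequence that is summable because \<open>b < 1\<close>.\<close>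
    have mem: "B (a k) \<in> pts Y" and bd: "nrm Y (B (a k)) \<le> M * N * t powr (1 - b) * G * ((1/2) powr (1 - b)) ^ Suc k" for k
    proof -
      have dT: "0 < \<delta> (Suc k)" "\<delta> (Suc k) \<le> T" using d[of "Suc k"] t by auto
      show "B (a k) \<in> pts Y" unfolding aw using BU[OF dT] by simp
      have "nrm Y (B (a k)) \<le> N * \<delta> (Suc k) powr (- b) * norm (w k)"
        unfolding aw using BU[OF dT] by simp
      also have "\<dots> \<le> N * \<delta> (Suc k) powr (- b) * (M * G * \<delta> (Suc k))"
        using wn N by (intro mult_left_mono) auto
      also have "\<dots> = M * N * G * (\<delta> (Suc k) powr (- b) * \<delta> (Suc k) powr 1)"
        using dT by simp
      also have "\<delta> (Suc k) powr (- b) * \<delta> (Suc k) powr 1 = \<delta> (Suc k) powr (1 - b)"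
        by (simp only: powr_add[symmetric]) simp
      also have "\<dots> = t powr (1 - b) * ((1/2) powr (1 - b)) ^ Suc k"
        unfolding \<delta>_def using t0 by (subst powr_mult) (auto simp: half_power_powr simp del: power_Suc)
      finally show "nrm Y (B (a k)) \<le> M * N * t powr (1 - b) * G * ((1/2) powr (1 - b)) ^ Suc k"
        by (simp add: mult_ac)
    qed
    have "summable (\<lambda>k. M * N * t powr (1 - b) * G * ((1/2) powr (1 - b)) ^ Suc k)"
      by (intro summable_mult dyadic_sum_summable b)
    note * = Y.sums_in_space[OF mem bd this sums]
    have "(\<Sum>k. M * N * t powr (1 - b) * G * ((1/2) powr (1 - b)) ^ Suc k) = M * N * t powr (1 - b) * G * dyadic_sum b"
      unfolding dyadic_sum_def by (rule suminf_mult[OF dyadic_sum_summable[OF b]])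
    with * show ?thesis by (simp only: mult_ac)
  qed
  then show "B (mild g t) \<in> pts Y" "nrm Y (B (mild g t)) \<le> M * N * dyadic_sum b * t powr (1 - b) * G"
    by blast+
qed

end

text \<open>The interface between interpolation theory and the equation. \<open>\<beta>\<close> is
  the singularity of \<open>U t\<close> from the ambient space into \<open>Y\<close>;
  \<open>\<mu>\<close> uses the room left below \<open>1\<close> and is exchanged in
  \<open>U_smooth_diff\<close> for Hoelder continuity in time. Instances are the interpolation
  spaces and, with \<open>\<beta> = 0\<close>, the ambient space.\<close>

locale smoothing_space = smoothing_semigroup_on U L D A T M + Y: banach_sub Y
  for U L :: "real \<Rightarrow> 'a::banach \<Rightarrow>\<^sub>L 'a" and D :: "'a set" and A :: "'a \<Rightarrow> 'a" and T M
    and Y :: "'a nspace" +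
  fixes \<beta> \<mu> N :: real
  assumes exps: "0 \<le> \<beta>" "0 < \<mu>" "\<beta> + \<mu> < 1" and N: "N > 0"
    and U_smooth: "\<And>t x. 0 < t \<Longrightarrow> t \<le> T \<Longrightarrow> U t x \<in> pts Y \<and> nrm Y (U t x) \<le> N * t powr (- \<beta>) * norm x"
    and U_smooth_diff: "\<And>h t x. 0 \<le> h \<Longrightarrow> h \<le> T \<Longrightarrow> 0 < t \<Longrightarrow> t \<le> T \<Longrightarrow>
        nrm Y (U h (U t x) - U t x) \<le> N * h powr \<mu> * t powr (- (\<beta> + \<mu>)) * norm x"
    and U_orbit: "\<And>x. x \<in> pts Y \<Longrightarrow> continuous_map (top_of_set {0..T}) (ntop Y) (\<lambda>t. U t x)"
begin

lemma U_orbit_mem: "x \<in> pts Y \<Longrightarrow> 0 \<le> t \<Longrightarrow> t \<le> T \<Longrightarrow> U t x \<in> pts Y"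
  using U_orbit unfolding Y.continuous_map_iff by auto

lemma mild_bound:
  assumes "0 \<le> t" "t \<le> T" "continuous_on {0..t} g" "\<And>s. s \<in> {0..t} \<Longrightarrow> norm (g s) \<le> G"
  shows "mild g t \<in> pts Y" "nrm Y (mild g t) \<le> M * N * dyadic_sum \<beta> * t powr (1 - \<beta>) * G"
proof -
  have b: "\<beta> < 1" using exps by simp
  note * = mild_in_subspace[OF Y.banach_sub_axioms b less_imp_le[OF N], of id_blinfun t g G]
  show "mild g t \<in> pts Y" "nrm Y (mild g t) \<le> M * N * dyadic_sum \<beta> * t powr (1 - \<beta>) * G"
    using * assms U_smooth by auto
qed

text \<open>The first summand bounds the integral over the new interval, where
  \<open>h powr (1 - \<beta>)\<close> is split into \<open>h powr \<mu>\<close> and a power of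
  \<open>T\<close>; the second bounds the change of the old integral under
  \<open>U h\<close>.\<close>

definition "hoelder_const = M * N * dyadic_sum \<beta> * T powr (1 - \<beta> - \<mu>) + M * N * dyadic_sum (\<beta> + \<mu>) * T powr (1 - (\<beta> + \<mu>))"

lemma hoelder_const_bounds:
  "M * N * dyadic_sum (\<beta> + \<mu>) * T powr (1 - (\<beta> + \<mu>)) \<le> hoelder_const" "hoelder_const \<ge> 0"
  using M N dyadic_sum_nonneg[of \<beta>] dyadic_sum_nonneg[of "\<beta> + \<mu>"] exps by (simp_all add: hoelder_const_def)

text \<open>The dyadic estimate for the operator \<open>U h - id_blinfun\<close>, whose singularity
  \<open>\<beta> + \<mu>\<close> is still integrable.\<close>

lemma mild_smooth_diff:
  assumes h: "0 \<le> h" "h \<le> T" and s: "0 \<le> s" "s \<le> T" and g: "continuous_on {0..s} g"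
    and G: "\<And>r. r \<in> {0..s} \<Longrightarrow> norm (g r) \<le> G"
  shows "U h (mild g s) - mild g s \<in> pts Y"
    and "nrm Y (U h (mild g s) - mild g s) \<le> M * (N * h powr \<mu>) * dyadic_sum (\<beta> + \<mu>) * s powr (1 - (\<beta> + \<mu>)) * G"
    and "nrm Y (U h (mild g s) - mild g s) \<le> hoelder_const * h powr \<mu> * G"
proof -
  have G0: "G \<ge> 0" using order_trans[OF norm_ge_zero G[of 0]] s by simp
  have BU: "(U h - id_blinfun) (U \<tau> x) \<in> pts Y \<and>
      nrm Y ((U h - id_blinfun) (U \<tau> x)) \<le> N * h powr \<mu> * \<tau> powr (- (\<beta> + \<mu>)) * norm x"
    if "0 < \<tau>" "\<tau> \<le> T" for \<tau> x
  proof -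
    have "U h (U \<tau> x) \<in> pts Y" "U \<tau> x \<in> pts Y"
      using U_smooth[OF that] U_orbit_mem h by auto
    then show ?thesis using U_smooth_diff[OF h that] Y.diff_mem by (simp add: blinfun.diff_left)
  qed
  have N0: "0 \<le> N * h powr \<mu>" using N by simp
  note * = mild_in_subspace[OF Y.banach_sub_axioms exps(3) N0 BU s g G]
  from * show "U h (mild g s) - mild g s \<in> pts Y"
    and 2: "nrm Y (U h (mild g s) - mild g s) \<le> M * (N * h powr \<mu>) * dyadic_sum (\<beta> + \<mu>) * s powr (1 - (\<beta> + \<mu>)) * G"
    by (auto simp: blinfun.diff_left)
  note 2
  also have "\<dots> \<le> M * (N * h powr \<mu>) * dyadic_sum (\<beta> + \<mu>) * T powr (1 - (\<beta> + \<mu>)) * G"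
    using s exps M N dyadic_sum_nonneg[of "\<beta> + \<mu>"] G0 by (intro mult_right_mono mult_left_mono powr_mono2) auto
  also have "\<dots> = M * N * dyadic_sum (\<beta> + \<mu>) * T powr (1 - (\<beta> + \<mu>)) * (h powr \<mu> * G)" by simp
  also have "\<dots> \<le> hoelder_const * (h powr \<mu> * G)" using hoelder_const_bounds G0 by (intro mult_right_mono) auto
  finally show "nrm Y (U h (mild g s) - mild g s) \<le> hoelder_const * h powr \<mu> * G" by simp
qed

text \<open>Restarting at \<open>s\<close> writes the increment as \<open>U h - id_blinfun\<close>
  applied to the old convolution plus a convolution over the length \<open>h\<close>. Only the bound
  \<open>G\<close> on the forcing enters, so whole families of convolutions are
  equicontinuous.\<close>

lemma mild_hoelder:
  assumes "0 \<le> s" "s \<le> t" "t \<le> T" "continuous_on {0..t} g" "\<And>s. s \<in> {0..t} \<Longrightarrow> norm (g s) \<le> G"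
  shows "nrm Y (mild g t - mild g s) \<le> hoelder_const * (t - s) powr \<mu> * G"
proof -
  define h where "h = t - s"
  have h: "0 \<le> h" "h \<le> T" using assms by (auto simp: h_def)
  have gs: "continuous_on {0..s} g" by (rule continuous_on_subset[OF assms(4)]) (use assms in auto)
  have gh: "continuous_on {0..h} (\<lambda>r. g (s + r))"
    by (rule continuous_on_compose2[OF assms(4)]) (use assms in \<open>auto simp: h_def intro!: continuous_intros\<close>)
  have G0: "G \<ge> 0" using order_trans[OF norm_ge_zero assms(5)[of 0]] assms(1-3) by simp
  have 1: "mild (\<lambda>r. g (s + r)) h \<in> pts Y"
    "nrm Y (mild (\<lambda>r. g (s + r)) h) \<le> M * N * dyadic_sum \<beta> * h powr (1 - \<beta>) * G"
    by (rule mild_bound[OF h gh, of G]; use assms in \<open>auto simp: h_def\<close>)+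
  have s: "s \<le> T" "\<And>r. r \<in> {0..s} \<Longrightarrow> norm (g r) \<le> G" using assms by auto
  note 2 = mild_smooth_diff(1,2)[OF h assms(1) s(1) gs s(2)]
  have eq: "mild g t - mild g s = (U h (mild g s) - mild g s) + mild (\<lambda>r. g (s + r)) h"
    using mild_split(2)[OF assms(4,1,2)] by (simp add: h_def)
  have "nrm Y (mild g t - mild g s) \<le> nrm Y (U h (mild g s) - mild g s) + nrm Y (mild (\<lambda>r. g (s + r)) h)"
    unfolding eq by (rule Y.nrm_add[OF 2(1) 1(1)])
  also have "\<dots> \<le> M * (N * h powr \<mu>) * dyadic_sum (\<beta> + \<mu>) * s powr (1 - (\<beta> + \<mu>)) * G + M * N * dyadic_sum \<beta> * h powr (1 - \<beta>) * G"
    using 1 2 by simp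
  also have "\<dots> \<le> M * (N * h powr \<mu>) * dyadic_sum (\<beta> + \<mu>) * T powr (1 - (\<beta> + \<mu>)) * G + M * N * dyadic_sum \<beta> * (h powr \<mu> * T powr (1 - \<beta> - \<mu>)) * G"
  proof (intro add_mono mult_right_mono mult_left_mono G0)
    show "s powr (1 - (\<beta> + \<mu>)) \<le> T powr (1 - (\<beta> + \<mu>))" using assms exps by (intro powr_mono2) auto
    have "h powr (1 - \<beta>) = h powr \<mu> * h powr (1 - \<beta> - \<mu>)" by (simp add: powr_add[symmetric])
    also have "\<dots> \<le> h powr \<mu> * T powr (1 - \<beta> - \<mu>)"
      using h exps by (intro mult_left_mono powr_mono2) auto
    finally show "h powr (1 - \<beta>) \<le> h powr \<mu> * T powr (1 - \<beta> - \<mu>)" .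
  qed (use M N dyadic_sum_nonneg[of \<beta>] dyadic_sum_nonneg[of "\<beta> + \<mu>"] exps in auto)
  also have "\<dots> = hoelder_const * h powr \<mu> * G"
    by (simp add: hoelder_const_def algebra_simps)
  finally show ?thesis by (simp add: h_def)
qed

lemma mild_continuous:
  assumes g: "continuous_on {0..T} g"
  shows "continuous_map (top_of_set {0..T}) (ntop Y) (mild g)"
proof -
  obtain G where G: "\<And>s. s \<in> {0..T} \<Longrightarrow> norm (g s) \<le> G"
    using compact_imp_bounded[OF compact_continuous_image[OF g]] unfolding bounded_iff by fastforce
  have G0: "G \<ge> 0" using order_trans[OF norm_ge_zero G[of 0]] T by simp
  have sub: "continuous_on {0..t} g" if "t \<le> T" for t
    using g by (rule continuous_on_subset) (use that in auto)
  have mem: "mild g t \<in> pts Y" if "t \<in> {0..T}" for t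
    using that G by (intro mild_bound(1)[of t g G] sub) auto
  have hol: "nrm Y (mild g s - mild g t) \<le> hoelder_const * \<bar>s - t\<bar> powr \<mu> * G" if "s \<in> {0..T}" "t \<in> {0..T}" for s t
  proof (cases "s \<le> t")
    case True
    then show ?thesis using mild_hoelder[of s t g G] sub[of t] G that Y.nrm_diff_commute[OF mem mem, of s t]
      by (auto simp: abs_if)
  next
    case False
    then show ?thesis using mild_hoelder[of t s g G] sub[of s] G that by (auto simp: abs_if)
  qed
  show ?thesis
    unfolding Y.continuous_map_iff
  proof (intro conjI ballI allI impI)
    fix t e :: real assume t: "t \<in> {0..T}" and e: "e > 0"
    define d where "d = (e / (hoelder_const * G + 1)) powr (1 / \<mu>)"
    have p: "hoelder_const * G + 1 > 0" using hoelder_const_bounds(2) G0 by (simp add: add_nonneg_pos)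
    have d: "d > 0" "d powr \<mu> = e / (hoelder_const * G + 1)"
      using e p exps by (auto simp: d_def powr_powr)
    show "\<exists>d>0. \<forall>s\<in>{0..T}. \<bar>s - t\<bar> < d \<longrightarrow> nrm Y (mild g s - mild g t) < e"
    proof (intro exI[of _ d] conjI ballI impI d)
      fix s assume s: "s \<in> {0..T}" "\<bar>s - t\<bar> < d"
      have "nrm Y (mild g s - mild g t) \<le> (hoelder_const * G) * \<bar>s - t\<bar> powr \<mu>"
        using hol[OF s(1) t] by (simp add: mult_ac)
      also have "\<dots> \<le> (hoelder_const * G) * d powr \<mu>"
        using s exps hoelder_const_bounds(2) G0 by (intro mult_left_mono powr_mono2) auto
      also have "\<dots> < (hoelder_const * G + 1) * d powr \<mu>" using d(1) by (simp add: distrib_right)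
      also have "\<dots> = e" using d p by simp
      finally show "nrm Y (mild g s - mild g t) < e" .
    qed
  qed (use mem in auto)
qed

text \<open>In a sup norm with exponential weight the convolution is as small as desired. The last
  stretch of length \<open>\<delta>\<close> is small through
  \<open>\<delta> powr (1 - \<beta>)\<close>; the earlier part is smoothed by a fixed
  \<open>U \<delta>\<close> and gains \<open>1 / \<omega>\<close> from integrating the
  weight.\<close>

lemma mild_weighted:
  assumes "\<epsilon> > 0"
  obtains \<omega> :: real where "\<omega> > 0" "\<And>g G t. 0 \<le> t \<Longrightarrow> t \<le> T \<Longrightarrow> continuous_on {0..t} g \<Longrightarrow>
    (\<And>s. s \<in> {0..t} \<Longrightarrow> norm (g s) \<le> G * exp (\<omega> * s)) \<Longrightarrow> nrm Y (mild g t) \<le> \<epsilon> * G * exp (\<omega> * t)"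
proof -
  define K where "K = M * N * dyadic_sum \<beta> + 1"
  have K: "K > 0" "M * N * dyadic_sum \<beta> \<le> K" using M N dyadic_sum_nonneg[of \<beta>] exps by (auto simp: K_def add_nonneg_pos)
  define \<delta> where "\<delta> = min T ((\<epsilon> / (2 * K)) powr (1 / (1 - \<beta>)))"
  have d: "\<delta> > 0" "\<delta> \<le> T" using T K assms by (auto simp: \<delta>_def)
  have dK: "K * \<delta> powr (1 - \<beta>) \<le> \<epsilon> / 2"
  proof -
    have "\<delta> powr (1 - \<beta>) \<le> ((\<epsilon> / (2 * K)) powr (1 / (1 - \<beta>))) powr (1 - \<beta>)"
      using d exps by (intro powr_mono2) (auto simp: \<delta>_def)
    also have "\<dots> = \<epsilon> / (2 * K)" using exps assms K by (simp add: powr_powr)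
    finally show ?thesis using K by (simp add: field_simps)
  qed
  \<comment> \<open>Solves \<open>N * \<delta> powr (- \<beta>) * M / \<omega> = \<epsilon> /
    2\<close>, the share allotted to the earlier part.\<close>
  define \<omega> where "\<omega> = 2 * N * \<delta> powr (- \<beta>) * M / \<epsilon>"
  have l: "\<omega> > 0" using N d M assms by (simp add: \<omega>_def)
  have short: "nrm Y (mild g t) \<le> \<epsilon> / 2 * H"
    if "0 \<le> t" "t \<le> \<delta>" "continuous_on {0..t} g" "\<And>s. s \<in> {0..t} \<Longrightarrow> norm (g s) \<le> H" for g t H
  proof -
    have H0: "H \<ge> 0" using order_trans[OF norm_ge_zero that(4)[of 0]] that(1) by simp
    have "nrm Y (mild g t) \<le> M * N * dyadic_sum \<beta> * t powr (1 - \<beta>) * H"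
      using that d by (intro mild_bound(2)) auto
    also have "\<dots> \<le> K * \<delta> powr (1 - \<beta>) * H"
      using K that exps H0 by (intro mult_right_mono mult_mono powr_mono2) auto
    also have "\<dots> \<le> \<epsilon> / 2 * H" using dK H0 by (intro mult_right_mono)
    finally show ?thesis .
  qed
  show thesis
  proof (rule that[OF l])
    fix g :: "real \<Rightarrow> 'a" and G t assume t: "0 \<le> t" "t \<le> T" and g: "continuous_on {0..t} g"
      and bd: "\<And>s. s \<in> {0..t} \<Longrightarrow> norm (g s) \<le> G * exp (\<omega> * s)"
    have G0: "G \<ge> 0" using order_trans[OF norm_ge_zero bd[of 0]] t by simp
    have bd': "norm (g s) \<le> G * exp (\<omega> * t)" if "s \<in> {0..t}" for s
    proof -
      have "G * exp (\<omega> * s) \<le> G * exp (\<omega> * t)" using that l G0 by (intro mult_left_mono) auto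
      then show ?thesis using bd[OF that] by simp
    qed
    show "nrm Y (mild g t) \<le> \<epsilon> * G * exp (\<omega> * t)"
    proof (cases "t \<le> \<delta>")
      case True
      have "nrm Y (mild g t) \<le> \<epsilon> / 2 * (G * exp (\<omega> * t))" by (rule short[OF t(1) True g bd'])
      also have "\<dots> \<le> \<epsilon> * (G * exp (\<omega> * t))" using assms G0 by (intro mult_right_mono) auto
      finally show ?thesis by (simp add: mult_ac)
    next
      case False
      define s where "s = t - \<delta>"
      have s: "0 \<le> s" "s \<le> t" "t - s = \<delta>" using False d by (auto simp: s_def)
      have gs: "continuous_on {0..s} g" by (rule continuous_on_subset[OF g]) (use s in auto)
      have gd: "continuous_on {0..\<delta>} (\<lambda>r. g (s + r))"
        by (rule continuous_on_compose2[OF g]) (use s in \<open>auto intro!: continuous_intros\<close>)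
      have m1: "mild (\<lambda>r. g (s + r)) \<delta> \<in> pts Y"
        using bd' s d by (intro mild_bound(1)[OF _ _ gd, of "G * exp (\<omega> * t)"]) auto
      have n1: "nrm Y (mild (\<lambda>r. g (s + r)) \<delta>) \<le> \<epsilon> / 2 * (G * exp (\<omega> * t))"
        using bd' s d by (intro short[OF _ _ gd]) auto
      have "norm (mild g s) \<le> M * G * exp (\<omega> * t) / \<omega>"
      proof -
        have I: "((\<lambda>r. M * G * exp (\<omega> * r)) has_integral (M * G * exp (\<omega> * s) / \<omega> - M * G * exp (\<omega> * 0) / \<omega>)) {0..s}"
          using s l by (intro fundamental_theorem_of_calculus)
            (auto intro!: derivative_eq_intros simp: has_real_derivative_iff_has_vector_derivative[symmetric])
        have "norm (mild g s) \<le> integral {0..s} (\<lambda>r. M * G * exp (\<omega> * r))"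
          unfolding mild_def
        proof (rule integral_norm_bound_integral)
          show "(\<lambda>r. U (s - r) (g r)) integrable_on {0..s}" by (rule conv_integrable[OF gs]) simp
          show "(\<lambda>r. M * G * exp (\<omega> * r)) integrable_on {0..s}" using I by blast
          fix r assume r: "r \<in> {0..s}"
          have "norm (U (s - r) (g r)) \<le> M * norm (g r)" using r s t by (intro norm_U_apply) auto
          also have "\<dots> \<le> M * (G * exp (\<omega> * r))" using bd[of r] r s M by (intro mult_left_mono) auto
          finally show "norm (U (s - r) (g r)) \<le> M * G * exp (\<omega> * r)" by simp
        qed
        also have "\<dots> = M * G * exp (\<omega> * s) / \<omega> - M * G / \<omega>"
          using integral_unique[OF I] by (simp only: mult_zero_right exp_zero mult_1_right)
        also have "\<dots> \<le> M * G * exp (\<omega> * s) / \<omega>" using M G0 l by simp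
        also have "\<dots> \<le> M * G * exp (\<omega> * t) / \<omega>"
          using M G0 l s by (intro divide_right_mono mult_left_mono) auto
        finally show ?thesis .
      qed
      then have "N * \<delta> powr (- \<beta>) * norm (mild g s) \<le> N * \<delta> powr (- \<beta>) * (M * G * exp (\<omega> * t) / \<omega>)"
        using N by (intro mult_left_mono) auto
      also have "\<dots> = \<epsilon> / 2 * (G * exp (\<omega> * t))"
        using N d M assms by (simp add: \<omega>_def)
      finally have n2: "nrm Y (U \<delta> (mild g s)) \<le> \<epsilon> / 2 * (G * exp (\<omega> * t))"
        using U_smooth[OF d, of "mild g s"] by simp
      have "nrm Y (mild g t) \<le> nrm Y (U \<delta> (mild g s)) + nrm Y (mild (\<lambda>r. g (s + r)) \<delta>)"
        using mild_split(2)[OF g s(1,2)] s(3) Y.nrm_add[OF _ m1] U_smooth[OF d] by simp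
      with n1 n2 show ?thesis by (simp add: field_simps)
    qed
  qed
qed

end

subsection \<open>Compactness\<close>

text \<open>The common Hoelder bound reduces uniform convergence to convergence on a countable dense
  set of times; compactness of the countable power of \<open>S\<close> takes the place of a diagonal
  argument.\<close>

lemma arzela_ascoli_hoelder:
  fixes v :: "nat \<Rightarrow> real \<Rightarrow> 'a::banach"
  assumes T: "T > 0" and S: "compact S" and mem: "\<And>n t. t \<in> {0..T} \<Longrightarrow> v n t \<in> S"
    and \<mu>: "\<mu> > 0" and K: "K \<ge> 0"
    and eq: "\<And>n s t. s \<in> {0..T} \<Longrightarrow> t \<in> {0..T} \<Longrightarrow> norm (v n s - v n t) \<le> K * \<bar>s - t\<bar> powr \<mu>"
  obtains r w where "strict_mono (r :: nat \<Rightarrow> nat)" "uniform_limit {0..T} (\<lambda>n. v (r n)) w sequentially"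
proof -
  \<comment> \<open>Enumerates the times \<open>T * j / (m + 1)\<close> by coded pairs
    \<open>(j, m)\<close>; the minimum with \<open>T\<close> keeps the pairs with
    \<open>j > m + 1\<close> inside the interval.\<close>
  define q where "q i = min T (T * (real (fst (prod_decode i)) / real (Suc (snd (prod_decode i)))))" for i
  have q: "q i \<in> {0..T}" for i using T by (auto simp: q_def)
  define F where "F n = (\<lambda>i. v n (q i))" for n
  have "compact (PiE UNIV (\<lambda>_::nat. S))"
    using S compactin_PiE[of "\<lambda>_::nat. euclidean :: 'a topology" UNIV "\<lambda>_. S"]
    by (simp add: euclidean_product_topology)
  then have "seq_compact (PiE UNIV (\<lambda>_::nat. S))" by (rule compact_imp_seq_compact)
  moreover have "F n \<in> PiE UNIV (\<lambda>_::nat. S)" for n using mem q by (auto simp: F_def)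
  ultimately obtain l r where r: "strict_mono r" and l: "(F \<circ> r) \<longlonglongrightarrow> l"
    unfolding seq_compact_def by blast
  have lim: "(\<lambda>n. v (r n) (q i)) \<longlonglongrightarrow> l i" for i
    using continuous_on_tendsto_compose[OF continuous_on_product_coordinates[of i] l]
    by (simp add: F_def o_def)
  have "uniformly_Cauchy_on {0..T} (\<lambda>n. v (r n))"
  proof (rule uniformly_Cauchy_onI)
    fix e :: real assume e: "e > 0"
    define d where "d = (e / (4 * (K + 1))) powr (1 / \<mu>)"
    have d: "d > 0" "d powr \<mu> = e / (4 * (K + 1))" using e K \<mu> by (auto simp: d_def powr_powr)
    obtain m where m: "T / d < real (Suc m)"
      using reals_Archimedean2[of "T / d"] less_trans[of _ "real _" "real (Suc _)"] by (metis lessI of_nat_less_iff)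
    \<comment> \<open>For the given \<open>e\<close> only the finitely many grid points of mesh
      \<open>T / (m + 1) < d\<close> are used, so a common index \<open>N0\<close> exists.\<close>
    define I where "I = (\<lambda>j. prod_encode (j, m)) ` {..Suc m}"
    have "\<exists>N. \<forall>k\<ge>N. \<forall>n\<ge>N. dist (v (r k) (q i)) (v (r n) (q i)) < e / 4" for i
      using LIMSEQ_imp_Cauchy[OF lim[of i]] e unfolding Cauchy_def by (meson divide_pos_pos zero_less_numeral)
    then obtain N where N: "\<And>i k n. k \<ge> N i \<Longrightarrow> n \<ge> N i \<Longrightarrow> dist (v (r k) (q i)) (v (r n) (q i)) < e / 4"
      by metis
    define N0 where "N0 = Max (N ` I)"
    have N0: "N i \<le> N0" if "i \<in> I" for i
      unfolding N0_def by (rule Max_ge) (use that in \<open>auto simp: I_def\<close>)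
    have "dist (v (r k) t) (v (r n) t) < e" if t: "t \<in> {0..T}" and kn: "k \<ge> N0" "n \<ge> N0" for t k n
    proof -
      define x where "x = t / T * real (Suc m)"
      have x: "0 \<le> x" "x \<le> real (Suc m)" using t T mult_right_mono[of "t / T" 1 "real (Suc m)"] by (auto simp: x_def simp del: of_nat_Suc)
      define j where "j = nat \<lfloor>x\<rfloor>"
      have j: "real j \<le> x" "x < real j + 1" using x by (auto simp: j_def)
      then have jm: "j \<le> Suc m" using x by linarith
      define i where "i = prod_encode (j, m)"
      have i: "i \<in> I" using jm by (auto simp: I_def i_def)
      have qi: "q i = T * (real j / real (Suc m))"
        using jm T mult_left_mono[of "real j / real (Suc m)" 1 T]
        by (simp add: q_def i_def min_absorb2 del: of_nat_Suc)
      have "t = T * (x / real (Suc m))" using T by (simp add: x_def)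
      then have "t - q i = T / real (Suc m) * (x - real j)"
        unfolding qi by (simp add: right_diff_distrib diff_divide_distrib)
      moreover have "T / real (Suc m) * (x - real j) \<ge> 0" using T j by simp
      ultimately have "\<bar>t - q i\<bar> = T / real (Suc m) * (x - real j)" by linarith
      also have "\<dots> \<le> T / real (Suc m) * 1" using T j by (intro mult_left_mono) auto
      also have "\<dots> < d" using m d by (simp add: field_simps)
      finally have tq: "\<bar>t - q i\<bar> < d" .
      have "norm (v n' t - v n' (q i)) \<le> e / 4" for n'
      proof -
        have "norm (v n' t - v n' (q i)) \<le> K * d powr \<mu>"
          using eq[OF t q, of n' i] powr_mono2[of \<mu> "\<bar>t - q i\<bar>" d] tq \<mu> K
          by (smt (verit) mult_left_mono)
        also have "\<dots> \<le> e / 4" unfolding d(2) using K e by (simp add: field_simps)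
        finally show ?thesis .
      qed
      then have "dist (v (r k) t) (v (r k) (q i)) \<le> e / 4" "dist (v (r n) t) (v (r n) (q i)) \<le> e / 4"
        by (auto simp: dist_norm)
      moreover have "dist (v (r k) (q i)) (v (r n) (q i)) < e / 4"
        using N[of i k n] N0[OF i] kn by simp
      ultimately show ?thesis
        using dist_triangle[of "v (r k) t" "v (r n) t" "v (r k) (q i)"]
          dist_triangle[of "v (r k) (q i)" "v (r n) t" "v (r n) (q i)"] e
        by (simp add: dist_commute)
    qed
    then show "\<exists>M. \<forall>x\<in>{0..T}. \<forall>m\<ge>M. \<forall>n\<ge>M. dist (v (r m) x) (v (r n) x) < e" by blast
  qed
  then have "uniformly_convergent_on {0..T} (\<lambda>n. v (r n))" by (rule Cauchy_uniformly_convergent)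
  then obtain w where "uniform_limit {0..T} (\<lambda>n. v (r n)) w sequentially"
    unfolding uniformly_convergent_on_def by blast
  with r that show thesis by blast
qed

context smoothing_semigroup_on
begin

text \<open>Every element is within \<open>e m\<close> of its image under \<open>U (h m)\<close>,
  and these images lie in a compact set, so the set is totally bounded. It will hold the values of
  all convolutions at once.\<close>

lemma compact_smooth_set:
  assumes cpt: "\<And>t R. 0 < t \<Longrightarrow> t \<le> T \<Longrightarrow> \<exists>K. compact K \<and> U t ` cball 0 R \<subseteq> K"
    and h: "\<And>m. 0 < h m \<and> h m \<le> T" and e: "e \<longlonglongrightarrow> (0::real)"
  shows "compact {x. norm x \<le> R \<and> (\<forall>m::nat. norm (U (h m) x - x) \<le> e m)}" (is "compact ?S")
proof -
  have "?S = cball 0 R \<inter> (\<Inter>m. {x. norm (U (h m) x - x) \<le> e m})" by auto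
  also have "closed \<dots>"
    by (intro closed_Int closed_INT ballI closed_cball closed_Collect_le continuous_intros)
  finally have "complete ?S" by (simp add: complete_eq_closed)
  moreover have "\<exists>k. finite k \<and> ?S \<subseteq> (\<Union>x\<in>k. ball x \<epsilon>)" if eps: "\<epsilon> > 0" for \<epsilon>
  proof -
    have "\<forall>\<^sub>F m in sequentially. e m < \<epsilon> / 2" using e eps by (intro order_tendstoD) auto
    then obtain m where m: "e m < \<epsilon> / 2" using eventually_sequentially by auto
    obtain K where K: "compact K" "U (h m) ` cball 0 R \<subseteq> K" using cpt h by blast
    obtain k where k: "finite k" "K \<subseteq> (\<Union>x\<in>k. ball x (\<epsilon> / 2))"
      using K(1) half_gt_zero[OF eps] unfolding compact_eq_totally_bounded by blast
    have "?S \<subseteq> (\<Union>x\<in>k. ball x \<epsilon>)"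
    proof
      fix x assume x: "x \<in> ?S"
      then have "U (h m) x \<in> K" using K by auto
      then obtain y where y: "y \<in> k" "dist y (U (h m) x) < \<epsilon> / 2" using k by auto
      have "dist (U (h m) x) x < \<epsilon> / 2" using x m by (auto simp: dist_norm dest!: spec[of _ m])
      with y have "dist y x < \<epsilon>" using dist_triangle[of y x "U (h m) x"] by simp
      with y show "x \<in> (\<Union>x\<in>k. ball x \<epsilon>)" by auto
    qed
    with k show ?thesis by blast
  qed
  ultimately show ?thesis unfolding compact_eq_totally_bounded by blast
qed

end

context smoothing_space
begin

lemma continuous_map_sequentially:
  fixes s :: "nat \<Rightarrow> real"
  assumes w: "continuous_map (top_of_set {a..b}) (ntop Y) w" and s: "\<And>n. s n \<in> {a..b}" "s \<longlonglongrightarrow> l" "l \<in> {a..b}"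
  shows "(\<lambda>n. nrm Y (w (s n) - w l)) \<longlonglongrightarrow> 0"
proof (rule LIMSEQ_I)
  fix e :: real assume "e > 0"
  then obtain d where d: "d > 0" "\<forall>x\<in>{a..b}. \<bar>x - l\<bar> < d \<longrightarrow> nrm Y (w x - w l) < e"
    using w s(3) unfolding Y.continuous_map_iff by blast
  obtain N where "\<forall>n\<ge>N. norm (s n - l) < d" using LIMSEQ_D[OF s(2) d(1)] by blast
  moreover have "nrm Y (w (s n) - w l) \<ge> 0" for n
    using w s Y.nrm_nonneg Y.diff_mem unfolding Y.continuous_map_iff by blast
  ultimately show "\<exists>no. \<forall>n\<ge>no. norm (nrm Y (w (s n) - w l) - 0) < e"
    using d(2) s(1) by (intro exI[of _ N]) auto
qed

text \<open>Uniform closeness in the ambient norm is upgraded to closeness in \<open>Y\<close>. The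
  stretch of length \<open>\<delta>\<close> before \<open>t\<close> contributes at most
  \<open>\<epsilon>\<close> for any forcings bounded by \<open>G\<close>; what precedes it is
  smoothed by \<open>U \<delta>\<close>, which turns the ambient bound \<open>b\<close> into
  \<open>N * \<delta> powr (- \<beta>) * b\<close>.\<close>

lemma mild_compare:
  assumes "\<epsilon> > 0" "G \<ge> 0"
  obtains c where "c > 0" "\<And>g g' t b. t \<in> {0..T} \<Longrightarrow> continuous_on {0..T} g \<Longrightarrow> continuous_on {0..T} g' \<Longrightarrow>
     (\<And>s. s \<in> {0..T} \<Longrightarrow> norm (g s) \<le> G) \<Longrightarrow> (\<And>s. s \<in> {0..T} \<Longrightarrow> norm (g' s) \<le> G) \<Longrightarrow>
     (\<And>s. s \<in> {0..T} \<Longrightarrow> norm (mild g s - mild g' s) \<le> b) \<Longrightarrow>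
     nrm Y (mild g t - mild g' t) \<le> \<epsilon> + c * b"
proof -
  \<comment> \<open>The difference of two forcings is bounded by \<open>2 * G\<close>; adding
    \<open>1\<close> keeps the divisor \<open>K\<close> positive.\<close>
  define K where "K = M * N * dyadic_sum \<beta> * (2 * G) + 1"
  have K: "K > 0" "M * N * dyadic_sum \<beta> * (2 * G) \<le> K"
    using M N dyadic_sum_nonneg[of \<beta>] exps assms by (auto simp: K_def add_nonneg_pos)
  define \<delta> where "\<delta> = min T ((\<epsilon> / K) powr (1 / (1 - \<beta>)))"
  have d: "\<delta> > 0" "\<delta> \<le> T" using T K assms by (auto simp: \<delta>_def)
  have dK: "K * \<delta> powr (1 - \<beta>) \<le> \<epsilon>"
  proof -
    have "\<delta> powr (1 - \<beta>) \<le> ((\<epsilon> / K) powr (1 / (1 - \<beta>))) powr (1 - \<beta>)"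
      using d exps by (intro powr_mono2) (auto simp: \<delta>_def)
    also have "\<dots> = \<epsilon> / K" using exps assms K by (simp add: powr_powr)
    finally show ?thesis using K by (simp add: field_simps)
  qed
  show thesis
  proof (rule that[of "N * \<delta> powr (- \<beta>)"])
    show "N * \<delta> powr (- \<beta>) > 0" using N d by simp
    fix g g' :: "real \<Rightarrow> 'a" and t b
    assume t: "t \<in> {0..T}" and g: "continuous_on {0..T} g" "continuous_on {0..T} g'"
      and G: "\<And>s. s \<in> {0..T} \<Longrightarrow> norm (g s) \<le> G" "\<And>s. s \<in> {0..T} \<Longrightarrow> norm (g' s) \<le> G"
      and b: "\<And>s. s \<in> {0..T} \<Longrightarrow> norm (mild g s - mild g' s) \<le> b"
    define k where "k s = g s - g' s" for s
    have kc: "continuous_on {0..T} k" unfolding k_def using g by (intro continuous_intros)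
    have kG: "norm (k s) \<le> 2 * G" if "s \<in> {0..T}" for s
      using norm_triangle_ineq4[of "g s" "g' s"] G[OF that] by (simp add: k_def)
    have mk: "mild g s - mild g' s = mild k s" if "s \<in> {0..T}" for s
      unfolding k_def using g that by (intro mild_diff continuous_on_subset[OF g(1)] continuous_on_subset[OF g(2)]) auto
    have b0: "b \<ge> 0" using order_trans[OF norm_ge_zero b[of 0]] T by simp
    have short: "nrm Y (mild k' s) \<le> \<epsilon> \<and> mild k' s \<in> pts Y"
      if "0 \<le> s" "s \<le> \<delta>" "continuous_on {0..s} k'" "\<And>r. r \<in> {0..s} \<Longrightarrow> norm (k' r) \<le> 2 * G" for s k'
    proof -
      have "nrm Y (mild k' s) \<le> M * N * dyadic_sum \<beta> * s powr (1 - \<beta>) * (2 * G)"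
        using that d by (intro mild_bound(2)) auto
      also have "\<dots> = M * N * dyadic_sum \<beta> * (2 * G) * s powr (1 - \<beta>)" by simp
      also have "\<dots> \<le> K * \<delta> powr (1 - \<beta>)"
        using K that exps by (intro mult_mono powr_mono2) auto
      finally show ?thesis using dK mild_bound(1)[of s k' "2 * G"] that d by auto
    qed
    show "nrm Y (mild g t - mild g' t) \<le> \<epsilon> + N * \<delta> powr (- \<beta>) * b"
    proof (cases "t \<le> \<delta>")
      case True
      have "nrm Y (mild k t) \<le> \<epsilon>" using short[of t k] True t kG continuous_on_subset[OF kc, of "{0..t}"] by auto
      moreover have "0 \<le> N * \<delta> powr (- \<beta>) * b" using N b0 by simp
      ultimately show ?thesis using mk[OF t] by simp
    next
      case False
      define s where "s = t - \<delta>"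
      have s: "0 \<le> s" "s \<le> t" "t - s = \<delta>" "s \<in> {0..T}" using False d t by (auto simp: s_def)
      have kt: "continuous_on {0..t} k" by (rule continuous_on_subset[OF kc]) (use t in auto)
      have gd: "continuous_on {0..\<delta>} (\<lambda>r. k (s + r))"
        by (rule continuous_on_compose2[OF kt]) (use s in \<open>auto intro!: continuous_intros\<close>)
      have 1: "nrm Y (mild (\<lambda>r. k (s + r)) \<delta>) \<le> \<epsilon> \<and> mild (\<lambda>r. k (s + r)) \<delta> \<in> pts Y"
        using s d t by (intro short gd kG) auto
      have "nrm Y (U \<delta> (mild k s)) \<le> N * \<delta> powr (- \<beta>) * norm (mild k s)" using U_smooth[OF d] by simp
      also have "\<dots> \<le> N * \<delta> powr (- \<beta>) * b"
        using b[OF s(4)] mk[OF s(4)] N by (intro mult_left_mono) auto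
      finally have 2: "nrm Y (U \<delta> (mild k s)) \<le> N * \<delta> powr (- \<beta>) * b" .
      have "mild k t = U \<delta> (mild k s) + mild (\<lambda>r. k (s + r)) \<delta>"
        using mild_split(2)[OF kt s(1,2)] s(3) by simp
      then have "nrm Y (mild k t) \<le> nrm Y (U \<delta> (mild k s)) + nrm Y (mild (\<lambda>r. k (s + r)) \<delta>)"
        using Y.nrm_add 1 U_smooth[OF d] by simp
      with 1 2 mk[OF t] show ?thesis by simp
    qed
  qed
qed

end

subsection \<open>Existence of mild solutions\<close>

context smoothing_space
begin

lemma continuous_map_add_mild:
  assumes "x \<in> pts Y" "continuous_on {0..T} g"
  shows "continuous_map (top_of_set {0..T}) (ntop Y) (\<lambda>t. U t x + mild g t)"
  unfolding Y.continuous_map_iff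
proof (intro conjI ballI allI impI)
  have 1: "\<forall>t\<in>{0..T}. U t x \<in> pts Y" "\<And>t e. t \<in> {0..T} \<Longrightarrow> e > 0 \<Longrightarrow> \<exists>d>0. \<forall>s\<in>{0..T}. \<bar>s - t\<bar> < d \<longrightarrow> nrm Y (U s x - U t x) < e"
    using U_orbit[OF assms(1)] unfolding Y.continuous_map_iff by blast+
  have 2: "\<forall>t\<in>{0..T}. mild g t \<in> pts Y" "\<And>t e. t \<in> {0..T} \<Longrightarrow> e > 0 \<Longrightarrow> \<exists>d>0. \<forall>s\<in>{0..T}. \<bar>s - t\<bar> < d \<longrightarrow> nrm Y (mild g s - mild g t) < e"
    using mild_continuous[OF assms(2)] unfolding Y.continuous_map_iff by blast+
  show "U t x + mild g t \<in> pts Y" if "t \<in> {0..T}" for t using 1 2 that Y.add_mem by blast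
  fix t e :: real assume t: "t \<in> {0..T}" and e: "e > 0"
  obtain d1 where d1: "d1 > 0" "\<forall>s\<in>{0..T}. \<bar>s - t\<bar> < d1 \<longrightarrow> nrm Y (U s x - U t x) < e / 2"
    using 1(2)[OF t, of "e/2"] e by auto
  obtain d2 where d2: "d2 > 0" "\<forall>s\<in>{0..T}. \<bar>s - t\<bar> < d2 \<longrightarrow> nrm Y (mild g s - mild g t) < e / 2"
    using 2(2)[OF t, of "e/2"] e by auto
  show "\<exists>d>0. \<forall>s\<in>{0..T}. \<bar>s - t\<bar> < d \<longrightarrow> nrm Y (U s x + mild g s - (U t x + mild g t)) < e"
  proof (intro exI[of _ "min d1 d2"] conjI ballI impI)
    fix s assume s: "s \<in> {0..T}" "\<bar>s - t\<bar> < min d1 d2"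
    have "nrm Y ((U s x - U t x) + (mild g s - mild g t)) \<le> nrm Y (U s x - U t x) + nrm Y (mild g s - mild g t)"
      using 1 2 s t by (intro Y.nrm_add Y.diff_mem) auto
    moreover have "nrm Y (U s x - U t x) < e / 2" "nrm Y (mild g s - mild g t) < e / 2" using d1 d2 s by auto
    ultimately show "nrm Y (U s x + mild g s - (U t x + mild g t)) < e"
      by (simp add: algebra_simps)
  qed (use d1 d2 in auto)
qed

lemma continuous_map_nrm_bounded:
  assumes w: "continuous_map (top_of_set {0..T}) (ntop Y) w"
  obtains B where "B \<ge> 0" "\<And>t. t \<in> {0..T} \<Longrightarrow> nrm Y (w t) \<le> B"
proof -
  have mem: "\<And>t. t \<in> {0..T} \<Longrightarrow> w t \<in> pts Y" using w unfolding Y.continuous_map_iff by blast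
  have "continuous_on {0..T} (\<lambda>t. nrm Y (w t))"
    unfolding continuous_on_iff
  proof (intro ballI allI impI)
    fix t e :: real assume t: "t \<in> {0..T}" and "e > 0"
    then obtain d where d: "d > 0" "\<forall>s\<in>{0..T}. \<bar>s - t\<bar> < d \<longrightarrow> nrm Y (w s - w t) < e"
      using w unfolding Y.continuous_map_iff by blast
    have "dist (nrm Y (w s)) (nrm Y (w t)) < e" if s: "s \<in> {0..T}" "\<bar>s - t\<bar> < d" for s
    proof -
      have "nrm Y (w s) \<le> nrm Y (w s - w t) + nrm Y (w t)" "nrm Y (w t) \<le> nrm Y (w t - w s) + nrm Y (w s)"
        using Y.nrm_add[of "w s - w t" "w t"] Y.nrm_add[of "w t - w s" "w s"] mem s t Y.diff_mem by auto
      moreover have "nrm Y (w s - w t) < e" using d s by auto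
      moreover have "nrm Y (w t - w s) = nrm Y (w s - w t)" using mem s t by (intro Y.nrm_diff_commute) auto
      ultimately show ?thesis by (simp add: dist_real_def)
    qed
    with d show "\<exists>d>0. \<forall>x'\<in>{0..T}. dist x' t < d \<longrightarrow> dist (nrm Y (w x')) (nrm Y (w t)) < e"
      by (auto simp: dist_real_def)
  qed
  from compact_imp_bounded[OF compact_continuous_image[OF this compact_Icc]]
  obtain B where B: "\<And>t. t \<in> {0..T} \<Longrightarrow> \<bar>nrm Y (w t)\<bar> \<le> B"
    unfolding bounded_iff by fastforce
  show thesis
  proof
    show "B \<ge> 0" using order_trans[OF abs_ge_zero B[of 0]] T by simp
    show "nrm Y (w t) \<le> B" if "t \<in> {0..T}" for t using B[OF that] by simp
  qed
qed

end

text \<open>For existence \<open>f\<close> is regarded as a map from \<open>Y\<close> into the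
  ambient space; the finer target \<open>E\<^sub>\<gamma>\<close> matters for regularity. Linear
  growth in the ambient norm still controls the convolution in \<open>Y\<close> because the
  semigroup smooths.\<close>

locale semilinear_problem = smoothing_space U L D A T M Y \<beta> \<mu> N
  for U L :: "real \<Rightarrow> 'a::banach \<Rightarrow>\<^sub>L 'a" and D :: "'a set" and A :: "'a \<Rightarrow> 'a" and T M
    and Y :: "'a nspace" and \<beta> \<mu> N +
  fixes f :: "real \<Rightarrow> 'a \<Rightarrow> 'a" and C :: real
  assumes compact_U: "\<And>t R. 0 < t \<Longrightarrow> t \<le> T \<Longrightarrow> \<exists>K. compact K \<and> U t ` cball 0 R \<subseteq> K"
    and C: "C > 0"
    and f_growth: "\<And>t x. t \<in> {0..T} \<Longrightarrow> x \<in> pts Y \<Longrightarrow> norm (f t x) \<le> C * (1 + nrm Y x)"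
    and f_cont: "\<And>s x t y. (\<And>n. s n \<in> {0..T}) \<Longrightarrow> (\<And>n. x n \<in> pts Y) \<Longrightarrow> t \<in> {0..T} \<Longrightarrow> y \<in> pts Y \<Longrightarrow>
        s \<longlonglongrightarrow> t \<Longrightarrow> (\<lambda>n. nrm Y (x n - y)) \<longlonglongrightarrow> 0 \<Longrightarrow> (\<lambda>n. f (s n) (x n)) \<longlonglongrightarrow> f t y"
begin

text \<open>The time change \<open>p\<close> is the delay in the approximate equations and the
  identity in the limit equation.\<close>

lemma f_comp_continuous:
  assumes w: "continuous_map (top_of_set {0..T}) (ntop Y) w" and p: "continuous_on {0..T} p" "p ` {0..T} \<subseteq> {0..T}"
  shows "continuous_on {0..T} (\<lambda>s. f s (w (p s)))"
  unfolding continuous_on_sequentially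
proof (intro allI ballI impI, elim conjE)
  fix s :: "nat \<Rightarrow> real" and t assume t: "t \<in> {0..T}" and s: "\<forall>n. s n \<in> {0..T}" "s \<longlonglongrightarrow> t"
  have w': "w x \<in> pts Y" if "x \<in> {0..T}" for x using w that unfolding Y.continuous_map_iff by blast
  have pm: "p x \<in> {0..T}" if "x \<in> {0..T}" for x using p(2) that by blast
  have "(\<lambda>n. p (s n)) \<longlonglongrightarrow> p t"
    by (rule continuous_on_tendsto_compose[OF p(1) s(2) t]) (use s in auto)
  then have "(\<lambda>n. nrm Y (w (p (s n)) - w (p t))) \<longlonglongrightarrow> 0"
    using s t pm by (intro continuous_map_sequentially[OF w]) blast+
  then have "(\<lambda>n. f (s n) (w (p (s n)))) \<longlonglongrightarrow> f t (w (p t))"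
    using s t pm w' by (intro f_cont) blast+
  then show "((\<lambda>s. f s (w (p s))) \<circ> s) \<longlonglongrightarrow> f t (w (p t))" by (simp add: o_def)
qed

text \<open>Picard iteration for the equation with delay \<open>h\<close>; the iterate \<open>k\<close> is exact on \<open>[0, k h]\<close>.\<close>

fun delayed_picard :: "real \<Rightarrow> 'a \<Rightarrow> nat \<Rightarrow> real \<Rightarrow> 'a" where
  "delayed_picard h x 0 t = U t x"
| "delayed_picard h x (Suc k) t = U t x + mild (\<lambda>s. f s (delayed_picard h x k (max 0 (s - h)))) t"

context
  fixes x0 :: 'a
  assumes x0: "x0 \<in> pts Y"
begin

lemma delayed_picard_continuous:
  "h \<ge> 0 \<Longrightarrow> continuous_map (top_of_set {0..T}) (ntop Y) (delayed_picard h x0 k)"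
proof (induction k)
  case 0
  then show ?case using U_orbit[OF x0] by simp
next
  case (Suc k)
  have "continuous_on {0..T} (\<lambda>s. f s (delayed_picard h x0 k (max 0 (s - h))))"
    using Suc by (intro f_comp_continuous continuous_intros) auto
  from continuous_map_add_mild[OF x0 this] show ?case by simp
qed

lemma delayed_picard_forcing_continuous:
  "h \<ge> 0 \<Longrightarrow> continuous_on {0..T} (\<lambda>s. f s (delayed_picard h x0 k (max 0 (s - h))))"
  by (intro f_comp_continuous delayed_picard_continuous continuous_intros) auto

lemma delayed_picard_mem: "h \<ge> 0 \<Longrightarrow> t \<in> {0..T} \<Longrightarrow> delayed_picard h x0 k t \<in> pts Y"
  using delayed_picard_continuous unfolding Y.continuous_map_iff by blast

text \<open>The value at \<open>t\<close> depends on the previous iterate only up to time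
  \<open>max 0 (t - h)\<close>, so each iteration extends the agreement by one step of length
  \<open>h\<close>.\<close>

lemma delayed_picard_stable:
  assumes h: "h \<ge> 0" and "t \<in> {0..T}" "t \<le> real k * h"
  shows "delayed_picard h x0 (Suc k) t = delayed_picard h x0 k t"
  using assms(2,3)
proof (induction k arbitrary: t)
  case 0
  then have "t = 0" by simp
  then show ?case by simp
next
  case (Suc k)
  have "mild (\<lambda>s. f s (delayed_picard h x0 (Suc k) (max 0 (s - h)))) t = mild (\<lambda>s. f s (delayed_picard h x0 k (max 0 (s - h)))) t"
  proof (rule mild_cong)
    fix s assume s: "s \<in> {0..t}"
    have "max 0 (s - h) \<in> {0..T}" "max 0 (s - h) \<le> real k * h"
      using s Suc.prems h by (auto simp: algebra_simps)
    then show "f s (delayed_picard h x0 (Suc k) (max 0 (s - h))) = f s (delayed_picard h x0 k (max 0 (s - h)))"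
      using Suc.IH by simp
  qed
  then show ?case by simp
qed

text \<open>The weighted estimate absorbs the linear growth. The delay only moves the argument of
  the increasing weight to the left, so one constant serves every delay and every iterate.\<close>

lemma delayed_picard_bounded:
  obtains R where "R \<ge> 0" "\<And>h k t. h \<ge> 0 \<Longrightarrow> t \<in> {0..T} \<Longrightarrow> nrm Y (delayed_picard h x0 k t) \<le> R"
proof -
  obtain a where a: "a \<ge> 0" "\<And>t. t \<in> {0..T} \<Longrightarrow> nrm Y (U t x0) \<le> a"
    using continuous_map_nrm_bounded[OF U_orbit[OF x0]] by blast
  obtain om where om: "om > 0" "\<And>g G t. 0 \<le> t \<Longrightarrow> t \<le> T \<Longrightarrow> continuous_on {0..t} g \<Longrightarrow>
    (\<And>s. s \<in> {0..t} \<Longrightarrow> norm (g s) \<le> G * exp (om * s)) \<Longrightarrow> nrm Y (mild g t) \<le> 1 / (2 * C) * G * exp (om * t)"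
    using mild_weighted[of "1 / (2 * C)"] C by auto
  \<comment> \<open>Solves \<open>W = a + (1 + W) / 2\<close>, which is the condition left after
    applying the weighted estimate with constant \<open>1 / (2 * C)\<close>.\<close>
  define W where "W = 2 * a + 1"
  have W: "nrm Y (delayed_picard h x0 k t) \<le> W * exp (om * t)" if h: "h \<ge> 0" and "t \<in> {0..T}" for h k t
    using that(2)
  proof (induction k arbitrary: t)
    case 0
    have "a * 1 \<le> W * exp (om * t)" using a om 0 by (intro mult_mono) (auto simp: W_def)
    then show ?case using a(2)[OF 0] by simp
  next
    case (Suc k)
    define g where "g s = f s (delayed_picard h x0 k (max 0 (s - h)))" for s
    have gc: "continuous_on {0..t} g" unfolding g_def
      by (rule continuous_on_subset[OF delayed_picard_forcing_continuous[OF h]]) (use Suc.prems in auto)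
    have gb: "norm (g s) \<le> (C * (1 + W)) * exp (om * s)" if s: "s \<in> {0..t}" for s
    proof -
      have m: "max 0 (s - h) \<in> {0..T}" using s h Suc.prems by auto
      have "norm (g s) \<le> C * (1 + nrm Y (delayed_picard h x0 k (max 0 (s - h))))"
        unfolding g_def using s Suc.prems by (intro f_growth delayed_picard_mem[OF h m]) auto
      also have "\<dots> \<le> C * (1 * exp (om * s) + W * exp (om * s))"
      proof (intro mult_left_mono add_mono)
        show "1 \<le> 1 * exp (om * s)" using om s by simp
        have "nrm Y (delayed_picard h x0 k (max 0 (s - h))) \<le> W * exp (om * max 0 (s - h))" by (rule Suc.IH[OF m])
        also have "\<dots> \<le> W * exp (om * s)" using a om s h by (intro mult_left_mono) (auto simp: W_def)
        finally show "nrm Y (delayed_picard h x0 k (max 0 (s - h))) \<le> W * exp (om * s)" .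
      qed (use C in auto)
      finally show ?thesis by (simp add: algebra_simps)
    qed
    have mm: "mild g t \<in> pts Y" using mild_continuous[of g] delayed_picard_forcing_continuous[OF h] Suc.prems
      unfolding g_def Y.continuous_map_iff by blast
    have "nrm Y (delayed_picard h x0 (Suc k) t) \<le> nrm Y (U t x0) + nrm Y (mild g t)"
      using Y.nrm_add[OF U_orbit_mem[OF x0, of t] mm] Suc.prems by (simp add: g_def[abs_def])
    also have "\<dots> \<le> a + 1 / (2 * C) * (C * (1 + W)) * exp (om * t)"
      using Suc.prems by (intro add_mono a om(2) gc gb) auto
    also have "\<dots> \<le> a * exp (om * t) + 1 / (2 * C) * (C * (1 + W)) * exp (om * t)"
      using om Suc.prems a(1) mult_left_mono[of 1 "exp (om * t)" a] by simp
    also have "\<dots> = W * exp (om * t)" using C by (simp add: W_def field_simps)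
    finally show ?case .
  qed
  show thesis
  proof (rule that[of "W * exp (om * T)"])
    show "W * exp (om * T) \<ge> 0" using a by (simp add: W_def)
    show "nrm Y (delayed_picard h x0 k t) \<le> W * exp (om * T)" if "h \<ge> 0" "t \<in> {0..T}" for h k t
    proof -
      have "W * exp (om * t) \<le> W * exp (om * T)" using that om a by (intro mult_left_mono) (auto simp: W_def)
      then show ?thesis using W[OF that] by (meson order_trans)
    qed
  qed
qed

theorem mild_solution_exists:
  "\<exists>u. continuous_map (top_of_set {0..T}) (ntop Y) u \<and>
       (\<forall>t\<in>{0..T}. u t = U t x0 + mild (\<lambda>s. f s (u s)) t)"
proof -
  obtain R where R: "R \<ge> 0" "\<And>h k t. h \<ge> 0 \<Longrightarrow> t \<in> {0..T} \<Longrightarrow> nrm Y (delayed_picard h x0 k t) \<le> R"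
    using delayed_picard_bounded by blast
  \<comment> \<open>With delay \<open>T / (n + 1)\<close> the iterate \<open>n + 1\<close> is
    already stationary on the whole interval, so \<open>u n\<close> solves the delayed equation
    exactly.\<close>
  define h where "h n = T / real (Suc n)" for n
  have h: "0 < h n" "h n \<le> T" "T = real (Suc n) * h n" for n using T by (auto simp: h_def field_simps)
  have h0: "h \<longlonglongrightarrow> 0" unfolding h_def
    using tendsto_mult_right_zero[OF LIMSEQ_inverse_real_of_nat, of T] by (simp add: divide_inverse)
  define u where "u n = delayed_picard (h n) x0 (Suc n)" for n
  define g where "g n = (\<lambda>s. f s (u n (max 0 (s - h n))))" for n
  define G where "G = C * (1 + R)"
  have hn: "0 \<le> h n" for n using h(1)[of n] by simp
  have uc: "continuous_map (top_of_set {0..T}) (ntop Y) (u n)" for n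
    unfolding u_def by (rule delayed_picard_continuous[OF hn])
  have um: "u n t \<in> pts Y" if "t \<in> {0..T}" for n t unfolding u_def by (rule delayed_picard_mem[OF hn that])
  have gc: "continuous_on {0..T} (g n)" for n
    unfolding g_def u_def by (rule delayed_picard_forcing_continuous[OF hn])
  have mx: "max 0 (s - h n) \<in> {0..T}" if "s \<in> {0..T}" for s n using that hn[of n] by auto
  have gG: "norm (g n s) \<le> G" if "s \<in> {0..T}" for n s
  proof -
    have "norm (g n s) \<le> C * (1 + nrm Y (u n (max 0 (s - h n))))"
      unfolding g_def using that um mx by (intro f_growth) auto
    also have "\<dots> \<le> G" unfolding G_def u_def using C R(2)[OF hn mx[OF that]] by (intro mult_left_mono add_left_mono) (auto simp del: delayed_picard.simps)
    finally show ?thesis .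
  qed
  have G0: "G \<ge> 0" using C R by (simp add: G_def)
  have ueq: "u n t = U t x0 + mild (g n) t" if t: "t \<in> {0..T}" for n t
  proof -
    have "u n t = delayed_picard (h n) x0 (Suc (Suc n)) t"
      unfolding u_def using delayed_picard_stable[OF hn[of n] t, of "Suc n"] t h(3)[of n] by (simp del: delayed_picard.simps)
    then show ?thesis by (simp only: g_def u_def delayed_picard.simps(2))
  qed
  have gct: "continuous_on {0..t} (g n)" if "t \<le> T" for n t
    by (rule continuous_on_subset[OF gc]) (use that in auto)
  obtain c where c: "c > 0" "\<forall>x\<in>pts Y. norm x \<le> c * nrm Y x" using Y.embed by blast
  \<comment> \<open>Bounds the distance of every convolution from its image under
    \<open>U (h m)\<close>, uniformly in \<open>n\<close> and \<open>t\<close>. The delays are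
    reused here as smoothing times that tend to \<open>0\<close>.\<close>
  define e where "e m = c * (hoelder_const * h m powr \<mu> * G)" for m
  have e0: "e \<longlonglongrightarrow> 0"
  proof -
    have "(\<lambda>m. h m powr \<mu>) \<longlonglongrightarrow> 0"
      using tendsto_powr'[OF h0 tendsto_const[of \<mu>]] exps hn by simp
    then show ?thesis unfolding e_def
      by (intro tendsto_mult_right_zero tendsto_mult_left_zero)
  qed
  define S where "S = {x. norm x \<le> M * G * T \<and> (\<forall>m. norm (U (h m) x - x) \<le> e m)}"
  have S: "compact S"
    unfolding S_def by (rule compact_smooth_set[OF compact_U _ e0]) (use h in auto)
  have vS: "mild (g n) t \<in> S" if t: "t \<in> {0..T}" for n t
  proof -
    have "norm (mild (g n) t) \<le> M * G * (t - 0)"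
      unfolding mild_def by (rule conv_norm[OF gct]) (use t gG in auto)
    also have "\<dots> \<le> M * G * T" using t M G0 by (intro mult_left_mono) auto
    finally have 1: "norm (mild (g n) t) \<le> M * G * T" .
    have "norm (U (h m) (mild (g n) t) - mild (g n) t) \<le> e m" for m
    proof -
      have d: "U (h m) (mild (g n) t) - mild (g n) t \<in> pts Y"
        "nrm Y (U (h m) (mild (g n) t) - mild (g n) t) \<le> hoelder_const * h m powr \<mu> * G"
        using t gG h by (intro mild_smooth_diff(1)[of _ _ _ G] mild_smooth_diff(3) gct; auto simp: less_imp_le)+
      then have "norm (U (h m) (mild (g n) t) - mild (g n) t) \<le> c * nrm Y (U (h m) (mild (g n) t) - mild (g n) t)"
        using c by blast
      also have "\<dots> \<le> e m" unfolding e_def using c d by (intro mult_left_mono) auto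
      finally show ?thesis .
    qed
    with 1 show ?thesis by (simp add: S_def)
  qed
  have vm: "mild (g n) t \<in> pts Y" if "t \<in> {0..T}" for n t
    using that gG by (intro mild_bound(1)[of _ _ G] gct) auto
  have hol1: "norm (mild (g n) s - mild (g n) t) \<le> c * hoelder_const * G * \<bar>s - t\<bar> powr \<mu>"
    if "s \<le> t" "s \<in> {0..T}" "t \<in> {0..T}" for n s t
  proof -
    have "norm (mild (g n) s - mild (g n) t) \<le> c * nrm Y (mild (g n) t - mild (g n) s)"
      using c vm Y.diff_mem that by (metis norm_minus_commute)
    also have "\<dots> \<le> c * (hoelder_const * (t - s) powr \<mu> * G)"
      using c that gG by (intro mult_left_mono mild_hoelder gct) auto
    finally show ?thesis using that by (simp add: mult_ac abs_if)
  qed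
  have hol: "norm (mild (g n) s - mild (g n) t) \<le> c * hoelder_const * G * \<bar>s - t\<bar> powr \<mu>"
    if "s \<in> {0..T}" "t \<in> {0..T}" for n s t
    using hol1[of s t n] hol1[of t s n] that by (cases "s \<le> t") (auto simp: norm_minus_commute abs_minus_commute)
  have K0: "c * hoelder_const * G \<ge> 0" using c hoelder_const_bounds(2) G0 by simp
  obtain r w where r: "strict_mono r" and wlim: "uniform_limit {0..T} (\<lambda>n. mild (g (r n))) w sequentially"
    by (rule arzela_ascoli_hoelder[OF T S vS exps(2) K0 hol])
  \<comment> \<open>Only convolution parts are compared: the orbit \<open>U t x0\<close> is common
    to all approximations and cancels in differences.\<close>
  define v where "v n = mild (g (r n))" for n
  have vmem: "v n t \<in> pts Y" if "t \<in> {0..T}" for n t unfolding v_def by (rule vm[OF that])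
  have vw: "\<exists>N. \<forall>n\<ge>N. \<forall>t\<in>{0..T}. norm (v n t - w t) < \<epsilon>" if "\<epsilon> > 0" for \<epsilon>
    using uniform_limitD[OF wlim that] by (auto simp: v_def dist_norm eventually_sequentially)
  have vlim: "(\<lambda>n. v n t) \<longlonglongrightarrow> w t" if "t \<in> {0..T}" for t
    using tendsto_uniform_limitI[OF wlim that] by (simp add: v_def)
  \<comment> \<open>Uniform convergence is known so far in the ambient norm only. The bound
    \<open>G\<close> common to all forcings allows \<open>mild_compare\<close> to turn it into a
    uniform Cauchy property in \<open>Y\<close>.\<close>
  have cauchy: "\<exists>N. \<forall>n\<ge>N. \<forall>m\<ge>N. \<forall>t\<in>{0..T}. nrm Y (v n t - v m t) \<le> \<epsilon>" if eps: "\<epsilon> > 0" for \<epsilon>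
  proof -
    obtain k where k: "k > 0" "\<And>g g' t b. t \<in> {0..T} \<Longrightarrow> continuous_on {0..T} g \<Longrightarrow> continuous_on {0..T} g' \<Longrightarrow>
     (\<And>s. s \<in> {0..T} \<Longrightarrow> norm (g s) \<le> G) \<Longrightarrow> (\<And>s. s \<in> {0..T} \<Longrightarrow> norm (g' s) \<le> G) \<Longrightarrow>
     (\<And>s. s \<in> {0..T} \<Longrightarrow> norm (mild g s - mild g' s) \<le> b) \<Longrightarrow>
     nrm Y (mild g t - mild g' t) \<le> \<epsilon> / 2 + k * b"
      using mild_compare[of "\<epsilon> / 2" G] eps G0 by (metis half_gt_zero)
    obtain N where N: "\<forall>n\<ge>N. \<forall>t\<in>{0..T}. norm (v n t - w t) < \<epsilon> / (4 * k)"
      using vw[of "\<epsilon> / (4 * k)"] eps k by auto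
    have "nrm Y (v n t - v m t) \<le> \<epsilon>" if nm: "n \<ge> N" "m \<ge> N" and t: "t \<in> {0..T}" for n m t
    proof -
      have "norm (v n s - v m s) \<le> \<epsilon> / (2 * k)" if s: "s \<in> {0..T}" for s
      proof -
        have "norm (v n s - v m s) \<le> norm (v n s - w s) + norm (v m s - w s)"
          using norm_triangle_ineq4[of "v n s - w s" "v m s - w s"] by simp
        also have "\<dots> \<le> \<epsilon> / (4 * k) + \<epsilon> / (4 * k)"
          using N nm s by (intro add_mono) (auto simp: less_imp_le)
        also have "\<dots> = \<epsilon> / (2 * k)" by simp
        finally show ?thesis .
      qed
      then have "nrm Y (v n t - v m t) \<le> \<epsilon> / 2 + k * (\<epsilon> / (2 * k))"
        unfolding v_def by (intro k(2)[OF t gc gc gG gG])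
      also have "\<dots> = \<epsilon>" using k by simp
      finally show ?thesis .
    qed
    then show ?thesis by blast
  qed
  \<comment> \<open>Limits in \<open>Y\<close> are also ambient limits, so the limit supplied by
    completeness of \<open>Y\<close> is \<open>w t\<close>.\<close>
  have wY: "w t \<in> pts Y \<and> (\<lambda>n. nrm Y (v n t - w t)) \<longlonglongrightarrow> 0" if t: "t \<in> {0..T}" for t
  proof -
    have "\<exists>l\<in>pts Y. (\<lambda>n. nrm Y (v n t - l)) \<longlonglongrightarrow> 0"
    proof (rule Y.complete[OF vmem[OF t]])
      fix \<epsilon> :: real assume "\<epsilon> > 0"
      then obtain N where N: "\<forall>n\<ge>N. \<forall>m\<ge>N. \<forall>t\<in>{0..T}. nrm Y (v n t - v m t) \<le> \<epsilon> / 2"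
        using cauchy[of "\<epsilon> / 2"] by auto
      show "\<exists>N. \<forall>m\<ge>N. \<forall>n\<ge>N. nrm Y (v m t - v n t) < \<epsilon>"
      proof (intro exI[of _ N] allI impI)
        fix m n assume "m \<ge> N" "n \<ge> N"
        then have "nrm Y (v m t - v n t) \<le> \<epsilon> / 2" using N t by blast
        also have "\<dots> < \<epsilon>" using \<open>\<epsilon> > 0\<close> by simp
        finally show "nrm Y (v m t - v n t) < \<epsilon>" .
      qed
    qed
    then obtain l where l: "l \<in> pts Y" "(\<lambda>n. nrm Y (v n t - l)) \<longlonglongrightarrow> 0" by blast
    have "(\<lambda>n. v n t) \<longlonglongrightarrow> l" by (rule Y.tendsto_of_nrm[OF vmem[OF t] l])
    with vlim[OF t] have "l = w t" using LIMSEQ_unique by blast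
    with l show ?thesis by simp
  qed
  have unif: "\<exists>N. \<forall>n\<ge>N. \<forall>t\<in>{0..T}. nrm Y (v n t - w t) \<le> \<epsilon>" if eps: "\<epsilon> > 0" for \<epsilon>
  proof -
    obtain N where N: "\<forall>n\<ge>N. \<forall>m\<ge>N. \<forall>t\<in>{0..T}. nrm Y (v n t - v m t) \<le> \<epsilon>"
      using cauchy[OF eps] by blast
    have "nrm Y (v n t - w t) \<le> \<epsilon>" if n: "n \<ge> N" and t: "t \<in> {0..T}" for n t
    proof (rule LIMSEQ_le_const)
      show "(\<lambda>m. \<epsilon> + nrm Y (v m t - w t)) \<longlonglongrightarrow> \<epsilon>"
        using tendsto_add[OF tendsto_const[of \<epsilon>] conjunct2[OF wY[OF t]]] by simp
      have "nrm Y (v n t - w t) \<le> \<epsilon> + nrm Y (v m t - w t)" if "m \<ge> N" for m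
        using Y.nrm_triangle[OF vmem[OF t] vmem[OF t] conjunct1[OF wY[OF t]], of n m] N n that t by fastforce
      then show "\<exists>N. \<forall>m\<ge>N. nrm Y (v n t - w t) \<le> \<epsilon> + nrm Y (v m t - w t)" by blast
    qed
    then show ?thesis by blast
  qed
  define z where "z t = U t x0 + w t" for t
  have uz: "u (r n) t - z t = v n t - w t" if "t \<in> {0..T}" for n t
    unfolding z_def v_def using ueq[OF that] by simp
  have zm: "z t \<in> pts Y" if "t \<in> {0..T}" for t
    unfolding z_def using that wY U_orbit_mem[OF x0] Y.add_mem by auto
  have zc: "continuous_map (top_of_set {0..T}) (ntop Y) z"
    unfolding Y.continuous_map_iff
  proof (intro conjI ballI allI impI zm)
    fix t \<epsilon> :: real assume t: "t \<in> {0..T}" and eps: "\<epsilon> > 0"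
    obtain N where N: "\<forall>n\<ge>N. \<forall>t\<in>{0..T}. nrm Y (v n t - w t) \<le> \<epsilon> / 4"
      using unif[of "\<epsilon> / 4"] eps by auto
    obtain d where d: "d > 0" "\<forall>s\<in>{0..T}. \<bar>s - t\<bar> < d \<longrightarrow> nrm Y (u (r N) s - u (r N) t) < \<epsilon> / 4"
    proof -
      have "\<epsilon> / 4 > 0" using eps by simp
      then show thesis using that uc[of "r N"] t unfolding Y.continuous_map_iff by blast
    qed
    show "\<exists>d>0. \<forall>s\<in>{0..T}. \<bar>s - t\<bar> < d \<longrightarrow> nrm Y (z s - z t) < \<epsilon>"
    proof (intro exI[of _ d] conjI ballI impI d)
      fix s assume s: "s \<in> {0..T}" "\<bar>s - t\<bar> < d"
      have "nrm Y (z s - z t) \<le> nrm Y (z s - u (r N) s) + nrm Y (u (r N) s - u (r N) t) + nrm Y (u (r N) t - z t)"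
        using s t zm um by (intro Y.nrm_triangle4) auto
      moreover have "nrm Y (z s - u (r N) s) = nrm Y (u (r N) s - z s)"
        using s zm um by (intro Y.nrm_diff_commute) auto
      moreover have "nrm Y (u (r N) s - z s) \<le> \<epsilon> / 4" "nrm Y (u (r N) t - z t) \<le> \<epsilon> / 4"
        unfolding uz[OF s(1)] uz[OF t] using N s t by auto
      moreover have "nrm Y (u (r N) s - u (r N) t) < \<epsilon> / 4" using d s by auto
      ultimately show "nrm Y (z s - z t) < \<epsilon>" using eps by linarith
    qed
  qed
  define q where "q s = f s (z s)" for s
  have qc: "continuous_on {0..T} q"
    unfolding q_def using f_comp_continuous[OF zc, of "\<lambda>s. s"] by (simp add: continuous_on_id)
  \<comment> \<open>Continuity of \<open>f\<close> need not be uniform on bounded sets of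
    \<open>Y\<close>, so one argues by contradiction: the times violating uniform convergence
    accumulate at some \<open>l\<close>, the delayed states there converge to \<open>z l\<close> in
    \<open>Y\<close>, and continuity of \<open>f\<close> at \<open>(l, z l)\<close> is
    contradicted.\<close>
  have gq: "\<exists>N. \<forall>n\<ge>N. \<forall>s\<in>{0..T}. norm (g (r n) s - q s) < \<epsilon>" if eps: "\<epsilon> > 0" for \<epsilon>
  proof (rule ccontr)
    assume "\<not> ?thesis"
    then have "\<forall>k. \<exists>n s. n \<ge> k \<and> s \<in> {0..T} \<and> norm (g (r n) s - q s) \<ge> \<epsilon>" by (meson not_less)
    then obtain n s where ns: "\<And>k. n k \<ge> k" "\<And>k. s k \<in> {0..T}" "\<And>k. norm (g (r (n k)) (s k) - q (s k)) \<ge> \<epsilon>"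
      by metis
    obtain l p where l: "l \<in> {0..T}" "strict_mono p" "(s \<circ> p) \<longlonglongrightarrow> l"
    proof -
      have "\<forall>k. s k \<in> {0..T}" using ns(2) by blast
      then show thesis using that compact_Icc[of 0 T] unfolding compact_def by blast
    qed
    define a where "a k = n (p k)" for k
    define b where "b k = s (p k)" for k
    have bl: "b \<longlonglongrightarrow> l" "\<And>k. b k \<in> {0..T}" using l ns(2) by (auto simp: b_def[abs_def] o_def)
    have ak: "a k \<ge> k" for k using ns(1)[of "p k"] seq_suble[OF l(2), of k] by (simp add: a_def)
    have rak: "filterlim (\<lambda>k. r (a k)) at_top sequentially"
      using ak seq_suble[OF r] by (intro filterlim_at_top_mono[OF filterlim_ident]) (auto intro!: always_eventually intro: order_trans)
    define c where "c k = max 0 (b k - h (r (a k)))" for k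
    have hk: "(\<lambda>k. h (r (a k))) \<longlonglongrightarrow> 0" by (rule filterlim_compose[OF h0 rak])
    have cl: "c \<longlonglongrightarrow> l"
    proof -
      have "c \<longlonglongrightarrow> max 0 (l - 0)" unfolding c_def by (intro tendsto_intros bl hk)
      then show ?thesis using l by simp
    qed
    have cT: "c k \<in> {0..T}" for k unfolding c_def by (rule mx[OF bl(2)])
    have conv: "(\<lambda>k. nrm Y (u (r (a k)) (c k) - z l)) \<longlonglongrightarrow> 0"
    proof (rule LIMSEQ_I)
      fix e :: real assume e: "e > 0"
      obtain N where N: "\<forall>n\<ge>N. \<forall>t\<in>{0..T}. nrm Y (v n t - w t) \<le> e / 2" using unif[of "e/2"] e by auto
      have "\<exists>no. \<forall>k\<ge>no. norm (nrm Y (z (c k) - z l) - 0) < e / 2"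
        by (rule LIMSEQ_D[OF continuous_map_sequentially[OF zc cT cl l(1)]]) (use e in simp)
      then obtain N' where "\<forall>k\<ge>N'. norm (nrm Y (z (c k) - z l) - 0) < e / 2" by blast
      then have N': "\<forall>k\<ge>N'. nrm Y (z (c k) - z l) < e / 2" by (auto dest: abs_less_iff[THEN iffD1])
      have "norm (nrm Y (u (r (a k)) (c k) - z l) - 0) < e" if k: "k \<ge> max N N'" for k
      proof -
        have "nrm Y (u (r (a k)) (c k) - z l) \<le> nrm Y (u (r (a k)) (c k) - z (c k)) + nrm Y (z (c k) - z l)"
          using cT l by (intro Y.nrm_triangle um zm) auto
        moreover have "nrm Y (u (r (a k)) (c k) - z (c k)) \<le> e / 2"
          unfolding uz[OF cT] using N k ak[of k] cT[of k] by simp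
        moreover have "nrm Y (z (c k) - z l) < e / 2" using N' k by auto
        moreover have "nrm Y (u (r (a k)) (c k) - z l) \<ge> 0"
          using cT l by (intro Y.nrm_nonneg Y.diff_mem um zm) auto
        ultimately show ?thesis by simp
      qed
      then show "\<exists>no. \<forall>k\<ge>no. norm (nrm Y (u (r (a k)) (c k) - z l) - 0) < e" by blast
    qed
    have "(\<lambda>k. f (b k) (u (r (a k)) (c k))) \<longlonglongrightarrow> f l (z l)"
      by (rule f_cont[OF bl(2) um[OF cT] l(1) zm[OF l(1)] bl(1) conv])
    then have 1: "(\<lambda>k. g (r (a k)) (b k)) \<longlonglongrightarrow> q l" by (simp add: g_def q_def c_def)
    have 2: "(\<lambda>k. q (b k)) \<longlonglongrightarrow> q l"
      by (rule continuous_on_tendsto_compose[OF qc bl(1) l(1)]) (use bl in auto)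
    have "(\<lambda>k. norm (g (r (a k)) (b k) - q (b k))) \<longlonglongrightarrow> 0"
      using tendsto_norm[OF tendsto_diff[OF 1 2]] by simp
    then have "\<epsilon> \<le> 0"
      by (rule LIMSEQ_le_const) (use ns(3) in \<open>auto simp: a_def b_def\<close>)
    then show False using eps by simp
  qed
  have fixp: "w t = mild q t" if t: "t \<in> {0..T}" for t
  proof -
    have "(\<lambda>n. v n t) \<longlonglongrightarrow> mild q t"
    proof (rule LIMSEQ_I)
      fix e :: real assume e: "e > 0"
      define \<epsilon> where "\<epsilon> = e / (2 * M * T)"
      have eps: "\<epsilon> > 0" using e M T by (simp add: \<epsilon>_def)
      obtain N where N: "\<forall>n\<ge>N. \<forall>s\<in>{0..T}. norm (g (r n) s - q s) < \<epsilon>" using gq[OF eps] by blast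
      have "norm (v n t - mild q t) < e" if n: "n \<ge> N" for n
      proof -
        have qct: "continuous_on {0..t} q" by (rule continuous_on_subset[OF qc]) (use t in auto)
        have gnt: "continuous_on {0..t} (g (r n))" using t by (intro gct) auto
        have "norm (v n t - mild q t) = norm (mild (\<lambda>s. g (r n) s - q s) t)"
          unfolding v_def using mild_diff[OF gnt qct] by simp
        also have "\<dots> \<le> M * \<epsilon> * (t - 0)"
          unfolding mild_def
          by (rule conv_norm) (use t N n in \<open>auto intro!: continuous_intros gnt qct simp: less_imp_le\<close>)
        also have "\<dots> \<le> M * \<epsilon> * T" using t M eps by (intro mult_left_mono) auto
        also have "\<dots> < e" using e M T by (simp add: \<epsilon>_def)
        finally show ?thesis .
      qed
      then show "\<exists>no. \<forall>n\<ge>no. norm (v n t - mild q t) < e" by blast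
    qed
    then show ?thesis using vlim[OF t] LIMSEQ_unique by blast
  qed
  show ?thesis
    using zc fixp by (intro exI[of _ z]) (auto simp: z_def q_def[abs_def])
qed

end

end

subsection \<open>Regularity of mild solutions\<close>

context smoothing_semigroup_on
begin

text \<open>At distance at least \<open>\<delta>\<close> from \<open>t\<close> the kernel factors as
  \<open>L \<delta>\<close> after \<open>U (t - \<delta> - r)\<close>, so truncated integrals have
  continuous integrands and \<open>L \<delta>\<close> can be taken out.\<close>

lemma L_integrand:
  assumes "\<delta> > 0" "b \<le> t - \<delta>" "continuous_on {a..b} k"
  shows "continuous_on {a..b} (\<lambda>r. L (t - r) (k r))"
    and "integral {a..b} (\<lambda>r. L (t - r) (k r)) = L \<delta> (integral {a..b} (\<lambda>r. U (t - \<delta> - r) (k r)))"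
proof -
  have eq: "L (t - r) (k r) = L \<delta> (U (t - \<delta> - r) (k r))" if "r \<in> {a..b}" for r
    using L_add(2)[of "t - \<delta> - r" \<delta> "k r"] assms that by simp
  have c: "continuous_on {a..b} (\<lambda>r. U (t - \<delta> - r) (k r))"
    using conv_continuous[OF assms(3), of "t - \<delta>"] assms by simp
  show "continuous_on {a..b} (\<lambda>r. L (t - r) (k r))"
    by (rule continuous_on_eq[of _ "\<lambda>r. L \<delta> (U (t - \<delta> - r) (k r))"])
       (use c eq in \<open>auto intro!: continuous_intros\<close>)
  have "integral {a..b} (\<lambda>r. L (t - r) (k r)) = integral {a..b} (\<lambda>r. L \<delta> (U (t - \<delta> - r) (k r)))"
    by (rule integral_cong) (use eq in auto)
  also have "\<dots> = L \<delta> (integral {a..b} (\<lambda>r. U (t - \<delta> - r) (k r)))"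
    using integral_linear[OF integrable_continuous_real[OF c] blinfun.bounded_linear_right, of "L \<delta>"]
    by (simp add: o_def)
  finally show "integral {a..b} (\<lambda>r. L (t - r) (k r)) = L \<delta> (integral {a..b} (\<lambda>r. U (t - \<delta> - r) (k r)))" .
qed

text \<open>Applying \<open>A\<close> to the convolution truncated at \<open>t - \<epsilon> 2\<^sup>-\<^sup>k\<close> and adding \<open>U (\<epsilon> 2\<^sup>-\<^sup>k) (g t)\<close> gives a sequence whose
  increments only see \<open>g r - g t\<close>, which cancels the singularity of \<open>L (t - r)\<close>.\<close>

lemma mild_in_domain:
  assumes g: "continuous_on {0..T} g" and mc: "continuous_on {0..T} (mild g)"
    and eps: "\<epsilon> > 0" and kappa: "\<kappa> > 0" "\<kappa> \<le> 1" and H0: "H \<ge> 0"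
    and H: "\<And>s t. \<epsilon> \<le> s \<Longrightarrow> s < t \<Longrightarrow> t \<le> T \<Longrightarrow> norm (L (t - s) (g s - g t)) \<le> H * (t - s) powr (\<kappa> - 1)"
  shows "\<forall>t\<in>{2*\<epsilon>..T}. mild g t \<in> D" "continuous_on {2*\<epsilon>..T} (\<lambda>t. A (mild g t))"
proof -
  obtain G where G: "\<And>s. s \<in> {0..T} \<Longrightarrow> norm (g s) \<le> G"
    using compact_imp_bounded[OF compact_continuous_image[OF g]] unfolding bounded_iff by fastforce
  \<comment> \<open>Truncation starts at distance \<open>\<epsilon>\<close> from \<open>t\<close>,
    so for \<open>t \<ge> 2 * \<epsilon>\<close> every increment of the truncated integrals lives at
    times at or beyond \<open>\<epsilon>\<close>, where the hypothesis on \<open>H\<close> is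
    available.\<close>
  define \<delta> where "\<delta> k = \<epsilon> * (1/2)^k" for k
  have d: "\<delta> k > 0" "\<delta> k \<le> \<epsilon>" "\<delta> (Suc k) < \<delta> k" "\<delta> k - \<delta> (Suc k) = \<delta> (Suc k)" for k
    using eps by (auto simp: \<delta>_def power_le_one)
  have dlim: "\<delta> \<longlonglongrightarrow> 0" unfolding \<delta>_def by (intro tendsto_mult_right_zero LIMSEQ_power_zero) simp
  define x where "x k t = U (\<delta> k) (mild g (t - \<delta> k))" for k t
  define y where "y k t = L (\<delta> k) (mild g (t - \<delta> k)) + U (\<delta> k) (g t)" for k t
  define b where "b k = H * \<epsilon> powr \<kappa> * ((1/2) powr \<kappa>) ^ Suc k" for k
  have sub: "continuous_on {c..e} g" if "0 \<le> c" "e \<le> T" for c e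
    using g by (rule continuous_on_subset) (use that in auto)
  have yc: "continuous_on {2*\<epsilon>..T} (y k)" for k
    unfolding y_def
    by (intro continuous_intros continuous_on_compose2[OF mc] continuous_on_subset[OF g])
       (use d[of k] eps in auto)
  have inc: "norm (y (Suc k) t - y k t) \<le> b k" if t: "t \<in> {2*\<epsilon>..T}" for k t
  proof -
    define a where "a = t - \<delta> k"
    define e where "e = t - \<delta> (Suc k)"
    have ae: "0 \<le> a" "a \<le> e" "e \<le> T" "e < t" "\<epsilon> \<le> a" "e - a = \<delta> (Suc k)" "t \<le> T" "0 \<le> t"
      using d[of k] d[of "Suc k"] t eps by (auto simp: a_def e_def)
    have gae: "continuous_on {a..e} g" "continuous_on {0..e} g" using ae by (auto intro!: sub)
    have "mild g e = U (e - a) (mild g a) + integral {a..e} (\<lambda>r. U (e - r) (g r))"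
      by (rule mild_split(1)[OF gae(2) ae(1,2)])
    then have "L (\<delta> (Suc k)) (mild g e) = L (\<delta> (Suc k)) (U (e - a) (mild g a)) + L (\<delta> (Suc k)) (integral {a..e} (\<lambda>r. U (e - r) (g r)))"
      by (simp add: blinfun.add_right)
    also have "L (\<delta> (Suc k)) (U (e - a) (mild g a)) = L (\<delta> k) (mild g a)"
      using L_add(2)[of "e - a" "\<delta> (Suc k)" "mild g a"] ae d[of k] d[of "Suc k"] by simp
    also have "L (\<delta> (Suc k)) (integral {a..e} (\<lambda>r. U (e - r) (g r))) = integral {a..e} (\<lambda>r. L (t - r) (g r))"
      using L_integrand(2)[OF d(1)[of "Suc k"], of e t a g] gae by (simp add: e_def)
    finally have 1: "L (\<delta> (Suc k)) (mild g e) = L (\<delta> k) (mild g a) + integral {a..e} (\<lambda>r. L (t - r) (g r))" .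
    have "((\<lambda>r. L (t - r) (g t)) has_integral (- U (t - e) (g t) - (- U (t - a) (g t)))) {a..e}"
    proof (rule fundamental_theorem_of_calculus[OF ae(2)])
      fix r assume r: "r \<in> {a..e}"
      have "((\<lambda>r. t - r) has_vector_derivative (-1)) (at r within {a..e})"
        unfolding has_vector_derivative_def by (auto intro!: derivative_eq_intros)
      from vector_diff_chain_within[OF this has_vector_derivative_at_within[OF deriv[of "t - r" "g t"]]]
      have "((\<lambda>r. U (t - r) (g t)) has_vector_derivative - L (t - r) (g t)) (at r within {a..e})"
        using r ae by (simp add: o_def)
      from has_vector_derivative_minus[OF this]
      show "((\<lambda>r. - U (t - r) (g t)) has_vector_derivative L (t - r) (g t)) (at r within {a..e})" by simp
    qed
    then have 2: "integral {a..e} (\<lambda>r. L (t - r) (g t)) = U (\<delta> k) (g t) - U (\<delta> (Suc k)) (g t)"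
      by (simp add: integral_unique a_def e_def)
    have c1: "continuous_on {a..e} (\<lambda>r. L (t - r) (g r))" "continuous_on {a..e} (\<lambda>r. L (t - r) (g t))"
      using L_integrand(1)[OF d(1)[of "Suc k"], of e t a] gae by (auto simp: e_def)
    have "y (Suc k) t - y k t = integral {a..e} (\<lambda>r. L (t - r) (g r)) - integral {a..e} (\<lambda>r. L (t - r) (g t))"
      unfolding y_def using 1 2 by (simp add: a_def e_def)
    also have "\<dots> = integral {a..e} (\<lambda>r. L (t - r) (g r - g t))"
      using c1 by (simp add: blinfun.diff_right integral_diff integrable_continuous_real)
    \<comment> \<open>The bound on the integrand is largest at the right end, at distance
      \<open>\<delta> (Suc k)\<close> from \<open>t\<close>, and the piece has the same length. The
      product is of order \<open>\<delta> powr \<kappa>\<close>, hence geometric.\<close>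
    also have "norm \<dots> \<le> (H * \<delta> (Suc k) powr (\<kappa> - 1)) * (e - a)"
    proof (rule integral_bound[OF ae(2)])
      show "continuous_on {a..e} (\<lambda>r. L (t - r) (g r - g t))"
        using c1 by (simp add: blinfun.diff_right continuous_on_diff)
      fix r assume r: "r \<in> {a..e}"
      have "norm (L (t - r) (g r - g t)) \<le> H * (t - r) powr (\<kappa> - 1)" using r ae by (intro H) auto
      also have "\<dots> \<le> H * \<delta> (Suc k) powr (\<kappa> - 1)"
        using r d(1)[of "Suc k"] kappa H0 by (intro mult_left_mono powr_mono2') (auto simp: e_def)
      finally show "norm (L (t - r) (g r - g t)) \<le> H * \<delta> (Suc k) powr (\<kappa> - 1)" .
    qed
    also have "\<dots> = H * (\<delta> (Suc k) powr (\<kappa> - 1) * \<delta> (Suc k) powr 1)" using ae d(1)[of "Suc k"] by simp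
    also have "\<delta> (Suc k) powr (\<kappa> - 1) * \<delta> (Suc k) powr 1 = \<delta> (Suc k) powr \<kappa>"
      by (simp only: powr_add[symmetric]) simp
    also have "\<delta> (Suc k) powr \<kappa> = \<epsilon> powr \<kappa> * ((1/2) powr \<kappa>) ^ Suc k"
      unfolding \<delta>_def using eps by (subst powr_mult) (auto simp: half_power_powr simp del: power_Suc)
    finally show ?thesis by (simp add: b_def mult_ac)
  qed
  have bs: "summable b"
    unfolding b_def power_Suc using powr_less_mono2[of \<kappa> "1/2" "1::real"] kappa
    by (intro summable_mult summable_geometric) auto
  have "uniform_limit {2*\<epsilon>..T} (\<lambda>n t. \<Sum>k<n. y (Suc k) t - y k t) (\<lambda>t. \<Sum>k. y (Suc k) t - y k t) sequentially"
    by (rule Weierstrass_m_test[OF inc bs])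
  moreover have telesc: "(\<Sum>k<n. y (Suc k) t - y k t) = y n t - y 0 t" for n t
    using sum_lessThan_telescope[of "\<lambda>k. y k t" n] .
  ultimately have "uniform_limit {2*\<epsilon>..T} (\<lambda>n t. y n t - y 0 t) (\<lambda>t. \<Sum>k. y (Suc k) t - y k t) sequentially"
    by (simp only: telesc)
  moreover define z where "z t = (\<Sum>k. y (Suc k) t - y k t)" for t
  ultimately have ul: "uniform_limit {2*\<epsilon>..T} (\<lambda>n t. y n t - y 0 t) z sequentially" by (simp add: z_def[abs_def])
  have "continuous_on {2*\<epsilon>..T} z"
    by (rule uniform_limit_theorem[OF _ ul]) (auto intro!: always_eventually continuous_intros yc)
  then have yzc: "continuous_on {2*\<epsilon>..T} (\<lambda>t. z t + y 0 t - g t)"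
    by (intro continuous_intros yc continuous_on_subset[OF g]) (use eps in auto)
  \<comment> \<open>Closedness of \<open>A\<close> along the truncations \<open>x k t\<close>: their
    images are the \<open>y k t\<close> without the correction, and the correction tends to
    \<open>g t\<close>.\<close>
  have key: "mild g t \<in> D \<and> A (mild g t) = z t + y 0 t - g t" if t: "t \<in> {2*\<epsilon>..T}" for t
  proof (rule A_closed)
    have t0: "0 \<le> t" "t \<le> T" using t eps by auto
    show "x k t \<in> D" for k unfolding x_def by (rule U_in_D[OF d(1)])
    have ylim: "(\<lambda>k. y k t) \<longlonglongrightarrow> z t + y 0 t"
      using tendsto_add[OF tendsto_uniform_limitI[OF ul t] tendsto_const[of "y 0 t"]] by simp
    have "((\<lambda>k. U (\<delta> k) (g t)) \<longlongrightarrow> U 0 (g t)) sequentially"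
      by (rule U_tendsto[OF dlim _ _ tendsto_const]) (use d(1) in \<open>auto simp: less_imp_le\<close>)
    then have "(\<lambda>k. y k t - U (\<delta> k) (g t)) \<longlonglongrightarrow> z t + y 0 t - g t" by (intro tendsto_diff ylim) simp
    then show "(\<lambda>k. A (x k t)) \<longlonglongrightarrow> z t + y 0 t - g t"
      unfolding x_def using U_in_D(2)[OF d(1)] by (simp add: y_def)
    have "(\<lambda>k. mild g t - x k t) \<longlonglongrightarrow> 0"
    proof (rule Lim_null_comparison)
      show "\<forall>\<^sub>F k in sequentially. norm (mild g t - x k t) \<le> M * G * \<delta> k"
      proof (intro always_eventually allI)
        fix k
        have s: "0 \<le> t - \<delta> k" "t - \<delta> k \<le> t" using d[of k] t eps by auto
        have "mild g t - x k t = integral {t - \<delta> k..t} (\<lambda>r. U (t - r) (g r))"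
          using mild_split(1)[OF sub s] t0 by (simp add: x_def)
        also have "norm \<dots> \<le> M * G * (t - (t - \<delta> k))"
          by (rule conv_norm[OF sub]) (use s t0 G d[of k] t in auto)
        finally show "norm (mild g t - x k t) \<le> M * G * \<delta> k" by simp
      qed
      show "(\<lambda>k. M * G * \<delta> k) \<longlonglongrightarrow> 0" by (intro tendsto_mult_right_zero dlim)
    qed
    then show "(\<lambda>k. x k t) \<longlonglongrightarrow> mild g t"
      using tendsto_diff[OF tendsto_const[of "mild g t"]] by fastforce
  qed
  then show "\<forall>t\<in>{2*\<epsilon>..T}. mild g t \<in> D" by blast
  show "continuous_on {2*\<epsilon>..T} (\<lambda>t. A (mild g t))"
    by (rule continuous_on_eq[OF yzc]) (use key in auto)
qed

text \<open>Both integrands in the increment of a mild solution have this shape, \<open>a\<close>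
  being once \<open>A\<close> along the solution and once the forcing.\<close>

lemma near_identity:
  assumes "continuous_on {0<..T} a" "t0 \<in> {0<..T}" "e > 0"
  obtains d where "d > 0" "\<And>r s. 0 \<le> r \<Longrightarrow> r < d \<Longrightarrow> s \<in> {0<..T} \<Longrightarrow> \<bar>s - t0\<bar> < d \<Longrightarrow> norm (U r (a s) - a t0) \<le> e"
proof -
  have M0: "M > 0" using M by simp
  obtain d1 where d1: "d1 > 0" "\<forall>s\<in>{0<..T}. dist s t0 < d1 \<longrightarrow> dist (a s) (a t0) < e / (2 * M)"
    using assms M0 unfolding continuous_on_iff by (metis divide_pos_pos mult_pos_pos zero_less_numeral)
  have "((\<lambda>r. U r (a t0)) \<longlongrightarrow> U 0 (a t0)) (at 0 within {0..})"
    using U_cont[of "a t0"] unfolding continuous_on_def by (rule bspec) simp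
  from tendstoD[OF this, of "e / 2"] obtain d2 where d2: "d2 > 0" "\<And>r. 0 < r \<Longrightarrow> r < d2 \<Longrightarrow> dist (U r (a t0)) (a t0) < e / 2"
    using assms unfolding eventually_at by auto
  show thesis
  proof (rule that[of "min T (min d1 d2)"])
    show "min T (min d1 d2) > 0" using T d1 d2 by simp
    fix r s assume r: "0 \<le> r" "r < min T (min d1 d2)" and s: "s \<in> {0<..T}" "\<bar>s - t0\<bar> < min T (min d1 d2)"
    have "norm (U r (a t0) - a t0) \<le> e / 2"
      using d2(2)[of r] r assms(3) by (cases "r = 0") (auto simp: dist_norm less_imp_le)
    moreover have "norm (U r (a s - a t0)) \<le> M * norm (a s - a t0)" using r by (intro norm_U_apply) auto
    moreover have "M * norm (a s - a t0) \<le> M * (e / (2 * M))"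
      using d1(2) s M0 by (intro mult_left_mono) (auto simp: dist_norm dist_real_def less_imp_le)
    moreover have "M * (e / (2 * M)) = e / 2" using M0 by simp
    moreover have "norm (U r (a s) - a t0) \<le> norm (U r (a s - a t0)) + norm (U r (a t0) - a t0)"
      using norm_triangle_ineq[of "U r (a s - a t0)" "U r (a t0) - a t0"] by (simp add: blinfun.diff_right)
    ultimately show "norm (U r (a s) - a t0) \<le> e" by linarith
  qed
qed

text \<open>Restarting at \<open>s\<close> expresses \<open>u t - u s\<close> through one integral
  of \<open>U r (A (u s))\<close> and one of the smoothed forcing; near \<open>t0\<close> both
  integrands are close to constants.\<close>

lemma mild_solution_derivative:
  assumes g: "continuous_on {0..T} g" and u: "\<And>t. t \<in> {0..T} \<Longrightarrow> u t = U t x0 + mild g t"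
    and uD: "\<And>t. t \<in> {0<..T} \<Longrightarrow> u t \<in> D" and Au: "continuous_on {0<..T} (\<lambda>t. A (u t))"
    and t0: "t0 \<in> {0<..T}"
  shows "(u has_vector_derivative A (u t0) + g t0) (at t0 within {0<..T})"
proof -
  define B where "B = A (u t0) + g t0"
  have g': "continuous_on {0<..T} g" by (rule continuous_on_subset[OF g]) auto
  have diff: "u t - u s = integral {0..t - s} (\<lambda>r. U r (A (u s))) + integral {s..t} (\<lambda>r. U (t - r) (g r))"
    if st: "s \<in> {0<..T}" "t \<in> {0<..T}" "s \<le> t" for s t
  proof -
    have gt: "continuous_on {0..t} g" by (rule continuous_on_subset[OF g]) (use st in auto)
    have "u t = U t x0 + mild g t" using st by (intro u) auto
    also have "U t x0 = U (t - s) (U s x0)" using U_add[of "t - s" s x0] st by simp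
    also have "mild g t = U (t - s) (mild g s) + integral {s..t} (\<lambda>r. U (t - r) (g r))"
      using st by (intro mild_split(1) gt) auto
    finally have "u t = U (t - s) (u s) + integral {s..t} (\<lambda>r. U (t - r) (g r))"
      using u[of s] st by (simp add: blinfun.add_right)
    moreover have "U (t - s) (u s) - u s = integral {0..t - s} (\<lambda>r. U r (A (u s)))"
      using U_integral_A[OF uD[OF st(1)], of "t - s"] st by (simp add: integral_unique)
    ultimately show ?thesis by (simp add: algebra_simps)
  qed
  \<comment> \<open>Stated for all \<open>s \<le> t\<close> near \<open>t0\<close>, because the left
    difference quotient has to be restarted at the moving point below \<open>t0\<close>.\<close>
  have est: "\<exists>d>0. \<forall>s\<in>{0<..T}. \<forall>t\<in>{0<..T}. s \<le> t \<longrightarrow> \<bar>s - t0\<bar> < d \<longrightarrow> \<bar>t - t0\<bar> < d \<longrightarrow>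
      norm (u t - u s - (t - s) *\<^sub>R B) \<le> e * (t - s)" if e: "e > 0" for e
  proof -
    obtain d1 where d1: "d1 > 0" "\<And>r s. 0 \<le> r \<Longrightarrow> r < d1 \<Longrightarrow> s \<in> {0<..T} \<Longrightarrow> \<bar>s - t0\<bar> < d1 \<Longrightarrow> norm (U r (A (u s)) - A (u t0)) \<le> e / 2"
      using near_identity[OF Au t0, of "e / 2"] e by auto
    obtain d2 where d2: "d2 > 0" "\<And>r s. 0 \<le> r \<Longrightarrow> r < d2 \<Longrightarrow> s \<in> {0<..T} \<Longrightarrow> \<bar>s - t0\<bar> < d2 \<Longrightarrow> norm (U r (g s) - g t0) \<le> e / 2"
      using near_identity[OF g' t0, of "e / 2"] e by auto
    show ?thesis
    proof (intro exI[of _ "min d1 d2 / 2"] conjI ballI impI)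
      show "min d1 d2 / 2 > 0" using d1 d2 by simp
      fix s t assume st: "s \<in> {0<..T}" "t \<in> {0<..T}" "s \<le> t" and nr: "\<bar>s - t0\<bar> < min d1 d2 / 2" "\<bar>t - t0\<bar> < min d1 d2 / 2"
      have tm: "t - s < d1" "t - s < d2" using nr st by linarith+
      have gc: "continuous_on {s..t} g" by (rule continuous_on_subset[OF g]) (use st in auto)
      have c1: "continuous_on {0..t - s} (\<lambda>r. U r (A (u s)))" by (rule continuous_on_subset[OF U_cont]) auto
      have c2: "continuous_on {s..t} (\<lambda>r. U (t - r) (g r))" by (rule conv_continuous[OF gc]) simp
      have "u t - u s - (t - s) *\<^sub>R B = integral {0..t - s} (\<lambda>r. U r (A (u s)) - A (u t0)) + integral {s..t} (\<lambda>r. U (t - r) (g r) - g t0)"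
        unfolding diff[OF st] B_def using c1 c2 st
        by (simp add: integral_diff integrable_continuous_real scaleR_add_right)
      moreover have "norm (integral {0..t - s} (\<lambda>r. U r (A (u s)) - A (u t0))) \<le> e / 2 * (t - s - 0)"
        by (rule integral_bound) (use st tm nr d1 c1 in \<open>auto intro!: continuous_intros\<close>)
      moreover have "norm (integral {s..t} (\<lambda>r. U (t - r) (g r) - g t0)) \<le> e / 2 * (t - s)"
      proof (rule integral_bound)
        show "norm (U (t - r) (g r) - g t0) \<le> e / 2" if r: "r \<in> {s..t}" for r
        proof (rule d2(2))
          have "\<bar>r - t0\<bar> \<le> max \<bar>s - t0\<bar> \<bar>t - t0\<bar>" using r by auto
          moreover have "max \<bar>s - t0\<bar> \<bar>t - t0\<bar> < min d1 d2 / 2" using nr by (simp only: max_less_iff_conj)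
          moreover have "min d1 d2 \<le> d2" by simp
          ultimately show "\<bar>r - t0\<bar> < d2" using d2(1) by linarith
        qed (use r st tm in auto)
      qed (use st c2 in \<open>auto intro!: continuous_intros\<close>)
      ultimately show "norm (u t - u s - (t - s) *\<^sub>R B) \<le> e * (t - s)"
        using norm_triangle_ineq[of "integral {0..t - s} (\<lambda>r. U r (A (u s)) - A (u t0))" "integral {s..t} (\<lambda>r. U (t - r) (g r) - g t0)"]
        by (simp add: field_simps)
    qed
  qed
  show ?thesis
    unfolding has_vector_derivative_def has_derivative_within_alt B_def[symmetric]
  proof (intro conjI allI impI bounded_linear_scaleR_left)
    fix e :: real assume "e > 0"
    then obtain d where d: "d > 0" "\<And>s t. s \<in> {0<..T} \<Longrightarrow> t \<in> {0<..T} \<Longrightarrow> s \<le> t \<Longrightarrow> \<bar>s - t0\<bar> < d \<Longrightarrow> \<bar>t - t0\<bar> < d \<Longrightarrow>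
      norm (u t - u s - (t - s) *\<^sub>R B) \<le> e * (t - s)" using est by metis
    show "\<exists>d>0. \<forall>y\<in>{0<..T}. norm (y - t0) < d \<longrightarrow> norm (u y - u t0 - (y - t0) *\<^sub>R B) \<le> e * norm (y - t0)"
    proof (intro exI[of _ d] conjI ballI impI d(1))
      fix y assume y: "y \<in> {0<..T}" "norm (y - t0) < d"
      show "norm (u y - u t0 - (y - t0) *\<^sub>R B) \<le> e * norm (y - t0)"
      proof (cases "t0 \<le> y")
        case True
        then show ?thesis using d(2)[OF t0 y(1) True] y d(1) by simp
      next
        case False
        have "u y - u t0 - (y - t0) *\<^sub>R B = - (u t0 - u y - (t0 - y) *\<^sub>R B)" by (simp add: algebra_simps)
        then have "norm (u y - u t0 - (y - t0) *\<^sub>R B) = norm (u t0 - u y - (t0 - y) *\<^sub>R B)" by (metis norm_minus_cancel)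
        then show ?thesis using d(2)[OF y(1) t0] y d(1) False by simp
      qed
    qed
  qed
qed

theorem mild_solution_regular:
  assumes g: "continuous_on {0..T} g" and mc: "continuous_on {0..T} (mild g)"
    and u: "\<And>t. t \<in> {0..T} \<Longrightarrow> u t = U t x0 + mild g t"
    and reg: "\<And>\<epsilon>. \<epsilon> > 0 \<Longrightarrow> \<exists>H\<ge>0. \<exists>\<kappa>>0. \<kappa> \<le> 1 \<and> (\<forall>s t. \<epsilon> \<le> s \<longrightarrow> s < t \<longrightarrow> t \<le> T \<longrightarrow>
        norm (L (t - s) (g s - g t)) \<le> H * (t - s) powr (\<kappa> - 1))"
  shows "\<And>t. t \<in> {0<..T} \<Longrightarrow> u t \<in> D" "continuous_on {0<..T} (\<lambda>t. A (u t))"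
    and "\<And>t. t \<in> {0<..T} \<Longrightarrow> (u has_vector_derivative A (u t) + g t) (at t within {0<..T})"
proof -
  have loc: "(\<forall>t\<in>{2*\<epsilon>..T}. u t \<in> D) \<and> continuous_on {2*\<epsilon>..T} (\<lambda>t. A (u t))" if eps: "\<epsilon> > 0" for \<epsilon>
  proof -
    obtain H \<kappa> where H: "H \<ge> 0" "\<kappa> > 0" "\<kappa> \<le> 1"
      "\<And>s t. \<epsilon> \<le> s \<Longrightarrow> s < t \<Longrightarrow> t \<le> T \<Longrightarrow> norm (L (t - s) (g s - g t)) \<le> H * (t - s) powr (\<kappa> - 1)"
      using reg[OF eps] by blast
    note m = mild_in_domain[OF g mc eps H(2,3,1,4)]
    have uD: "u t \<in> D \<and> A (u t) = L t x0 + A (mild g t)" if "t \<in> {2*\<epsilon>..T}" for t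
      using that m(1) A_add[OF U_in_D(1)[of t x0], of "mild g t"] U_in_D(2)[of t x0] u[of t] eps by auto
    \<comment> \<open>\<open>L t x0\<close> is rewritten as an orbit starting from
      \<open>L \<epsilon> x0\<close>, so its continuity is that of the semigroup.\<close>
    have "continuous_on {2*\<epsilon>..T} (\<lambda>t. U (t - \<epsilon>) (L \<epsilon> x0) + A (mild g t))"
      by (intro continuous_intros m(2) U_continuous_on) (use eps in auto)
    then have "continuous_on {2*\<epsilon>..T} (\<lambda>t. A (u t))"
    proof (rule continuous_on_eq)
      fix t assume t: "t \<in> {2*\<epsilon>..T}"
      then show "U (t - \<epsilon>) (L \<epsilon> x0) + A (mild g t) = A (u t)"
        using uD[OF t] L_add(1)[of "t - \<epsilon>" \<epsilon> x0] eps by simp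
    qed
    with uD show ?thesis by blast
  qed
  show uD: "u t \<in> D" if "t \<in> {0<..T}" for t using loc[of "t / 2"] that by auto
  show Au: "continuous_on {0<..T} (\<lambda>t. A (u t))"
    unfolding continuous_on_eq_continuous_within
  proof
    fix t assume t: "t \<in> {0<..T}"
    \<comment> \<open>With \<open>\<epsilon> = t / 4\<close> the interval begins at
      \<open>t / 2\<close>, strictly below \<open>t\<close>, and is therefore a neighbourhood of
      \<open>t\<close> within \<open>{0<..T}\<close>.\<close>
    have "continuous (at t within {2*(t/4)..T}) (\<lambda>t. A (u t))"
      using loc[of "t / 4"] t unfolding continuous_on_eq_continuous_within by auto
    moreover have "at t within {2*(t/4)..T} = at t within {0<..T}"
      by (rule at_within_nhd[of t "{t/2<..}"]) (use t in auto)
    ultimately show "continuous (at t within {0<..T}) (\<lambda>t. A (u t))" by simp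
  qed
  show "(u has_vector_derivative A (u t) + g t) (at t within {0<..T})" if "t \<in> {0<..T}" for t
    by (rule mild_solution_derivative[OF g u uD Au that])
qed

end

subsection \<open>Interpolation between a space and the ambient space\<close>

lemma banach_space_imp_banach_sub:
  fixes X :: "'a::real_normed_vector nspace"
  assumes sa: "scalar_action K sm" and X: "banach_space K sm X"
    and emb: "\<forall>x\<in>pts X. norm x \<le> c * nrm X x"
  shows "banach_sub X"
proof -
  interpret scalar_action K sm by fact
  have rK: "complex_of_real r \<in> K" for r using field by auto
  have zero: "0 \<in> pts X" and add: "\<And>x y. x \<in> pts X \<Longrightarrow> y \<in> pts X \<Longrightarrow> x + y \<in> pts X"
    and sm: "\<And>c x. c \<in> K \<Longrightarrow> x \<in> pts X \<Longrightarrow> sm c x \<in> pts X"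
    and nn: "\<And>x. x \<in> pts X \<Longrightarrow> 0 \<le> nrm X x \<and> (nrm X x = 0 \<longleftrightarrow> x = 0)"
    and ns: "\<And>c x. c \<in> K \<Longrightarrow> x \<in> pts X \<Longrightarrow> nrm X (sm c x) = cmod c * nrm X x"
    and tri: "\<And>x y. x \<in> pts X \<Longrightarrow> y \<in> pts X \<Longrightarrow> nrm X (x + y) \<le> nrm X x + nrm X y"
    and compl: "Metric_space.mcomplete (pts X) (ndist X)"
    using X unfolding banach_space_def by auto
  have scale: "r *\<^sub>R x \<in> pts X" "nrm X (r *\<^sub>R x) = \<bar>r\<bar> * nrm X x" if "x \<in> pts X" for r x
    using sm[OF rK that] ns[OF rK that] by (auto simp: sm_of_real)
  have diff: "x - y \<in> pts X" if "x \<in> pts X" "y \<in> pts X" for x y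
    using add[OF that(1) scale(1)[OF that(2), of "-1"]] by simp
  have comm: "nrm X (x - y) = nrm X (y - x)" if "x \<in> pts X" "y \<in> pts X" for x y
    using scale(2)[OF diff[OF that], of "-1"] by simp
  interpret M: Metric_space "pts X" "ndist X"
  proof
    fix x y z
    show "0 \<le> ndist X x y" "ndist X x y = ndist X y x" using nn diff comm by (auto simp: ndist_def)
    assume xy: "x \<in> pts X" "y \<in> pts X"
    show "(ndist X x y = 0) = (x = y)" using xy nn[OF diff[OF xy]] by (simp add: ndist_def)
    assume z: "z \<in> pts X"
    show "ndist X x z \<le> ndist X x y + ndist X y z"
      using tri[OF diff[OF xy] diff[OF xy(2) z]] xy z by (simp add: ndist_def)
  qed
  show ?thesis
  proof
    fix y :: "nat \<Rightarrow> 'a"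
    assume y: "\<And>n. y n \<in> pts X" and C: "\<And>e. e > 0 \<Longrightarrow> \<exists>N. \<forall>m\<ge>N. \<forall>n\<ge>N. nrm X (y m - y n) < e"
    have "M.MCauchy y" unfolding M.MCauchy_def using y C by (auto simp: ndist_def)
    then obtain l where "limitin M.mtopology y l sequentially" using compl unfolding M.mcomplete_def by blast
    then have l: "l \<in> pts X" "\<And>e. e > 0 \<Longrightarrow> \<exists>N. \<forall>n\<ge>N. y n \<in> pts X \<and> ndist X (y n) l < e"
      unfolding M.limit_metric_sequentially by auto
    have "(\<lambda>n. nrm X (y n - l)) \<longlonglongrightarrow> 0"
    proof (rule LIMSEQ_I)
      fix e :: real assume "e > 0"
      then obtain N where "\<forall>n\<ge>N. y n \<in> pts X \<and> ndist X (y n) l < e" using l(2) by blast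
      then show "\<exists>N. \<forall>n\<ge>N. norm (nrm X (y n - l) - 0) < e"
        using nn[OF diff[OF y l(1)]] y l(1) by (intro exI[of _ N]) (auto simp: ndist_def)
    qed
    with l show "\<exists>l\<in>pts X. (\<lambda>n. nrm X (y n - l)) \<longlonglongrightarrow> 0" by blast
  next
    show "\<exists>c>0. \<forall>x\<in>pts X. norm x \<le> c * nrm X x"
    proof (intro exI[of _ "\<bar>c\<bar> + 1"] conjI ballI)
      fix x assume x: "x \<in> pts X"
      have "norm x \<le> c * nrm X x" using emb x by blast
      also have "\<dots> \<le> (\<bar>c\<bar> + 1) * nrm X x" using nn[OF x] by (intro mult_right_mono) auto
      finally show "norm x \<le> (\<bar>c\<bar> + 1) * nrm X x" .
    qed simp
  qed (use zero add scale tri in auto)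
qed

lemma whole_space_simps [simp]: "pts whole_space = UNIV" "nrm whole_space = norm"
  by (simp_all add: whole_space_def)

lemma banach_sub_whole_space: "banach_sub (whole_space :: 'a::banach nspace)"
proof
  fix y :: "nat \<Rightarrow> 'a"
  assume "\<And>e. e > 0 \<Longrightarrow> \<exists>N. \<forall>m\<ge>N. \<forall>n\<ge>N. nrm whole_space (y m - y n) < e"
  then have "Cauchy y" by (auto intro!: CauchyI)
  then obtain l where "y \<longlonglongrightarrow> l" using Cauchy_convergent convergent_def by blast
  then show "\<exists>l\<in>pts whole_space. (\<lambda>n. nrm whole_space (y n - l)) \<longlonglongrightarrow> 0"
    by (intro bexI[of _ l]) (auto simp: tendsto_norm_zero_iff LIM_zero_iff)
qed (auto simp: norm_triangle_ineq intro: exI[of _ 1])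

lemma ndist_whole_space: "ndist whole_space = dist"
  by (intro ext) (simp add: ndist_def dist_norm)

lemma ntop_whole_space [simp]: "ntop (whole_space :: 'a::real_normed_vector nspace) = euclidean"
  by (simp add: ntop_def ndist_whole_space)

lemma inter_space_simps [simp]:
  "pts (inter_space X Y) = pts X \<inter> pts Y" "nrm (inter_space X Y) x = max (nrm X x) (nrm Y x)"
  by (simp_all add: inter_space_def)

text \<open>A summand that embeds in the ambient space adds nothing to the sum, so the boundedness
  on the sum space that a couple morphism must have reduces to ambient boundedness.\<close>

lemma sum_space_whole:
  fixes X :: "'a::banach nspace"
  assumes "banach_sub X" and c: "\<And>x. x \<in> pts X \<Longrightarrow> norm x \<le> c * nrm X x"
  shows "pts (sum_space whole_space X) = UNIV" "nrm (sum_space whole_space X) z \<le> norm z"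
    "norm z \<le> max 1 c * nrm (sum_space whole_space X) z"
proof -
  interpret X: banach_sub X by fact
  define S where "S = {norm x + nrm X y |x y. y \<in> pts X \<and> z = x + y}"
  have nS: "nrm (sum_space whole_space X) z = Inf S" by (simp add: sum_space_def S_def)
  have "z = z + 0" by simp
  with X.zero_mem have "norm z + nrm X 0 \<in> S" unfolding S_def by blast
  then have zS: "norm z \<in> S" by simp
  have bd: "bdd_below S" unfolding S_def by (intro bdd_belowI[of _ 0]) (auto simp: X.nrm_nonneg)
  show "pts (sum_space whole_space X) = UNIV"
    using X.zero_mem by (auto simp: sum_space_def) (metis add.right_neutral)
  show "nrm (sum_space whole_space X) z \<le> norm z" unfolding nS by (rule cInf_lower[OF zS bd])
  have "norm z / max 1 c \<le> Inf S"
  proof (rule cInf_greatest)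
    show "S \<noteq> {}" using zS by blast
    fix s assume "s \<in> S"
    then obtain x y where s: "s = norm x + nrm X y" "y \<in> pts X" "z = x + y" unfolding S_def by blast
    have "norm z \<le> norm x + c * nrm X y" using c[OF s(2)] norm_triangle_ineq[of x y] unfolding s(3) by linarith
    also have "\<dots> \<le> max 1 c * norm x + max 1 c * nrm X y"
      using X.nrm_nonneg[OF s(2)] mult_right_mono[of 1 "max 1 c" "norm x"]
      by (intro add_mono mult_right_mono) auto
    finally show "norm z / max 1 c \<le> s" unfolding s(1) by (simp add: field_simps)
  qed
  then show "norm z \<le> max 1 c * nrm (sum_space whole_space X) z"
    unfolding nS by (simp add: divide_le_eq mult.commute)
qed

text \<open>\<open>opnorm\<close> is a supremum of reals and controls the operator only once its
  values on the unit ball are known to be bounded; this is the role of \<open>a\<close>.\<close>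

lemma opnorm_facts:
  assumes X: "banach_sub X" and Y: "banach_sub Y"
    and T: "\<And>x. x \<in> pts X \<Longrightarrow> blinfun_apply B x \<in> pts Y" and a: "\<And>x. x \<in> pts X \<Longrightarrow> nrm Y (B x) \<le> a * nrm X x"
  shows "0 \<le> opnorm X Y B" "a \<ge> 0 \<Longrightarrow> opnorm X Y B \<le> a" "x \<in> pts X \<Longrightarrow> nrm Y (B x) \<le> opnorm X Y B * nrm X x"
proof -
  interpret X: banach_sub X by fact
  interpret Y: banach_sub Y by fact
  define S where "S = {x \<in> pts X. nrm X x \<le> 1}"
  have 0: "0 \<in> S" using X.zero_mem by (simp add: S_def)
  have le: "nrm Y (B x) \<le> \<bar>a\<bar>" if "x \<in> S" for x
  proof -
    have "nrm Y (B x) \<le> a * nrm X x" using a that by (simp add: S_def)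
    also have "\<dots> \<le> \<bar>a\<bar> * 1" using that X.nrm_nonneg by (intro mult_mono) (auto simp: S_def)
    finally show ?thesis by simp
  qed
  then have bd: "bdd_above ((\<lambda>x. nrm Y (B x)) ` S)" by (intro bdd_aboveI[of _ "\<bar>a\<bar>"]) auto
  have up: "nrm Y (B x) \<le> opnorm X Y B" if "x \<in> S" for x
    unfolding opnorm_def S_def[symmetric] by (rule cSUP_upper[OF that bd])
  show o0: "0 \<le> opnorm X Y B" using up[OF 0] by (simp add: blinfun.zero_right)
  show "opnorm X Y B \<le> a" if "a \<ge> 0"
    unfolding opnorm_def S_def[symmetric] using 0 le that by (intro cSUP_least) auto
  show "nrm Y (B x) \<le> opnorm X Y B * nrm X x" if x: "x \<in> pts X"
  proof (cases "nrm X x = 0")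
    case True
    then have "x = 0" using X.nrm_eq_zero x by blast
    then show ?thesis by (simp add: blinfun.zero_right)
  next
    case False
    then have p: "nrm X x > 0" using X.nrm_nonneg[OF x] by simp
    define y where "y = (1 / nrm X x) *\<^sub>R x"
    have y: "y \<in> S" unfolding S_def y_def using X.scale_mem[OF x] X.nrm_scale[OF x, of "1 / nrm X x"] p by auto
    have "B x = nrm X x *\<^sub>R B y" unfolding y_def using p by (simp add: blinfun.scaleR_right)
    then have "nrm Y (B x) = nrm X x * nrm Y (B y)"
      using Y.nrm_scale[of "B y" "nrm X x"] T y p by (auto simp: S_def)
    also have "\<dots> \<le> nrm X x * opnorm X Y B" using up[OF y] p by (intro mult_left_mono) auto
    finally show ?thesis by (simp add: mult.commute)
  qed
qed

section \<open>Interpolation couples whose larger space is the ambient one\<close>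

locale normed_scalar_action = scalar_action K sm for K and sm :: "complex \<Rightarrow> 'a::banach \<Rightarrow> 'a" +
  assumes nrm_sm: "\<And>c x. c \<in> K \<Longrightarrow> norm (sm c x) = cmod c * norm x"
begin

lemma scalar_action: "scalar_action K sm" ..

definition embedded :: "'a nspace \<Rightarrow> bool" where
  "embedded X \<longleftrightarrow> banach_space K sm X \<and> (\<exists>c. \<forall>x\<in>pts X. norm x \<le> c * nrm X x)"

lemma embedded_banach_sub: "embedded X \<Longrightarrow> banach_sub X"
  using banach_space_imp_banach_sub[OF scalar_action] unfolding embedded_def by blast

lemma banach_space_whole_space: "banach_space K sm whole_space"
  unfolding banach_space_def
  using banach_sub.mcomplete[OF banach_sub_whole_space] nrm_sm
  by (auto simp: norm_triangle_ineq)

lemma embedded_whole_space: "embedded whole_space"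
  unfolding embedded_def using banach_space_whole_space by (auto intro: exI[of _ 1])

lemma continuous_on_sm: "continuous_on (K \<times> UNIV) (\<lambda>(c, x). sm c x)"
proof (cases "K = UNIV")
  case True
  interpret complex_action sm
    using complex_action_scalar_action[of sm] scalar_action nrm_sm True by simp
  show ?thesis unfolding split_def by (intro continuous_on continuous_intros)
next
  case False
  then have K: "K = \<real>" using field by blast
  have "continuous_on (K \<times> UNIV) (\<lambda>(c, x). Re c *\<^sub>R x :: 'a)"
    unfolding split_def by (intro continuous_intros)
  then show ?thesis
    by (rule continuous_on_eq) (auto simp: K sm_of_real elim!: Reals_cases)
qed

text \<open>The ambient norm topology serves as the common Hausdorff vector space topology.\<close>

lemma banach_couple_embedded:
  assumes X: "embedded X"
  shows "banach_couple K sm whole_space X"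
  unfolding banach_couple_def
proof (intro conjI exI[of _ euclidean])
  interpret X: banach_sub X by (rule embedded_banach_sub[OF X])
  show "banach_space K sm whole_space" by (rule banach_space_whole_space)
  show "banach_space K sm X" using X by (simp add: embedded_def)
  show "topspace euclidean = (UNIV :: 'a set)" "Hausdorff_space (euclidean :: 'a topology)" by auto
  show "continuous_map (prod_topology euclidean euclidean) euclidean (\<lambda>(x, y). x + y :: 'a)"
    unfolding euclidean_product_topology[symmetric] prod_topology_euclidean split_def
    by (simp add: continuous_map_iff_continuous2 continuous_intros)
  show "continuous_map (prod_topology (top_of_set K) euclidean) euclidean (\<lambda>(c, x). sm c x)"
    using continuous_on_sm prod_topology_subtopology_eu[of K "UNIV :: 'a set"] by simp
  show "continuous_map (ntop whole_space) euclidean (id :: 'a \<Rightarrow> 'a)" by simp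
  show "continuous_map (ntop X) euclidean id"
  proof -
    obtain c where c: "c > 0" "\<forall>x\<in>pts X. norm x \<le> c * nrm X x" using X.embed by blast
    have "continuous_map X.M.mtopology Met_TC.mtopology (id :: 'a \<Rightarrow> 'a)"
      unfolding Met_TC.continuous_map_to_metric
    proof (intro ballI allI impI)
      fix x and e :: real assume x: "x \<in> topspace X.M.mtopology" and e: "e > 0"
      have "dist x y < e" if "y \<in> X.M.mball x (e / c)" for y
      proof -
        have "norm (x - y) \<le> c * nrm X (x - y)" using c X.diff_mem that by (auto simp: X.M.in_mball)
        also have "\<dots> < c * (e / c)" using that c by (intro mult_strict_left_mono) (auto simp: X.M.in_mball ndist_def)
        finally show ?thesis using c by (simp add: dist_norm)
      qed
      then show "\<exists>U. openin X.M.mtopology U \<and> x \<in> U \<and> (\<forall>y\<in>U. id y \<in> Met_TC.mball (id x) e)"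
        using x e c by (intro exI[of _ "X.M.mball x (e / c)"]) (auto simp: Met_TC.in_mball)
    qed
    then show ?thesis by (simp add: X.ntop_eq)
  qed
qed

definition commutes :: "('a \<Rightarrow>\<^sub>L 'a) \<Rightarrow> bool" where
  "commutes B \<longleftrightarrow> (\<forall>c\<in>K. \<forall>x. B (sm c x) = sm c (B x))"

lemma couple_morphism_embedded:
  assumes X: "embedded X" and Y: "embedded Y" and B: "commutes B"
    and m: "\<And>x. x \<in> pts X \<Longrightarrow> B x \<in> pts Y" and b: "\<And>x. x \<in> pts X \<Longrightarrow> nrm Y (B x) \<le> b * nrm X x"
  shows "couple_morphism K sm whole_space X whole_space Y (blinfun_apply B)"
proof -
  interpret X: banach_sub X by (rule embedded_banach_sub[OF X])
  interpret Y: banach_sub Y by (rule embedded_banach_sub[OF Y])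
  obtain c where c: "c > 0" "\<forall>x\<in>pts X. norm x \<le> c * nrm X x" using X.embed by blast
  obtain d where d: "d > 0" "\<forall>x\<in>pts Y. norm x \<le> d * nrm Y x" using Y.embed by blast
  note sX = sum_space_whole[OF X.banach_sub_axioms, of c] and sY = sum_space_whole[OF Y.banach_sub_axioms, of d]
  have "nrm (sum_space whole_space Y) (B x) \<le> (norm B * max 1 c) * nrm (sum_space whole_space X) x" for x
  proof -
    have "nrm (sum_space whole_space Y) (B x) \<le> norm (B x)" using sY(2) d by blast
    also have "\<dots> \<le> norm B * norm x" by (rule norm_blinfun)
    also have "\<dots> \<le> norm B * (max 1 c * nrm (sum_space whole_space X) x)"
      using sX(3) c by (intro mult_left_mono) auto
    finally show ?thesis by (simp add: mult.assoc)
  qed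
  then have "\<exists>C. \<forall>x. nrm (sum_space whole_space Y) (B x) \<le> C * nrm (sum_space whole_space X) x" by blast
  moreover have "\<exists>C. \<forall>x. norm (B x) \<le> C * norm x" using norm_blinfun by blast
  moreover have "\<exists>C. \<forall>x\<in>pts X. nrm Y (B x) \<le> C * nrm X x" using b by blast
  ultimately show ?thesis
    using B m b sX(1) sY(1) c d unfolding couple_morphism_def bounded_op_def commutes_def
    by (auto simp: blinfun.add_right)
qed

lemma interpolation_embedded:
  assumes F: "interpolation_functor K sm F" and X: "embedded X"
  shows "embedded (F whole_space X)" "pts X \<subseteq> pts (F whole_space X)"
    "\<exists>c>0. \<forall>x\<in>pts X. nrm (F whole_space X) x \<le> c * nrm X x"
proof -
  interpret X: banach_sub X by (rule embedded_banach_sub[OF X])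
  obtain c where c: "c > 0" "\<forall>x\<in>pts X. norm x \<le> c * nrm X x" using X.embed by blast
  have bs: "banach_space K sm (F whole_space X)" and ci: "cont_embedded (inter_space whole_space X) (F whole_space X)"
    and cs: "cont_embedded (F whole_space X) (sum_space whole_space X)"
    using F banach_couple_embedded[OF X] unfolding interpolation_functor_def by blast+
  obtain k where k: "\<forall>x\<in>pts (F whole_space X). nrm (sum_space whole_space X) x \<le> k * nrm (F whole_space X) x"
    using cs unfolding cont_embedded_def by blast
  have "norm x \<le> (max 1 c * k) * nrm (F whole_space X) x" if x: "x \<in> pts (F whole_space X)" for x
  proof -
    have "norm x \<le> max 1 c * nrm (sum_space whole_space X) x"
      using sum_space_whole(3)[OF X.banach_sub_axioms] c by blast
    also have "\<dots> \<le> max 1 c * (k * nrm (F whole_space X) x)" using k x by (intro mult_left_mono) auto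
    finally show ?thesis by (simp add: mult.assoc)
  qed
  then show e: "embedded (F whole_space X)" using bs unfolding embedded_def by blast
  show sub: "pts X \<subseteq> pts (F whole_space X)" using ci unfolding cont_embedded_def by auto
  obtain l where l: "\<forall>x\<in>pts X. nrm (F whole_space X) x \<le> l * max (norm x) (nrm X x)"
    using ci unfolding cont_embedded_def by auto
  show "\<exists>c>0. \<forall>x\<in>pts X. nrm (F whole_space X) x \<le> c * nrm X x"
  proof (intro exI[of _ "(\<bar>l\<bar> + 1) * max c 1"] conjI ballI)
    fix x assume x: "x \<in> pts X"
    have n0: "0 \<le> nrm X x" by (rule X.nrm_nonneg[OF x])
    have "nrm (F whole_space X) x \<le> l * max (norm x) (nrm X x)" using l x by blast
    also have "\<dots> \<le> (\<bar>l\<bar> + 1) * max (norm x) (nrm X x)" using n0 by (intro mult_right_mono) auto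
    also have "max (norm x) (nrm X x) \<le> max c 1 * nrm X x"
    proof -
      have "norm x \<le> c * nrm X x" using c x by blast
      moreover have "c * nrm X x \<le> max c 1 * nrm X x" "1 * nrm X x \<le> max c 1 * nrm X x"
        using n0 by (intro mult_right_mono; simp)+
      ultimately show ?thesis by simp
    qed
    finally show "nrm (F whole_space X) x \<le> (\<bar>l\<bar> + 1) * max c 1 * nrm X x"
      by (simp add: mult.assoc mult_left_mono)
  qed (simp add: add_nonneg_pos)
qed

text \<open>Intersection and sum of the trivial couple are both the ambient space, so the functor
  reproduces it up to an equivalent norm. Used as source or target, this couple yields estimates for
  operators from or into the ambient space.\<close>

lemma interpolation_whole_space:
  assumes F: "interpolation_functor K sm F"
  shows "pts (F whole_space whole_space) = UNIV"
    "\<exists>c>0. \<forall>x. nrm (F whole_space whole_space) x \<le> c * norm x"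
    "\<exists>c>0. \<forall>x. norm x \<le> c * nrm (F whole_space whole_space) x"
proof -
  note * = interpolation_embedded[OF F embedded_whole_space]
  show 1: "pts (F whole_space whole_space) = UNIV" using *(2) by auto
  show "\<exists>c>0. \<forall>x. nrm (F whole_space whole_space) x \<le> c * norm x" using *(3) by simp
  show "\<exists>c>0. \<forall>x. norm x \<le> c * nrm (F whole_space whole_space) x"
    using banach_sub.embed[OF embedded_banach_sub[OF *(1)]] 1 by simp
qed

text \<open>Bounds \<open>a\<close> and \<open>b\<close> stand in for the operator norms, and the
  constant is fixed before the operator, so that families such as \<open>U t\<close> can be
  interpolated with rates in \<open>t\<close>.\<close>

lemma interpolation_estimate:
  assumes F: "interpolation_functor K sm F" "of_exponent K sm \<theta> F" and \<theta>: "0 < \<theta>" "\<theta> < 1"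
    and X: "embedded X" and Y: "embedded Y"
  obtains C where "C > 0" "\<And>B a b. commutes B \<Longrightarrow> a \<ge> 0 \<Longrightarrow> b \<ge> 0 \<Longrightarrow> (\<And>x. norm (B x) \<le> a * norm x) \<Longrightarrow>
     (\<And>x. x \<in> pts X \<Longrightarrow> B x \<in> pts Y \<and> nrm Y (B x) \<le> b * nrm X x) \<Longrightarrow>
     \<forall>x\<in>pts (F whole_space X). B x \<in> pts (F whole_space Y) \<and>
        nrm (F whole_space Y) (B x) \<le> C * a powr (1 - \<theta>) * b powr \<theta> * nrm (F whole_space X) x"
proof -
  obtain C0 where C0: "\<And>T. couple_morphism K sm whole_space X whole_space Y T \<Longrightarrow>
      opnorm (F whole_space X) (F whole_space Y) T \<le> C0 * opnorm whole_space whole_space T powr (1 - \<theta>) * opnorm X Y T powr \<theta>"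
    using F(2) banach_couple_embedded[OF X] banach_couple_embedded[OF Y] unfolding of_exponent_def by meson
  note bX = embedded_banach_sub[OF X] and bY = embedded_banach_sub[OF Y]
  note fX = embedded_banach_sub[OF interpolation_embedded(1)[OF F(1) X]]
    and fY = embedded_banach_sub[OF interpolation_embedded(1)[OF F(1) Y]]
  show thesis
  \<comment> \<open>The constant from \<open>of_exponent\<close> carries no sign; a positive one is
    needed before the operator norms may be replaced by larger bounds.\<close>
  proof (rule that[of "\<bar>C0\<bar> + 1"])
    fix B :: "'a \<Rightarrow>\<^sub>L 'a" and a b :: real
    assume B: "commutes B" and ab: "a \<ge> 0" "b \<ge> 0" and a: "\<And>x. norm (B x) \<le> a * norm x"
      and b: "\<And>x. x \<in> pts X \<Longrightarrow> B x \<in> pts Y \<and> nrm Y (B x) \<le> b * nrm X x"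
    have mor: "couple_morphism K sm whole_space X whole_space Y B"
      using b by (intro couple_morphism_embedded[OF X Y B]) auto
    then have bo: "bounded_op K sm (F whole_space X) (F whole_space Y) B"
      using F(1) banach_couple_embedded[OF X] banach_couple_embedded[OF Y] unfolding interpolation_functor_def by blast
    have k1: "B x \<in> pts (F whole_space Y)" if "x \<in> pts (F whole_space X)" for x
      using bo that unfolding bounded_op_def by (simp add: image_subset_iff)
    have "\<exists>k. \<forall>x\<in>pts (F whole_space X). nrm (F whole_space Y) (B x) \<le> k * nrm (F whole_space X) x"
      using bo unfolding bounded_op_def by (elim conjE)
    then obtain k where k2: "\<And>x. x \<in> pts (F whole_space X) \<Longrightarrow> nrm (F whole_space Y) (B x) \<le> k * nrm (F whole_space X) x"
      by blast
    have oa: "0 \<le> opnorm whole_space whole_space B" "opnorm whole_space whole_space B \<le> a"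
      using opnorm_facts(1,2)[OF banach_sub_whole_space banach_sub_whole_space, of B a] a ab by auto
    have ob: "0 \<le> opnorm X Y B" "opnorm X Y B \<le> b"
      using opnorm_facts(1,2)[OF bX bY, of B b] b ab by auto
    have "C0 * opnorm whole_space whole_space B powr (1 - \<theta>) * opnorm X Y B powr \<theta>
        \<le> (\<bar>C0\<bar> + 1) * opnorm whole_space whole_space B powr (1 - \<theta>) * opnorm X Y B powr \<theta>"
      by (intro mult_right_mono) auto
    also have "\<dots> \<le> (\<bar>C0\<bar> + 1) * a powr (1 - \<theta>) * b powr \<theta>"
      using oa ob \<theta> by (intro mult_mono powr_mono2) auto
    finally have op: "opnorm (F whole_space X) (F whole_space Y) B \<le> (\<bar>C0\<bar> + 1) * a powr (1 - \<theta>) * b powr \<theta>"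
      using C0[OF mor] by linarith
    show "\<forall>x\<in>pts (F whole_space X). B x \<in> pts (F whole_space Y) \<and>
        nrm (F whole_space Y) (B x) \<le> (\<bar>C0\<bar> + 1) * a powr (1 - \<theta>) * b powr \<theta> * nrm (F whole_space X) x"
    proof (intro ballI conjI k1)
      fix x assume x: "x \<in> pts (F whole_space X)"
      have "nrm (F whole_space Y) (B x) \<le> opnorm (F whole_space X) (F whole_space Y) B * nrm (F whole_space X) x"
        using opnorm_facts(3)[OF fX fY k1 k2 x] .
      also have "\<dots> \<le> (\<bar>C0\<bar> + 1) * a powr (1 - \<theta>) * b powr \<theta> * nrm (F whole_space X) x"
        using op banach_sub.nrm_nonneg[OF fX x] by (intro mult_right_mono)
      finally show "nrm (F whole_space Y) (B x) \<le> (\<bar>C0\<bar> + 1) * a powr (1 - \<theta>) * b powr \<theta> * nrm (F whole_space X) x" .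
    qed
  qed simp
qed

lemma interpolation_estimate_into:
  assumes F: "interpolation_functor K sm F" "of_exponent K sm \<theta> F" and \<theta>: "0 < \<theta>" "\<theta> < 1" and Y: "embedded Y"
  obtains C where "C > 0" "\<And>B a b x. commutes B \<Longrightarrow> a \<ge> 0 \<Longrightarrow> b \<ge> 0 \<Longrightarrow> (\<And>x. norm (B x) \<le> a * norm x) \<Longrightarrow>
     (\<And>x. B x \<in> pts Y \<and> nrm Y (B x) \<le> b * norm x) \<Longrightarrow>
     B x \<in> pts (F whole_space Y) \<and> nrm (F whole_space Y) (B x) \<le> C * a powr (1 - \<theta>) * b powr \<theta> * norm x"
proof -
  obtain C where C: "C > 0" "\<And>B a b. commutes B \<Longrightarrow> a \<ge> 0 \<Longrightarrow> b \<ge> 0 \<Longrightarrow> (\<And>x. norm (B x) \<le> a * norm x) \<Longrightarrow>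
     (\<And>x. x \<in> pts whole_space \<Longrightarrow> B x \<in> pts Y \<and> nrm Y (B x) \<le> b * nrm whole_space x) \<Longrightarrow>
     \<forall>x\<in>pts (F whole_space whole_space). B x \<in> pts (F whole_space Y) \<and>
        nrm (F whole_space Y) (B x) \<le> C * a powr (1 - \<theta>) * b powr \<theta> * nrm (F whole_space whole_space) x"
    using interpolation_estimate[OF F \<theta> embedded_whole_space Y] by blast
  obtain c where c: "c > 0" "\<forall>x. nrm (F whole_space whole_space) x \<le> c * norm x"
    using interpolation_whole_space(2)[OF F(1)] by blast
  show thesis
  proof (rule that[of "C * c"])
    fix B :: "'a \<Rightarrow>\<^sub>L 'a" and a b :: real and x
    assume B: "commutes B" "a \<ge> 0" "b \<ge> 0" "\<And>x. norm (B x) \<le> a * norm x" "\<And>x. B x \<in> pts Y \<and> nrm Y (B x) \<le> b * norm x"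
    have *: "B x \<in> pts (F whole_space Y) \<and>
        nrm (F whole_space Y) (B x) \<le> C * a powr (1 - \<theta>) * b powr \<theta> * nrm (F whole_space whole_space) x"
      using C(2)[OF B(1-4)] B(5) interpolation_whole_space(1)[OF F(1)] by simp
    have "C * a powr (1 - \<theta>) * b powr \<theta> * nrm (F whole_space whole_space) x \<le> C * a powr (1 - \<theta>) * b powr \<theta> * (c * norm x)"
      using c C(1) by (intro mult_left_mono) auto
    with * show "B x \<in> pts (F whole_space Y) \<and> nrm (F whole_space Y) (B x) \<le> C * c * a powr (1 - \<theta>) * b powr \<theta> * norm x"
      by (auto simp: mult_ac)
  qed (use c C in simp)
qed

lemma interpolation_estimate_from:
  assumes F: "interpolation_functor K sm F" "of_exponent K sm \<theta> F" and \<theta>: "0 < \<theta>" "\<theta> < 1" and X: "embedded X"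
  obtains C where "C > 0" "\<And>B a b x. commutes B \<Longrightarrow> a \<ge> 0 \<Longrightarrow> b \<ge> 0 \<Longrightarrow> (\<And>x. norm (B x) \<le> a * norm x) \<Longrightarrow>
     (\<And>x. x \<in> pts X \<Longrightarrow> norm (B x) \<le> b * nrm X x) \<Longrightarrow> x \<in> pts (F whole_space X) \<Longrightarrow>
     norm (B x) \<le> C * a powr (1 - \<theta>) * b powr \<theta> * nrm (F whole_space X) x"
proof -
  obtain C where C: "C > 0" "\<And>B a b. commutes B \<Longrightarrow> a \<ge> 0 \<Longrightarrow> b \<ge> 0 \<Longrightarrow> (\<And>x. norm (B x) \<le> a * norm x) \<Longrightarrow>
     (\<And>x. x \<in> pts X \<Longrightarrow> B x \<in> pts whole_space \<and> nrm whole_space (B x) \<le> b * nrm X x) \<Longrightarrow>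
     \<forall>x\<in>pts (F whole_space X). B x \<in> pts (F whole_space whole_space) \<and>
        nrm (F whole_space whole_space) (B x) \<le> C * a powr (1 - \<theta>) * b powr \<theta> * nrm (F whole_space X) x"
    using interpolation_estimate[OF F \<theta> X embedded_whole_space] by blast
  obtain c where c: "c > 0" "\<forall>x. norm x \<le> c * nrm (F whole_space whole_space) x"
    using interpolation_whole_space(3)[OF F(1)] by blast
  show thesis
  proof (rule that[of "c * C"])
    fix B :: "'a \<Rightarrow>\<^sub>L 'a" and a b :: real and x
    assume B: "commutes B" "a \<ge> 0" "b \<ge> 0" "\<And>x. norm (B x) \<le> a * norm x" "\<And>x. x \<in> pts X \<Longrightarrow> norm (B x) \<le> b * nrm X x"
      and x: "x \<in> pts (F whole_space X)"
    have "norm (B x) \<le> c * nrm (F whole_space whole_space) (B x)" using c by blast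
    also have "\<dots> \<le> c * (C * a powr (1 - \<theta>) * b powr \<theta> * nrm (F whole_space X) x)"
      using C(2)[OF B(1-4)] B(5) x c by (intro mult_left_mono) auto
    finally show "norm (B x) \<le> c * C * a powr (1 - \<theta>) * b powr \<theta> * nrm (F whole_space X) x"
      by (simp add: mult_ac)
  qed (use c C in simp)
qed

end

subsection \<open>Analytic semigroups on the interpolation scale\<close>

locale analytic_scale = normed_scalar_action K sm + smoothing_semigroup_on U L "pts E1" A T M
  for K and sm :: "complex \<Rightarrow> 'a::banach \<Rightarrow> 'a" and U L and E1 :: "'a nspace" and A T M +
  assumes E1: "embedded E1" and commutes_U: "\<And>t. t \<ge> 0 \<Longrightarrow> commutes (U t)"
begin

sublocale E1: banach_sub E1
  by (rule embedded_banach_sub[OF E1])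

text \<open>The domain with the graph norm, complete because \<open>A\<close> is closed; it exists
  to be compared with the given norm of \<open>E1\<close>.\<close>

definition graph_space :: "'a nspace" where
  "graph_space = \<lparr>pts = pts E1, nrm = (\<lambda>x. norm x + norm (A x))\<rparr>"

lemma banach_sub_graph_space: "banach_sub graph_space"
proof
  show "0 \<in> pts graph_space" using zero_in_D by (simp add: graph_space_def)
  show "x + y \<in> pts graph_space" if "x \<in> pts graph_space" "y \<in> pts graph_space" for x y
    using that A_add by (auto simp: graph_space_def)
  show "r *\<^sub>R x \<in> pts graph_space" if "x \<in> pts graph_space" for r x
    using that A_scale by (auto simp: graph_space_def)
  show "nrm graph_space (r *\<^sub>R x) = \<bar>r\<bar> * nrm graph_space x" if "x \<in> pts graph_space" for r x
    using that A_scale by (auto simp: graph_space_def distrib_left)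
  show "nrm graph_space (x + y) \<le> nrm graph_space x + nrm graph_space y"
    if "x \<in> pts graph_space" "y \<in> pts graph_space" for x y
    using that A_add[of x y] norm_triangle_ineq[of x y] norm_triangle_ineq[of "A x" "A y"]
    by (simp add: graph_space_def)
  show "\<exists>c>0. \<forall>x\<in>pts graph_space. norm x \<le> c * nrm graph_space x"
    by (intro exI[of _ 1]) (auto simp: graph_space_def)
  fix y :: "nat \<Rightarrow> 'a"
  assume y: "\<And>n. y n \<in> pts graph_space"
    and C: "\<And>e. e > 0 \<Longrightarrow> \<exists>N. \<forall>m\<ge>N. \<forall>n\<ge>N. nrm graph_space (y m - y n) < e"
  have yD: "y n \<in> pts E1" for n using y by (simp add: graph_space_def)
  have C': "\<exists>N. \<forall>m\<ge>N. \<forall>n\<ge>N. norm (y m - y n) < e \<and> norm (A (y m) - A (y n)) < e" if e: "e > 0" for e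
  proof -
    obtain N where N: "\<forall>m\<ge>N. \<forall>n\<ge>N. norm (y m - y n) + norm (A (y m - y n)) < e"
      using C[OF e] by (auto simp: graph_space_def)
    have "norm (y m - y n) < e \<and> norm (A (y m) - A (y n)) < e" if "m \<ge> N" "n \<ge> N" for m n
    proof -
      have "norm (y m - y n) + norm (A (y m) - A (y n)) < e"
        using N[rule_format, OF that] A_diff[OF yD yD, of m n] by simp
      then show ?thesis using norm_ge_zero[of "y m - y n"] norm_ge_zero[of "A (y m) - A (y n)"] by linarith
    qed
    then show ?thesis by blast
  qed
  have "Cauchy y" "Cauchy (\<lambda>n. A (y n))" by (rule CauchyI; use C' in meson)+
  then obtain l z where l: "y \<longlonglongrightarrow> l" and z: "(\<lambda>n. A (y n)) \<longlonglongrightarrow> z"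
    using Cauchy_convergent unfolding convergent_def by blast
  have lD: "l \<in> pts E1 \<and> A l = z" by (rule A_closed[OF yD l z])
  have "(\<lambda>n. norm (y n - l) + norm (A (y n) - z)) \<longlonglongrightarrow> 0 + 0"
    using l z by (intro tendsto_add) (simp_all add: tendsto_norm_zero_iff LIM_zero_iff)
  then have "(\<lambda>n. nrm graph_space (y n - l)) \<longlonglongrightarrow> 0"
    using A_diff[OF yD, of l] lD by (simp add: graph_space_def)
  then show "\<exists>l\<in>pts graph_space. (\<lambda>n. nrm graph_space (y n - l)) \<longlonglongrightarrow> 0"
    using lD by (intro bexI[of _ l]) (auto simp: graph_space_def)
qed

text \<open>Two complete norms on the same set: the bounded inclusion theorem applies in both
  directions. Estimates of \<open>L\<close> thereby become estimates in \<open>E1\<close>.\<close>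

lemma graph_norm:
  obtains c where "c \<ge> 1" "\<And>x. x \<in> pts E1 \<Longrightarrow> nrm E1 x \<le> c * (norm x + norm (A x))"
    "\<And>x. x \<in> pts E1 \<Longrightarrow> norm x + norm (A x) \<le> c * nrm E1 x"
proof -
  have eq: "pts graph_space = pts E1" by (simp add: graph_space_def)
  obtain a where a: "a > 0" "\<forall>x\<in>pts graph_space. nrm E1 x \<le> a * nrm graph_space x"
    using inclusion_bounded[OF banach_sub_graph_space E1.banach_sub_axioms] eq by auto
  obtain b where b: "b > 0" "\<forall>x\<in>pts E1. nrm graph_space x \<le> b * nrm E1 x"
    using inclusion_bounded[OF E1.banach_sub_axioms banach_sub_graph_space] eq by auto
  show thesis
  proof (rule that[of "max 1 (max a b)"])
    fix x assume x: "x \<in> pts E1"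
    have "nrm E1 x \<le> a * (norm x + norm (A x))" using a x by (auto simp: graph_space_def)
    also have "\<dots> \<le> max 1 (max a b) * (norm x + norm (A x))" by (intro mult_right_mono) auto
    finally show "nrm E1 x \<le> max 1 (max a b) * (norm x + norm (A x))" .
    have "norm x + norm (A x) \<le> b * nrm E1 x" using b x by (auto simp: graph_space_def)
    also have "\<dots> \<le> max 1 (max a b) * nrm E1 x" using E1.nrm_nonneg[OF x] by (intro mult_right_mono) auto
    finally show "norm x + norm (A x) \<le> max 1 (max a b) * nrm E1 x" .
  qed simp
qed

text \<open>Couple morphisms are linear over \<open>K\<close>, so every operator to be interpolated
  must be shown to commute with scalars from \<open>K\<close>.\<close>

lemma commutes_L:
  assumes t: "t > 0"
  shows "commutes (L t)"
  unfolding commutes_def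
proof (intro ballI allI)
  fix c x assume c: "c \<in> K"
  have bl: "bounded_linear (sm c)"
  proof (rule bounded_linear_intro)
    show "sm c (x + y) = sm c x + sm c y" for x y using sm_add_right[OF c] .
    have r: "complex_of_real r \<in> K" for r using field by auto
    show "sm c (r *\<^sub>R x) = r *\<^sub>R sm c x" for r x
      using sm_mult[OF c r, of r x] sm_mult[OF r c, of r x] by (simp add: sm_of_real mult.commute)
    show "norm (sm c x) \<le> norm x * cmod c" for x using nrm_sm[OF c] by simp
  qed
  have "((\<lambda>t. sm c (U t x)) has_vector_derivative sm c (L t x)) (at t)"
    by (rule bounded_linear.has_vector_derivative[OF bl deriv[OF t]])
  then have "((\<lambda>t. U t (sm c x)) has_vector_derivative sm c (L t x)) (at t)"
    by (rule has_vector_derivative_transform_within_open[of _ _ _ "{0<..}"])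
       (use t c commutes_U in \<open>auto simp: commutes_def\<close>)
  with deriv[OF t] show "L t (sm c x) = sm c (L t x)" by (rule vector_derivative_unique_at)
qed

lemma commutes_compose: "commutes B \<Longrightarrow> commutes B' \<Longrightarrow> commutes (B o\<^sub>L B')"
  by (simp add: commutes_def)

lemma commutes_diff: "commutes B \<Longrightarrow> commutes B' \<Longrightarrow> commutes (B - B')"
  unfolding commutes_def
proof (intro ballI allI)
  fix c x assume a: "\<forall>c\<in>K. \<forall>x. B (sm c x) = sm c (B x)" "\<forall>c\<in>K. \<forall>x. B' (sm c x) = sm c (B' x)" and c: "c \<in> K"
  have "sm c (B x - B' x) + sm c (B' x) = sm c (B x)"
    using sm_add_right[OF c, of "B x - B' x" "B' x"] by simp
  then show "(B - B') (sm c x) = sm c ((B - B') x)"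
    using a c by (simp add: blinfun.diff_left algebra_simps)
qed

lemma commutes_id: "commutes id_blinfun"
  by (simp add: commutes_def)

lemma U_diff_bound:
  assumes "0 \<le> h" "h \<le> T" "0 < t" "t \<le> T"
  shows "norm (U h (U t x) - U t x) \<le> 2 * M^2 * norm x"
    and "norm (U h (U t x) - U t x) \<le> M^2 * (h / t) * norm x"
proof -
  have "norm (U h (U t x) - U t x) \<le> norm (U h (U t x)) + norm (U t x)" by (rule norm_triangle_ineq4)
  also have "\<dots> \<le> M * (M * norm x) + M * norm x"
    using assms M norm_U_apply[of h "U t x"] norm_U_apply[of t x] mult_left_mono[of "norm (U t x)" "M * norm x" M]
    by linarith
  also have "\<dots> \<le> M * (M * norm x) + M * (M * norm x)"
    using M mult_right_mono[of 1 M "norm x"] by (intro add_left_mono mult_left_mono) auto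
  finally show "norm (U h (U t x) - U t x) \<le> 2 * M^2 * norm x" by (simp add: power2_eq_square)
  have eq: "U h (U t x) - U t x = integral {t..t+h} (\<lambda>r. L r x)"
    using U_integral_L[of t "t + h" x] U_add[of h t x] assms by (simp add: integral_unique add.commute)
  \<comment> \<open>\<open>r\<close> may exceed \<open>T\<close>, where \<open>norm_L\<close> says
    nothing, so \<open>L r\<close> is factored through \<open>L t\<close>.\<close>
  have L: "L r x = U (r - t) (L t x)" if "r \<in> {t..t+h}" for r
    using L_add(1)[of "r - t" t x] that assms by simp
  have "norm (integral {t..t+h} (\<lambda>r. L r x)) \<le> (M * (M / t * norm x)) * (t + h - t)"
  proof (rule integral_bound)
    show "continuous_on {t..t+h} (\<lambda>r. L r x)"
    proof (rule continuous_on_eq)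
      show "continuous_on {t..t+h} (\<lambda>r. U (r - t) (L t x))"
        by (intro U_continuous_on continuous_intros) simp
    qed (rule L[symmetric])
    fix r assume r: "r \<in> {t..t+h}"
    have "norm (L r x) \<le> M * norm (L t x)" unfolding L[OF r] using r assms by (intro norm_U_apply) auto
    also have "\<dots> \<le> M * (M / t * norm x)" using assms M by (intro mult_left_mono norm_L_apply) auto
    finally show "norm (L r x) \<le> M * (M / t * norm x)" .
  qed (use assms in auto)
  then show "norm (U h (U t x) - U t x) \<le> M^2 * (h / t) * norm x"
    unfolding eq by (simp add: power2_eq_square field_simps)
qed

text \<open>Combines the linear bound, used for \<open>h \<le> t\<close>, with the bounded one, used
  for \<open>h > t\<close>.\<close>

lemma U_diff_hoelder:
  assumes "0 \<le> h" "h \<le> T" "0 < t" "t \<le> T" and \<nu>: "0 < \<nu>" "\<nu> \<le> 1"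
  shows "norm (U h (U t x) - U t x) \<le> 2 * M^2 * (h / t) powr \<nu> * norm x"
proof (cases "h \<le> t")
  case True
  have "h / t \<le> (h / t) powr \<nu>"
  proof (cases "h = 0")
    case False
    then have "h / t > 0" "h / t \<le> 1" using True assms by auto
    then have "(h / t) powr 1 \<le> (h / t) powr \<nu>" using \<nu> by (intro powr_mono') auto
    then show ?thesis using assms by simp
  qed simp
  then have "M^2 * (h / t) * norm x \<le> 2 * M^2 * (h / t) powr \<nu> * norm x"
    using assms by (intro mult_right_mono mult_mono) auto
  then show ?thesis using U_diff_bound(2)[OF assms(1-4), of x] by linarith
next
  case False
  then have "1 \<le> (h / t) powr \<nu>" using assms by (intro ge_one_powr_ge_zero) auto
  then have "2 * M^2 * 1 * norm x \<le> 2 * M^2 * (h / t) powr \<nu> * norm x"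
    by (intro mult_right_mono mult_left_mono) auto
  then show ?thesis using U_diff_bound(1)[OF assms(1-4), of x] by simp
qed

lemma U_into_E1:
  obtains b where "b > 0" "\<And>t x. 0 < t \<Longrightarrow> t \<le> T \<Longrightarrow> U t x \<in> pts E1 \<and> nrm E1 (U t x) \<le> b / t * norm x"
    "\<And>h t \<nu> x. 0 \<le> h \<Longrightarrow> h \<le> T \<Longrightarrow> 0 < t \<Longrightarrow> t \<le> T \<Longrightarrow> 0 < \<nu> \<Longrightarrow> \<nu> \<le> 1 \<Longrightarrow>
       U h (U t x) - U t x \<in> pts E1 \<and> nrm E1 (U h (U t x) - U t x) \<le> b * (h / t) powr \<nu> / t * norm x"
proof -
  obtain c where c: "c \<ge> 1" "\<And>x. x \<in> pts E1 \<Longrightarrow> nrm E1 x \<le> c * (norm x + norm (A x))"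
    "\<And>x. x \<in> pts E1 \<Longrightarrow> norm x + norm (A x) \<le> c * nrm E1 x"
    using graph_norm by blast
  \<comment> \<open>One constant for both estimates: the first two summands serve the bound for
    \<open>U t\<close>, the last two the bound for increments.\<close>
  define b where "b = c * (M * T + M + 2 * M^2 * T + 8 * M^3)"
  have M0: "M > 0" using M by simp
  have b: "b > 0" using c M0 T by (simp add: b_def add_pos_pos)
  show thesis
  proof (rule that[OF b])
    fix t :: real and x assume t: "0 < t" "t \<le> T"
    have "nrm E1 (U t x) \<le> c * (norm (U t x) + norm (L t x))"
      using c(2)[OF U_in_D(1)[OF t(1)], of x] U_in_D(2)[OF t(1), of x] by simp
    also have "\<dots> \<le> c * (M * norm x + M / t * norm x)"
      using c t by (intro mult_left_mono add_mono norm_U_apply norm_L_apply) auto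
    also have "\<dots> = c * (M * t + M) / t * norm x" using t by (simp add: field_simps)
    also have "\<dots> \<le> b / t * norm x"
    proof (intro mult_right_mono divide_right_mono)
      have "M * t \<le> M * T" using t M0 by simp
      moreover have "0 \<le> 2 * M^2 * T + 8 * M^3" using M0 T by simp
      ultimately show "c * (M * t + M) \<le> b" unfolding b_def using c by (intro mult_left_mono) auto
    qed (use t in auto)
    finally show "U t x \<in> pts E1 \<and> nrm E1 (U t x) \<le> b / t * norm x" using U_in_D(1)[OF t(1)] by blast
  next
    fix h t \<nu> :: real and x assume h: "0 \<le> h" "h \<le> T" and t: "0 < t" "t \<le> T" and \<nu>: "0 < \<nu>" "\<nu> \<le> 1"
    define w where "w = (h / t) powr \<nu>"
    have w0: "w \<ge> 0" by (simp add: w_def)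
    have D: "U h (U t x) \<in> pts E1" "U t x \<in> pts E1" "A (U h (U t x)) = L (t + h) x" "A (U t x) = L t x"
      using U_in_D[of "t + h" x] U_in_D[of t x] U_add[of h t x] t h by (auto simp: add.commute)
    \<comment> \<open>Half of the time is spent on \<open>L\<close>, at the cost of a factor
      \<open>1 / t\<close>, and the other half on the Hoelder estimate of the increment.\<close>
    define y where "y = L (t / 2) x"
    have "L (t + h) x - L t x = U h (U (t/2) y) - U (t/2) y"
      using L_add(1)[of "t / 2 + h" "t / 2" x] L_add(1)[of "t / 2" "t / 2" x] U_add[of h "t/2" y] t h
      by (simp add: y_def add_ac)
    then have "norm (A (U h (U t x) - U t x)) = norm (U h (U (t/2) y) - U (t/2) y)"
      using A_diff[OF D(1,2)] D by simp
    also have "\<dots> \<le> 2 * M^2 * (h / (t/2)) powr \<nu> * norm y"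
      using h t \<nu> by (intro U_diff_hoelder) auto
    also have "\<dots> \<le> 2 * M^2 * (2 * w) * (M / (t / 2) * norm x)"
    proof (intro mult_mono mult_left_mono)
      have "(h / (t/2)) powr \<nu> = 2 powr \<nu> * w" using h t by (simp add: w_def powr_mult[symmetric] mult.commute)
      also have "\<dots> \<le> 2 powr 1 * w" using \<nu> w0 by (intro mult_right_mono powr_mono) auto
      finally show "(h / (t/2)) powr \<nu> \<le> 2 * w" by simp
      show "norm y \<le> M / (t / 2) * norm x" unfolding y_def using t by (intro norm_L_apply) auto
    qed (use w0 M0 t in auto)
    also have "\<dots> = 8 * M^3 * w / t * norm x" by (simp add: power2_eq_square power3_eq_cube)
    finally have n2: "norm (A (U h (U t x) - U t x)) \<le> 8 * M^3 * w / t * norm x" .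
    have n1: "norm (U h (U t x) - U t x) \<le> 2 * M^2 * w * norm x"
      unfolding w_def using h t \<nu> by (intro U_diff_hoelder) auto
    have m: "U h (U t x) - U t x \<in> pts E1" using A_diff[OF D(1,2)] by blast
    have "nrm E1 (U h (U t x) - U t x) \<le> c * (2 * M^2 * w * norm x + 8 * M^3 * w / t * norm x)"
      using c(2)[OF m] n1 n2 c(1) mult_left_mono[OF add_mono[OF n1 n2], of c] by linarith
    also have "\<dots> = c * (2 * M^2 * t + 8 * M^3) * w / t * norm x" using t by (simp add: field_simps)
    also have "\<dots> \<le> b * w / t * norm x"
    proof (intro mult_right_mono divide_right_mono)
      have "2 * M^2 * t \<le> 2 * M^2 * T" using t M0 by simp
      moreover have "0 \<le> M * T + M" using M0 T by simp
      ultimately show "c * (2 * M^2 * t + 8 * M^3) \<le> b" unfolding b_def using c by (intro mult_left_mono) auto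
    qed (use t w0 in auto)
    finally show "U h (U t x) - U t x \<in> pts E1 \<and> nrm E1 (U h (U t x) - U t x) \<le> b * (h / t) powr \<nu> / t * norm x"
      using m by (simp add: w_def)
  qed
qed

text \<open>On its domain \<open>A\<close> commutes with the semigroup, so each estimate reduces to
  ambient bounds for \<open>x\<close> and \<open>A x\<close>; the last one will give continuity of
  orbits in \<open>E1\<close>.\<close>

lemma U_on_E1:
  obtains b where "b > 0" "\<And>t x. 0 \<le> t \<Longrightarrow> t \<le> T \<Longrightarrow> x \<in> pts E1 \<Longrightarrow> U t x \<in> pts E1 \<and> nrm E1 (U t x) \<le> b * nrm E1 x"
    "\<And>t x. 0 < t \<Longrightarrow> t \<le> T \<Longrightarrow> x \<in> pts E1 \<Longrightarrow> norm (L t x) \<le> b * nrm E1 x"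
    "\<And>t x. 0 \<le> t \<Longrightarrow> t \<le> T \<Longrightarrow> x \<in> pts E1 \<Longrightarrow> norm (U t x - x) \<le> b * t * nrm E1 x"
    "\<And>t s x. 0 \<le> t \<Longrightarrow> 0 \<le> s \<Longrightarrow> x \<in> pts E1 \<Longrightarrow> nrm E1 (U t x - U s x) \<le> b * (norm (U t x - U s x) + norm (U t (A x) - U s (A x)))"
proof -
  obtain c where c: "c \<ge> 1" "\<And>x. x \<in> pts E1 \<Longrightarrow> nrm E1 x \<le> c * (norm x + norm (A x))"
    "\<And>x. x \<in> pts E1 \<Longrightarrow> norm x + norm (A x) \<le> c * nrm E1 x"
    using graph_norm by blast
  have M0: "M > 0" using M by simp
  have UA: "U t x \<in> pts E1 \<and> A (U t x) = U t (A x)" if "0 \<le> t" "x \<in> pts E1" for t x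
    using U_in_D[of t x] L_eq_U_A[OF that(2), of t] that by (cases "t = 0") auto
  have Ax: "norm (A x) \<le> c * nrm E1 x" if "x \<in> pts E1" for x
    using c(3)[OF that] norm_ge_zero[of x] by linarith
  have MU: "M * norm (A x) \<le> c * M * c * nrm E1 x" if "x \<in> pts E1" for x
  proof -
    have "M * norm (A x) \<le> M * (c * nrm E1 x)" using Ax[OF that] M0 by (intro mult_left_mono) auto
    also have "\<dots> \<le> c * (M * (c * nrm E1 x))"
      using c(1) M0 E1.nrm_nonneg[OF that] mult_right_mono[of 1 c "M * (c * nrm E1 x)"] by simp
    finally show ?thesis by (simp add: mult_ac)
  qed
  have cb: "c \<le> c * M * c"
  proof -
    have "1 * 1 \<le> M * c" using c M by (intro mult_mono) auto
    then show ?thesis using c mult_left_mono[of 1 "M * c" c] by (simp add: mult.assoc)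
  qed
  show thesis
  proof (rule that[of "c * M * c"])
    show "c * M * c > 0" using c M0 by simp
    fix t :: real and x assume t: "0 \<le> t" "t \<le> T" and x: "x \<in> pts E1"
    have "nrm E1 (U t x) \<le> c * (norm (U t x) + norm (U t (A x)))" using c(2)[of "U t x"] UA[OF t(1) x] by simp
    also have "\<dots> \<le> c * (M * norm x + M * norm (A x))"
      using c t by (intro mult_left_mono add_mono norm_U_apply) auto
    also have "\<dots> = c * M * (norm x + norm (A x))" by (simp add: algebra_simps)
    also have "\<dots> \<le> c * M * (c * nrm E1 x)" using c M0 x by (intro mult_left_mono) auto
    finally show "U t x \<in> pts E1 \<and> nrm E1 (U t x) \<le> c * M * c * nrm E1 x" using UA[OF t(1) x] by (simp add: mult_ac)
    have "norm (integral {0..t} (\<lambda>r. U r (A x))) \<le> (M * norm (A x)) * (t - 0)"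
      by (rule integral_bound) (use t norm_U_apply in \<open>auto intro!: continuous_on_subset[OF U_cont]\<close>)
    also have "\<dots> \<le> (c * M * c * nrm E1 x) * (t - 0)" using MU[OF x] t by (intro mult_right_mono) auto
    finally show "norm (U t x - x) \<le> c * M * c * t * nrm E1 x"
      using U_integral_A[OF x t(1)] by (simp add: integral_unique mult_ac)
  next
    fix t :: real and x assume t: "0 < t" "t \<le> T" and x: "x \<in> pts E1"
    have "norm (L t x) \<le> M * norm (A x)" unfolding L_eq_U_A[OF x t(1)] using t by (intro norm_U_apply) auto
    then show "norm (L t x) \<le> c * M * c * nrm E1 x" using MU[OF x] by linarith
  next
    fix t s :: real and x assume ts: "0 \<le> t" "0 \<le> s" and x: "x \<in> pts E1"
    have "nrm E1 (U t x - U s x) \<le> c * (norm (U t x - U s x) + norm (U t (A x) - U s (A x)))"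
      using c(2)[of "U t x - U s x"] UA[OF _ x] A_diff[of "U t x" "U s x"] ts by simp
    also have "\<dots> \<le> c * M * c * (norm (U t x - U s x) + norm (U t (A x) - U s (A x)))"
      using cb by (intro mult_right_mono) auto
    finally show "nrm E1 (U t x - U s x) \<le> c * M * c * (norm (U t x - U s x) + norm (U t (A x) - U s (A x)))" .
  qed
qed

text \<open>Exponent zero is not produced by a functor and needs its own instance; the time exponent
  \<open>1/2\<close> is an arbitrary choice in \<open>(0, 1)\<close>.\<close>

lemma smoothing_space_whole_space: "smoothing_space U L (pts E1) A T M whole_space 0 (1/2) (2 * M^2)"
proof (intro smoothing_space.intro smoothing_space_axioms.intro banach_sub_whole_space smoothing_semigroup_on_axioms)
  have M2: "M \<le> 2 * M^2" using M mult_left_mono[of 1 M M] by (simp add: power2_eq_square)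
  show "2 * M^2 > 0" using M by simp
  fix t x assume t: "0 < t" "t \<le> T"
  have "norm (U t x) \<le> M * norm x" using t by (intro norm_U_apply) auto
  also have "\<dots> \<le> 2 * M^2 * norm x" using M2 by (intro mult_right_mono) auto
  finally show "U t x \<in> pts whole_space \<and> nrm whole_space (U t x) \<le> 2 * M^2 * t powr (- 0) * norm x"
    using t by simp
next
  fix h t x assume h: "0 \<le> h" "h \<le> T" and t: "0 < t" "t \<le> T"
  have "norm (U h (U t x) - U t x) \<le> 2 * M^2 * (h / t) powr (1/2) * norm x"
    using h t by (intro U_diff_hoelder) auto
  also have "(h / t) powr (1/2) = h powr (1/2) * t powr (- (0 + 1/2))"
    using h t by (simp add: powr_divide powr_minus field_simps)
  finally show "nrm whole_space (U h (U t x) - U t x) \<le> 2 * M^2 * h powr (1/2) * t powr (- (0 + 1/2)) * norm x"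
    by simp
next
  fix x :: 'a
  show "continuous_map (top_of_set {0..T}) (ntop whole_space) (\<lambda>t. U t x)"
    by (auto intro: continuous_on_subset[OF U_cont])
qed auto

end

context analytic_scale
begin

text \<open>Interpolates ambient bounds with those into \<open>E1\<close>. For increments both
  endpoint estimates carry the same factor \<open>(h / t) powr \<mu>\<close>, which therefore
  survives the interpolation unchanged.\<close>

lemma smoothing_space_interpolation:
  assumes F: "interpolation_functor K sm F" "of_exponent K sm \<theta> F" "admissible_functor K sm F"
    and \<theta>: "0 < \<theta>" "\<theta> < 1" and emb: "cont_embedded E1 whole_space" and dens: "dense_in E1 whole_space"
  shows "\<exists>\<mu> N. smoothing_space U L (pts E1) A T M (F whole_space E1) \<theta> \<mu> N"
proof -
  define Y where "Y = F whole_space E1"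
  have Y: "embedded Y" "pts E1 \<subseteq> pts Y" unfolding Y_def by (rule interpolation_embedded[OF F(1) E1])+
  obtain k where k: "k > 0" "\<forall>x\<in>pts E1. nrm Y x \<le> k * nrm E1 x"
    unfolding Y_def using interpolation_embedded(3)[OF F(1) E1] by blast
  interpret Y: banach_sub Y by (rule embedded_banach_sub[OF Y(1)])
  have M0: "M > 0" using M by simp
  obtain b where b: "b > 0" "\<And>t x. 0 < t \<Longrightarrow> t \<le> T \<Longrightarrow> U t x \<in> pts E1 \<and> nrm E1 (U t x) \<le> b / t * norm x"
    "\<And>h t \<nu> x. 0 \<le> h \<Longrightarrow> h \<le> T \<Longrightarrow> 0 < t \<Longrightarrow> t \<le> T \<Longrightarrow> 0 < \<nu> \<Longrightarrow> \<nu> \<le> 1 \<Longrightarrow>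
       U h (U t x) - U t x \<in> pts E1 \<and> nrm E1 (U h (U t x) - U t x) \<le> b * (h / t) powr \<nu> / t * norm x"
    proof (rule U_into_E1, goal_cases)
      case (1 c)
      show ?case by (rule that[OF 1(2-)])
    qed
  obtain C where C: "C > 0" "\<And>B a b x. commutes B \<Longrightarrow> a \<ge> 0 \<Longrightarrow> b \<ge> 0 \<Longrightarrow> (\<And>x. norm (blinfun_apply B x) \<le> a * norm x) \<Longrightarrow>
     (\<And>x. B x \<in> pts E1 \<and> nrm E1 (B x) \<le> b * norm x) \<Longrightarrow>
     B x \<in> pts Y \<and> nrm Y (B x) \<le> C * a powr (1 - \<theta>) * b powr \<theta> * norm x"
    proof (rule interpolation_estimate_into[OF F(1,2) \<theta> E1, folded Y_def], goal_cases)
      case (1 c)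
      show ?case by (rule that[OF 1(2-)])
    qed
  define \<mu> where "\<mu> = (1 - \<theta>) / 2"
  have \<mu>: "0 < \<mu>" "\<mu> \<le> 1" "\<theta> + \<mu> < 1" using \<theta> by (auto simp: \<mu>_def field_simps)
  define N where "N = C * (2 * M^2) powr (1 - \<theta>) * b powr \<theta>"
  have N: "N > 0" using C b M0 by (simp add: N_def)
  have into: "U t x \<in> pts Y \<and> nrm Y (U t x) \<le> N * t powr (- \<theta>) * norm x" if t: "0 < t" "t \<le> T" for t x
  proof -
    have "U t x \<in> pts Y \<and> nrm Y (U t x) \<le> C * (2 * M^2) powr (1 - \<theta>) * (b / t) powr \<theta> * norm x"
    proof (rule C(2))
      show "commutes (U t)" using t by (intro commutes_U) auto
      show "norm (U t x) \<le> 2 * M^2 * norm x" for x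
      proof -
        have "norm (U t x) \<le> M * norm x" using t by (intro norm_U_apply) auto
        also have "\<dots> \<le> 2 * M^2 * norm x"
          using M mult_left_mono[of 1 M M] by (intro mult_right_mono) (auto simp: power2_eq_square)
        finally show ?thesis .
      qed
    qed (use t b in auto)
    moreover have "(b / t) powr \<theta> = b powr \<theta> * t powr (- \<theta>)"
      using t b(1) by (simp add: powr_divide powr_minus_divide)
    ultimately show ?thesis by (simp add: N_def mult_ac)
  qed
  have diff: "nrm Y (U h (U t x) - U t x) \<le> N * h powr \<mu> * t powr (- (\<theta> + \<mu>)) * norm x"
    if h: "0 \<le> h" "h \<le> T" and t: "0 < t" "t \<le> T" for h t x
  proof -
    define w where "w = (h / t) powr \<mu>"
    have w0: "w \<ge> 0" by (simp add: w_def)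
    define B where "B = (U h o\<^sub>L U t) - U t"
    have B: "B x = U h (U t x) - U t x" for x by (simp add: B_def blinfun.diff_left)
    have "nrm Y (B x) \<le> C * (2 * M^2 * w) powr (1 - \<theta>) * (b * w / t) powr \<theta> * norm x"
    proof (rule conjunct2[OF C(2)])
      show "commutes B" unfolding B_def using h t by (intro commutes_diff commutes_compose commutes_U) auto
      show "norm (B x) \<le> 2 * M^2 * w * norm x" for x
        unfolding B w_def using h t \<mu> by (intro U_diff_hoelder) auto
      show "B x \<in> pts E1 \<and> nrm E1 (B x) \<le> b * w / t * norm x" for x
        unfolding B w_def using b(3)[OF h t \<mu>(1,2)] .
    qed (use w0 b t in auto)
    also have "(2 * M^2 * w) powr (1 - \<theta>) = (2 * M^2) powr (1 - \<theta>) * w powr (1 - \<theta>)"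
      using w0 by (intro powr_mult)
    also have "(b * w / t) powr \<theta> = b powr \<theta> * w powr \<theta> * t powr (- \<theta>)"
      using w0 b(1) t by (simp add: powr_divide powr_mult powr_minus_divide)
    also have "C * ((2 * M^2) powr (1 - \<theta>) * w powr (1 - \<theta>)) * (b powr \<theta> * w powr \<theta> * t powr (- \<theta>)) * norm x
        = N * (w powr (1 - \<theta>) * w powr \<theta>) * t powr (- \<theta>) * norm x" by (simp add: N_def)
    also have "w powr (1 - \<theta>) * w powr \<theta> = w" using w0 by (simp add: powr_add[symmetric])
    also have "N * w * t powr (- \<theta>) * norm x = N * h powr \<mu> * (t powr (- \<mu>) * t powr (- \<theta>)) * norm x"
      using h t by (simp add: w_def powr_divide powr_minus_divide)
    also have "t powr (- \<mu>) * t powr (- \<theta>) = t powr (- (\<theta> + \<mu>))" by (simp add: powr_add[symmetric] algebra_simps)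
    finally show ?thesis unfolding B .
  qed
  \<comment> \<open>Strong continuity in \<open>Y\<close>: the operators \<open>U t\<close> are
    uniformly bounded there by interpolation, orbits of points of \<open>E1\<close> are continuous
    in \<open>E1\<close> and so in \<open>Y\<close>, and admissibility makes \<open>E1\<close> dense
    in \<open>Y\<close>.\<close>
  have orbit: "continuous_map (top_of_set {0..T}) (ntop Y) (\<lambda>t. U t x)" if x: "x \<in> pts Y" for x
  proof -
    obtain d where d: "d > 0" "\<And>t x. 0 \<le> t \<Longrightarrow> t \<le> T \<Longrightarrow> x \<in> pts E1 \<Longrightarrow> U t x \<in> pts E1 \<and> nrm E1 (U t x) \<le> d * nrm E1 x"
      "\<And>t x. 0 < t \<Longrightarrow> t \<le> T \<Longrightarrow> x \<in> pts E1 \<Longrightarrow> norm (L t x) \<le> d * nrm E1 x"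
      "\<And>t x. 0 \<le> t \<Longrightarrow> t \<le> T \<Longrightarrow> x \<in> pts E1 \<Longrightarrow> norm (U t x - x) \<le> d * t * nrm E1 x"
      "\<And>t s x. 0 \<le> t \<Longrightarrow> 0 \<le> s \<Longrightarrow> x \<in> pts E1 \<Longrightarrow> nrm E1 (U t x - U s x) \<le> d * (norm (U t x - U s x) + norm (U t (A x) - U s (A x)))"
    proof (rule U_on_E1, goal_cases)
      case (1 c)
      show ?case by (rule that[OF 1(2-)])
    qed
    obtain C' where C': "C' > 0" "\<And>B a b. commutes B \<Longrightarrow> a \<ge> 0 \<Longrightarrow> b \<ge> 0 \<Longrightarrow> (\<And>x. norm (blinfun_apply B x) \<le> a * norm x) \<Longrightarrow>
       (\<And>x. x \<in> pts E1 \<Longrightarrow> B x \<in> pts E1 \<and> nrm E1 (B x) \<le> b * nrm E1 x) \<Longrightarrow>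
       \<forall>x\<in>pts Y. B x \<in> pts Y \<and> nrm Y (B x) \<le> C' * a powr (1 - \<theta>) * b powr \<theta> * nrm Y x"
    proof (rule interpolation_estimate[OF F(1,2) \<theta> E1 E1, folded Y_def], goal_cases)
      case (1 c)
      show ?case by (rule that[OF 1(2-)])
    qed
    define R where "R = C' * M powr (1 - \<theta>) * d powr \<theta>"
    have R: "R > 0" using C' M0 d by (simp add: R_def)
    have UY: "U t y \<in> pts Y \<and> nrm Y (U t y) \<le> R * nrm Y y" if "0 \<le> t" "t \<le> T" "y \<in> pts Y" for t y
      unfolding R_def using C'(2)[OF commutes_U[OF that(1)] _ _ norm_U_apply[OF that(1,2)] d(2)[OF that(1,2)]] that(3) M0 d(1)
      by auto
    show ?thesis
      unfolding Y.continuous_map_iff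
    proof (intro conjI ballI allI impI)
      show "U t x \<in> pts Y" if "t \<in> {0..T}" for t using UY x that by auto
      fix t e :: real assume t: "t \<in> {0..T}" and e: "e > 0"
      have "x \<in> ntop Y closure_of pts E1"
        using F(3) banach_couple_embedded[OF E1] emb dens x unfolding admissible_functor_def dense_in_def Y_def by blast
      then obtain y where y: "y \<in> pts E1" "y \<in> pts Y" "nrm Y (x - y) < e / (3 * R)"
        using Y.closure_of_D e R by (metis divide_pos_pos mult_pos_pos zero_less_numeral)
      have c1: "continuous_on {0..T} (\<lambda>s. norm (U s y - U t y) + norm (U s (A y) - U t (A y)))"
        by (intro continuous_intros continuous_on_subset[OF U_cont]) auto
      have "e / (3 * (k * d)) > 0" using e k d by simp
      then obtain r where r: "r > 0" "\<And>s. s \<in> {0..T} \<Longrightarrow> \<bar>s - t\<bar> < r \<Longrightarrow>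
          norm (U s y - U t y) + norm (U s (A y) - U t (A y)) < e / (3 * (k * d))"
        using c1[unfolded continuous_on_iff, rule_format, OF t] by (force simp: dist_real_def)
      show "\<exists>r>0. \<forall>s\<in>{0..T}. \<bar>s - t\<bar> < r \<longrightarrow> nrm Y (U s x - U t x) < e"
      proof (intro exI[of _ r] conjI ballI impI r(1))
        fix s assume s: "s \<in> {0..T}" "\<bar>s - t\<bar> < r"
        have xy: "x - y \<in> pts Y" using x y Y.diff_mem by blast
        have small: "nrm Y (U r (x - y)) \<le> e / 3" if "r \<in> {0..T}" for r
        proof -
          have "nrm Y (U r (x - y)) \<le> R * nrm Y (x - y)" using UY[OF _ _ xy] that by auto
          also have "\<dots> \<le> R * (e / (3 * R))" using y R by (intro mult_left_mono) auto
          finally show ?thesis using R by simp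
        qed
        have UD: "U s y \<in> pts E1" "U t y \<in> pts E1" using d(2)[OF _ _ y(1)] s t by auto
        have "nrm Y (U s y - U t y) \<le> k * nrm E1 (U s y - U t y)"
          using k E1.diff_mem[OF UD] by blast
        also have "\<dots> \<le> k * (d * (norm (U s y - U t y) + norm (U s (A y) - U t (A y))))"
          using d(5)[OF _ _ y(1)] s t k by (intro mult_left_mono) auto
        also have "\<dots> < k * (d * (e / (3 * (k * d))))"
          using r(2)[OF s] k d by (intro mult_strict_left_mono) auto
        also have "\<dots> = e / 3" using k d by simp
        finally have mid: "nrm Y (U s y - U t y) < e / 3" .
        have eq: "U s x - U t x = (U s (x - y) - U t (x - y)) + (U s y - U t y)"
          by (simp add: blinfun.diff_right)
        have mem: "U s (x - y) \<in> pts Y" "U t (x - y) \<in> pts Y" "U s y \<in> pts Y" "U t y \<in> pts Y"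
          using UY xy y s t by auto
        have "nrm Y (U s x - U t x) \<le> nrm Y (U s (x - y) - U t (x - y)) + nrm Y (U s y - U t y)"
          unfolding eq using mem by (intro Y.nrm_add Y.diff_mem)
        also have "nrm Y (U s (x - y) - U t (x - y)) \<le> nrm Y (U s (x - y)) + nrm Y (U t (x - y))"
          using mem by (intro Y.nrm_diff)
        finally show "nrm Y (U s x - U t x) < e" using small[OF s(1)] small[OF t] mid by linarith
      qed
    qed
  qed
  have "smoothing_space U L (pts E1) A T M Y \<theta> \<mu> N"
    using \<theta> \<mu> N into diff orbit
    by (intro smoothing_space.intro smoothing_space_axioms.intro smoothing_semigroup_on_axioms Y.banach_sub_axioms) auto
  then show ?thesis unfolding Y_def by blast
qed

text \<open>Here the source is the interpolation space. On the ambient space \<open>L t\<close> is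
  of order \<open>1 / t\<close> and \<open>U t - id_blinfun\<close> is bounded; from
  \<open>E1\<close> to the ambient space they are bounded and of order \<open>t\<close>,
  respectively.\<close>

lemma interpolation_smoothing_from:
  assumes F: "interpolation_functor K sm F" "of_exponent K sm \<theta> F" and \<theta>: "0 < \<theta>" "\<theta> < 1"
  obtains c where "c > 0" "\<And>t x. 0 < t \<Longrightarrow> t \<le> T \<Longrightarrow> x \<in> pts (F whole_space E1) \<Longrightarrow>
       norm (L t x) \<le> c * t powr (\<theta> - 1) * nrm (F whole_space E1) x"
    "\<And>t x. 0 \<le> t \<Longrightarrow> t \<le> T \<Longrightarrow> x \<in> pts (F whole_space E1) \<Longrightarrow>
       norm (U t x - x) \<le> c * t powr \<theta> * nrm (F whole_space E1) x"
proof -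
  obtain d where d: "d > 0" "\<And>t x. 0 \<le> t \<Longrightarrow> t \<le> T \<Longrightarrow> x \<in> pts E1 \<Longrightarrow> U t x \<in> pts E1 \<and> nrm E1 (U t x) \<le> d * nrm E1 x"
    "\<And>t x. 0 < t \<Longrightarrow> t \<le> T \<Longrightarrow> x \<in> pts E1 \<Longrightarrow> norm (L t x) \<le> d * nrm E1 x"
    "\<And>t x. 0 \<le> t \<Longrightarrow> t \<le> T \<Longrightarrow> x \<in> pts E1 \<Longrightarrow> norm (U t x - x) \<le> d * t * nrm E1 x"
    proof (rule U_on_E1, goal_cases)
      case (1 c)
      show ?case by (rule that[OF 1(2-5)])
    qed
  obtain C where C: "C > 0" "\<And>B a b x. commutes B \<Longrightarrow> a \<ge> 0 \<Longrightarrow> b \<ge> 0 \<Longrightarrow> (\<And>x. norm (blinfun_apply B x) \<le> a * norm x) \<Longrightarrow>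
     (\<And>x. x \<in> pts E1 \<Longrightarrow> norm (B x) \<le> b * nrm E1 x) \<Longrightarrow> x \<in> pts (F whole_space E1) \<Longrightarrow>
     norm (B x) \<le> C * a powr (1 - \<theta>) * b powr \<theta> * nrm (F whole_space E1) x"
    proof (rule interpolation_estimate_from[OF F \<theta> E1], goal_cases)
      case (1 c)
      show ?case by (rule that[OF 1(2-)])
    qed
  interpret Y: banach_sub "F whole_space E1"
    by (rule embedded_banach_sub[OF interpolation_embedded(1)[OF F(1) E1]])
  have M0: "M > 0" using M by simp
  define c where "c = C * (2 * M) powr (1 - \<theta>) * d powr \<theta>"
  show thesis
  proof (rule that[of c])
    show "c > 0" using C M0 d by (simp add: c_def)
    fix t :: real and x assume x: "x \<in> pts (F whole_space E1)"
    have n0: "nrm (F whole_space E1) x \<ge> 0" by (rule Y.nrm_nonneg[OF x])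
    {
      assume t: "0 < t" "t \<le> T"
      have "norm (L t x) \<le> C * (M / t) powr (1 - \<theta>) * d powr \<theta> * nrm (F whole_space E1) x"
        using t M0 d(1) by (intro C(2)[OF commutes_L[OF t(1)] _ _ norm_L_apply[OF t] d(3)[OF t] x]) auto
      also have "\<dots> \<le> C * (2 * M / t) powr (1 - \<theta>) * d powr \<theta> * nrm (F whole_space E1) x"
        using C(1) n0 t M0 \<theta> by (intro mult_right_mono mult_left_mono powr_mono2 divide_right_mono) auto
      also have "(2 * M / t) powr (1 - \<theta>) = (2 * M) powr (1 - \<theta>) * t powr (\<theta> - 1)"
        using t M0 powr_minus_divide[of t "1 - \<theta>"] by (simp add: powr_divide)
      finally show "norm (L t x) \<le> c * t powr (\<theta> - 1) * nrm (F whole_space E1) x"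
        by (simp add: c_def mult_ac)
    }
    {
      assume t: "0 \<le> t" "t \<le> T"
      have B: "(U t - id_blinfun) y = U t y - y" for y by (simp add: blinfun.diff_left)
      have "norm ((U t - id_blinfun) x) \<le> C * (2 * M) powr (1 - \<theta>) * (d * t) powr \<theta> * nrm (F whole_space E1) x"
      proof (rule C(2)[OF _ _ _ _ _ x])
        show "commutes (U t - id_blinfun)" using t by (intro commutes_diff commutes_U commutes_id)
        show "norm ((U t - id_blinfun) y) \<le> 2 * M * norm y" for y
          unfolding B using norm_triangle_ineq4[of "U t y" y] norm_U_apply[OF t, of y]
            mult_right_mono[OF M norm_ge_zero[of y]] by simp
        show "norm ((U t - id_blinfun) y) \<le> d * t * nrm E1 y" if "y \<in> pts E1" for y
          unfolding B by (rule d(4)[OF t that])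
      qed (use t M0 d in auto)
      also have "(d * t) powr \<theta> = d powr \<theta> * t powr \<theta>" using t d by (intro powr_mult)
      finally show "norm (U t x - x) \<le> c * t powr \<theta> * nrm (F whole_space E1) x"
        unfolding B by (simp add: c_def mult_ac)
    }
  qed
qed

text \<open>The differences \<open>U h x - U (2 * h) x\<close> equal \<open>U h (x - U h x)\<close>.
  The inner vector has ambient size of order \<open>h powr \<alpha>\<close>, and smoothing into
  \<open>Y\<close> costs \<open>h powr (- \<xi>)\<close>, so over dyadic \<open>h\<close> they sum
  in \<open>Y\<close> to \<open>x - U T x\<close>.\<close>

lemma interpolation_decreasing:
  assumes G: "interpolation_functor K sm G" "of_exponent K sm \<alpha> G" and \<alpha>: "\<xi> < \<alpha>" "0 < \<alpha>" "\<alpha> < 1"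
    and Y: "smoothing_space U L (pts E1) A T M Y \<xi> \<mu> N"
  shows "pts (G whole_space E1) \<subseteq> pts Y"
proof
  fix x assume x: "x \<in> pts (G whole_space E1)"
  interpret Y: smoothing_space U L "pts E1" A T M Y \<xi> \<mu> N by fact
  interpret X: banach_sub "G whole_space E1"
    by (rule embedded_banach_sub[OF interpolation_embedded(1)[OF G(1) E1]])
  obtain c where c: "c > 0" "\<And>t x. 0 < t \<Longrightarrow> t \<le> T \<Longrightarrow> x \<in> pts (G whole_space E1) \<Longrightarrow>
       norm (L t x) \<le> c * t powr (\<alpha> - 1) * nrm (G whole_space E1) x"
    "\<And>t x. 0 \<le> t \<Longrightarrow> t \<le> T \<Longrightarrow> x \<in> pts (G whole_space E1) \<Longrightarrow>
       norm (U t x - x) \<le> c * t powr \<alpha> * nrm (G whole_space E1) x"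
    proof (rule interpolation_smoothing_from[OF G \<alpha>(2,3)], goal_cases)
      case (1 c)
      show ?case by (rule that[OF 1(2-)])
    qed
  define h where "h k = T * (1/2)^k" for k
  have h: "h k > 0" "h k \<le> T" for k using T by (auto simp: h_def power_le_one)
  define y where "y k = U (h (Suc k)) (x - U (h (Suc k)) x)" for k
  have ydiff: "y k = U (h (Suc k)) x - U (h k) x" for k
  proof -
    have "h k = h (Suc k) + h (Suc k)" by (simp add: h_def)
    then show ?thesis using U_add[of "h (Suc k)" "h (Suc k)" x] h(1)[of "Suc k"]
      by (simp add: y_def blinfun.diff_right)
  qed
  define q where "q = N * c * nrm (G whole_space E1) x * T powr (\<alpha> - \<xi>)"
  have bd: "nrm Y (y k) \<le> q * ((1/2) powr (\<alpha> - \<xi>)) ^ Suc k" for k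
  proof -
    have hk: "0 < h (Suc k)" "h (Suc k) \<le> T" using h by auto
    have "nrm Y (y k) \<le> N * h (Suc k) powr (- \<xi>) * norm (x - U (h (Suc k)) x)"
      unfolding y_def using Y.U_smooth[OF hk] by blast
    also have "\<dots> \<le> N * h (Suc k) powr (- \<xi>) * (c * h (Suc k) powr \<alpha> * nrm (G whole_space E1) x)"
      using c(3)[OF _ hk(2) x] hk Y.N by (intro mult_left_mono) (auto simp: norm_minus_commute)
    also have "\<dots> = N * c * nrm (G whole_space E1) x * (h (Suc k) powr (- \<xi>) * h (Suc k) powr \<alpha>)" by simp
    also have "h (Suc k) powr (- \<xi>) * h (Suc k) powr \<alpha> = h (Suc k) powr (\<alpha> - \<xi>)"
      by (simp add: powr_add[symmetric])
    also have "\<dots> = T powr (\<alpha> - \<xi>) * ((1/2) powr (\<alpha> - \<xi>)) ^ Suc k"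
      unfolding h_def using T by (subst powr_mult) (auto simp: half_power_powr simp del: power_Suc)
    finally show ?thesis by (simp only: q_def mult_ac)
  qed
  have mem: "y k \<in> pts Y" for k unfolding y_def using Y.U_smooth h by blast
  have sm: "summable (\<lambda>k. q * ((1/2) powr (\<alpha> - \<xi>)) ^ Suc k)"
    unfolding power_Suc using powr_less_mono2[of "\<alpha> - \<xi>" "1/2" "1::real"] \<alpha>
    by (intro summable_mult summable_geometric) auto
  have "y sums (x - U T x)"
  proof -
    have part: "(\<Sum>k<n. y k) = U (h n) x - U T x" for n
      unfolding ydiff using sum_lessThan_telescope[of "\<lambda>k. U (h k) x" n] by (simp add: h_def)
    have "h \<longlonglongrightarrow> 0" unfolding h_def by (intro tendsto_mult_right_zero LIMSEQ_power_zero) simp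
    then have "((\<lambda>n. U (h n) x) \<longlongrightarrow> U 0 x) sequentially"
      by (rule U_tendsto[OF _ _ _ tendsto_const]) (use h in \<open>auto simp: less_imp_le\<close>)
    then show ?thesis unfolding sums_def part by (intro tendsto_diff) auto
  qed
  from Y.Y.sums_in_space(1)[OF mem bd sm this] have "x - U T x \<in> pts Y" .
  moreover have "U T x \<in> pts Y" using Y.U_smooth[of T x] T by blast
  ultimately have "(x - U T x) + U T x \<in> pts Y" by (rule Y.Y.add_mem)
  then show "x \<in> pts Y" by simp
qed

lemma compact_U:
  assumes ce: "compactly_embedded E1 whole_space" and t: "0 < t" "t \<le> T"
  shows "\<exists>K. compact K \<and> U t ` cball 0 R \<subseteq> K"
proof -
  obtain b where b: "b > 0" "\<And>t x. 0 < t \<Longrightarrow> t \<le> T \<Longrightarrow> U t x \<in> pts E1 \<and> nrm E1 (U t x) \<le> b / t * norm x"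
    proof (rule U_into_E1, goal_cases)
      case (1 c)
      show ?case by (rule that[OF 1(2,3)])
    qed
  define S where "S = {x \<in> pts E1. nrm E1 x \<le> 1}"
  have S: "compact (closure S)"
    using ce by (simp add: compactly_embedded_def S_def)
  define r where "r = b / t * (\<bar>R\<bar> + 1)"
  have r: "r > 0" using b t by (simp add: r_def)
  have "U t ` cball 0 R \<subseteq> (*\<^sub>R) r ` closure S"
  proof
    fix z assume "z \<in> U t ` cball 0 R"
    then obtain x where x: "norm x \<le> R" "z = U t x" by auto
    have z: "z \<in> pts E1" "nrm E1 z \<le> b / t * norm x" using b(2)[OF t, of x] x by auto
    note z(2)
    also have "b / t * norm x \<le> r" unfolding r_def using x b t by (intro mult_left_mono) auto
    finally have "nrm E1 z \<le> r" .
    then have "(1 / r) *\<^sub>R z \<in> S"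
      unfolding S_def using z r E1.scale_mem E1.nrm_scale[of z "1 / r"] by auto
    then have "(1 / r) *\<^sub>R z \<in> closure S" using closure_subset by blast
    moreover have "z = r *\<^sub>R ((1 / r) *\<^sub>R z)" using r by simp
    ultimately show "z \<in> (*\<^sub>R) r ` closure S" by blast
  qed
  moreover have "compact ((*\<^sub>R) r ` closure S)"
    by (intro compact_continuous_image S continuous_intros)
  ultimately show ?thesis by blast
qed

end

subsection \<open>The Cauchy problem\<close>

theorem proposition1p1:
  fixes K :: "complex set"
    and sm :: "complex \<Rightarrow> 'a::banach \<Rightarrow> 'a"
    and E0 E1 :: "'a nspace"
    and F :: "real \<Rightarrow> 'a nspace \<Rightarrow> 'a nspace \<Rightarrow> 'a nspace"
    and E :: "real \<Rightarrow> 'a nspace"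
    and A :: "'a \<Rightarrow> 'a"
    and f :: "real \<Rightarrow> 'a \<Rightarrow> 'a"
    and T \<gamma> \<xi> \<alpha> C :: real
    and u0 :: 'a
  assumes "scalar_action K sm"
    and "E0 = whole_space"
    and "banach_space K sm E0"
    and "banach_space K sm E1"
    and "cont_embedded E1 E0"
    and "dense_in E1 E0"
    and "compactly_embedded E1 E0"
    and "\<And>\<theta>. 0 < \<theta> \<Longrightarrow> \<theta> < 1 \<Longrightarrow>
           interpolation_functor K sm (F \<theta>) \<and> of_exponent K sm \<theta> (F \<theta>) \<and>
           admissible_functor K sm (F \<theta>)"
    and "E = interp_scale F E0 E1"
    and "generates_analytic_semigroup K sm (pts E1) A"
    and "0 < T"
    and "0 \<le> \<gamma>" and "\<gamma> < 1"
    and "0 \<le> \<xi>" and "\<xi> < 1"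
    and "continuous_map (prod_topology (top_of_set {0..T}) (ntop (E \<xi>))) (ntop (E \<gamma>))
           (\<lambda>(t, u). f t u)"
    and "0 < C"
    and "\<And>t u. t \<in> {0..T} \<Longrightarrow> u \<in> pts (E \<xi>) \<Longrightarrow>
           nrm (E \<gamma>) (f t u) \<le> C * (1 + nrm (E \<xi>) u)"
    and "\<gamma> = 0 \<Longrightarrow>
           \<exists>\<theta>0. 0 < \<theta>0 \<and> \<theta>0 < 1 \<and>
             (\<forall>R>0. \<exists>L>0. \<forall>t\<in>{0..T}. \<forall>s\<in>{0..T}.
                \<forall>u\<in>{u \<in> pts (E \<xi>). nrm (E \<xi>) u \<le> R}. \<forall>v\<in>{v \<in> pts (E \<xi>). nrm (E \<xi>) v \<le> R}.
                  nrm E0 (f t u - f s v)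
                    \<le> L * (\<bar>t - s\<bar> powr \<theta>0 + nrm (E \<xi>) (u - v) powr \<theta>0))"
    and "\<xi> \<le> \<alpha>" and "\<alpha> < 1"
    and "u0 \<in> pts (E \<alpha>)"
  shows "\<exists>u u'.
           (\<forall>t\<in>{0<..T}. (u has_vector_derivative u' t) (at t within {0<..T})) \<and>
           continuous_on {0<..T} u' \<and>
           continuous_map (top_of_set {0<..T}) (ntop E1) u \<and>
           continuous_map (top_of_set {0..T}) (ntop (E \<alpha>)) u \<and>
           (\<forall>t\<in>{0<..T}. u' t = A (u t) + f t (u t)) \<and>
           u 0 = u0"
proof -
  note sa = assms(1) and E0 = assms(2) and E1_emb = assms(5) and E1_dense = assms(6) and E1_cpt = assms(7)
    and F = assms(8) and E = assms(9) and T = assms(11)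
  interpret scalar_action K sm by fact
  have nrm_sm: "norm (sm c x) = cmod c * norm x" if "c \<in> K" for c x
    using assms(3) that unfolding E0 banach_space_def by simp
  interpret normed_scalar_action K sm by unfold_locales (rule nrm_sm)
  obtain U where an: "analytic_semigroup K sm U" and gen: "infinitesimal_generator U (pts E1) A"
    using assms(10) unfolding generates_analytic_semigroup_def by blast
  obtain L :: "real \<Rightarrow> 'a \<Rightarrow>\<^sub>L 'a" where deriv: "\<And>t x. t > 0 \<Longrightarrow> ((\<lambda>t. U t x) has_vector_derivative L t x) (at t)"
    and L_bound: "\<And>T. T > 0 \<Longrightarrow> \<exists>M>0. \<forall>t\<in>{0<..T}. norm (L t) \<le> M / t"
  proof (rule analytic_semigroup_derivative[OF sa nrm_sm an], goal_cases)
    case (2 L)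
    show ?case by (rule that[OF 2(2-)])
  qed
  interpret S: smoothing_semigroup U L "pts E1" A
    by unfold_locales (use an gen deriv in \<open>auto simp: analytic_semigroup_def\<close>)
  obtain M1 where M1: "M1 > 0" "\<forall>t\<in>{0..T}. norm (U t) \<le> M1" using S.U_bounded by blast
  obtain M2 where M2: "M2 > 0" "\<forall>t\<in>{0<..T}. norm (L t) \<le> M2 / t" using L_bound[OF T] by blast
  define M where "M = max 1 (max M1 M2)"
  have MU: "norm (U t) \<le> M" if "0 \<le> t" "t \<le> T" for t
  proof -
    have "norm (U t) \<le> M1" using M1 that by simp
    then show ?thesis by (simp add: M_def)
  qed
  have LM: "norm (L t) \<le> M / t" if "0 < t" "t \<le> T" for t
  proof -
    have "norm (L t) \<le> M2 / t" using M2 that by simp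
    also have "\<dots> \<le> M / t" using that by (intro divide_right_mono) (auto simp: M_def)
    finally show ?thesis .
  qed
  have E1: "embedded E1"
    using assms(4) E1_emb unfolding embedded_def cont_embedded_def E0 by simp
  interpret analytic_scale K sm U L E1 A T M
  proof (unfold_locales)
    show "commutes (U t)" if "t \<ge> 0" for t
      using an that unfolding analytic_semigroup_def commutes_def by blast
  qed (use T E1 MU LM in \<open>auto simp: M_def\<close>)
  have E_0: "E 0 = whole_space" by (simp add: E interp_scale_def E0)
  have E_F: "E \<theta> = F \<theta> whole_space E1" if "0 < \<theta>" for \<theta> using that by (simp add: E interp_scale_def E0)
  have space: "\<exists>\<mu> N. smoothing_space U L (pts E1) A T M (E \<theta>) \<theta> \<mu> N" if "0 \<le> \<theta>" "\<theta> < 1" for \<theta>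
  proof (cases "\<theta> = 0")
    case True
    then show ?thesis using smoothing_space_whole_space E_0 by auto
  next
    case False
    then have "0 < \<theta>" using that by simp
    with smoothing_space_interpolation[of "F \<theta>" \<theta>] F[of \<theta>] that E1_emb E1_dense E0 E_F show ?thesis by auto
  qed
  obtain \<mu> N where X: "smoothing_space U L (pts E1) A T M (E \<xi>) \<xi> \<mu> N"
    using space assms(14,15) by blast
  obtain \<mu>' N' where Y: "smoothing_space U L (pts E1) A T M (E \<alpha>) \<alpha> \<mu>' N'"
    using space[of \<alpha>] assms(14,20,21) by auto
  interpret X: smoothing_space U L "pts E1" A T M "E \<xi>" \<xi> \<mu> N by (rule X)
  interpret Y: smoothing_space U L "pts E1" A T M "E \<alpha>" \<alpha> \<mu>' N' by (rule Y)
  \<comment> \<open>The equation is solved in \<open>E \<xi>\<close>, where \<open>f\<close> lives,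
    so the initial value has to be placed there first. Equal exponents give literally the same
    space.\<close>
  have "pts (E \<alpha>) \<subseteq> pts (E \<xi>)"
  proof (cases "\<xi> = \<alpha>")
    case False
    then have "0 < \<alpha>" "\<xi> < \<alpha>" using assms(14,20) by auto
    with interpolation_decreasing[of "F \<alpha>" \<alpha> \<xi>, OF _ _ _ _ _ X] F[of \<alpha>] assms(21) E_F show ?thesis by auto
  qed simp
  then have u0: "u0 \<in> pts (E \<xi>)" using assms(22) by blast

  have G_sub: "banach_sub (E \<gamma>)"
    using space[of \<gamma>] assms(12,13) smoothing_space.axioms(2) by blast
  interpret G: banach_sub "E \<gamma>" by (rule G_sub)
  have f_mem: "f t x \<in> pts (E \<gamma>)" if "t \<in> {0..T}" "x \<in> pts (E \<xi>)" for t x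
    using continuous_map_image_subset_topspace[OF assms(16)] that by force
  obtain c where c: "c > 0" "\<forall>x\<in>pts (E \<gamma>). norm x \<le> c * nrm (E \<gamma>) x" using G.embed by blast
  \<comment> \<open>The growth bound is weakened to the ambient norm at the cost of the embedding
    constant \<open>c\<close> of \<open>E \<gamma>\<close>.\<close>
  interpret P: semilinear_problem U L "pts E1" A T M "E \<xi>" \<xi> \<mu> N f "c * C"
  proof unfold_locales
    show "\<exists>K. compact K \<and> U t ` cball 0 R \<subseteq> K" if "0 < t" "t \<le> T" for t R
      using compact_U[OF E1_cpt[unfolded E0] that] .
    show "c * C > 0" using c assms(17) by simp
    show "norm (f t x) \<le> c * C * (1 + nrm (E \<xi>) x)" if "t \<in> {0..T}" "x \<in> pts (E \<xi>)" for t x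
    proof -
      have "norm (f t x) \<le> c * nrm (E \<gamma>) (f t x)" using c f_mem[OF that] by blast
      also have "\<dots> \<le> c * (C * (1 + nrm (E \<xi>) x))" using assms(18)[OF that] c by (intro mult_left_mono) auto
      finally show ?thesis by simp
    qed
    fix s :: "nat \<Rightarrow> real" and x t y
    assume s: "\<And>n. s n \<in> {0..T}" "\<And>n. x n \<in> pts (E \<xi>)" "t \<in> {0..T}" "y \<in> pts (E \<xi>)" "s \<longlonglongrightarrow> t"
      "(\<lambda>n. nrm (E \<xi>) (x n - y)) \<longlonglongrightarrow> 0"
    have 1: "limitin (ntop (E \<xi>)) x y sequentially" unfolding X.Y.limitin_iff using s by blast
    have 2: "limitin (top_of_set {0..T}) s t sequentially"
      using s by (auto simp: limitin_subtopology)
    have "limitin (prod_topology (top_of_set {0..T}) (ntop (E \<xi>))) (\<lambda>n. (s n, x n)) (t, y) sequentially"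
      using 1 2 by (simp add: limitin_pairwise o_def)
    from continuous_map_limit[OF assms(16) this]
    have "limitin (ntop (E \<gamma>)) (\<lambda>n. f (s n) (x n)) (f t y) sequentially" by (simp add: o_def)
    then have "(\<lambda>n. nrm (E \<gamma>) (f (s n) (x n) - f t y)) \<longlonglongrightarrow> 0" unfolding G.limitin_iff by blast
    then show "(\<lambda>n. f (s n) (x n)) \<longlonglongrightarrow> f t y"
      using s f_mem by (intro G.tendsto_of_nrm) auto
  qed
  obtain u where uc: "continuous_map (top_of_set {0..T}) (ntop (E \<xi>)) u"
    and u: "\<And>t. t \<in> {0..T} \<Longrightarrow> u t = U t u0 + mild (\<lambda>s. f s (u s)) t"
    using P.mild_solution_exists[OF u0] by blast
  have um: "u t \<in> pts (E \<xi>)" if "t \<in> {0..T}" for t using uc that unfolding X.Y.continuous_map_iff by blast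
  define g where "g s = f s (u s)" for s
  have gc: "continuous_on {0..T} g"
    unfolding g_def using P.f_comp_continuous[OF uc, of "\<lambda>s. s"] by (simp add: continuous_on_id)
  have ug: "u t = U t u0 + mild g t" if "t \<in> {0..T}" for t using u[OF that] by (simp add: g_def[abs_def])
  have mc: "continuous_on {0..T} (mild g)"
    using smoothing_space.mild_continuous[OF smoothing_space_whole_space gc] by simp
  obtain R where R: "R \<ge> 0" "\<And>t. t \<in> {0..T} \<Longrightarrow> nrm (E \<xi>) (u t) \<le> R"
    using X.continuous_map_nrm_bounded[OF uc] by blast
  have reg: "\<exists>H\<ge>0. \<exists>\<kappa>>0. \<kappa> \<le> 1 \<and> (\<forall>s t. \<epsilon> \<le> s \<longrightarrow> s < t \<longrightarrow> t \<le> T \<longrightarrow>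
        norm (L (t - s) (g s - g t)) \<le> H * (t - s) powr (\<kappa> - 1))" if eps: "\<epsilon> > 0" for \<epsilon>
  proof (cases "\<gamma> = 0")
    case False
    then have \<gamma>: "0 < \<gamma>" using assms(12) by simp
    obtain d where d: "d > 0" "\<And>t x. 0 < t \<Longrightarrow> t \<le> T \<Longrightarrow> x \<in> pts (E \<gamma>) \<Longrightarrow>
       norm (L t x) \<le> d * t powr (\<gamma> - 1) * nrm (E \<gamma>) x"
      using interpolation_smoothing_from[of "F \<gamma>" \<gamma>] F[of \<gamma>] \<gamma> assms(13) E_F[OF \<gamma>] by metis
    \<comment> \<open>For positive \<open>\<gamma>\<close> a bound of \<open>g\<close> in
      \<open>E \<gamma>\<close> is enough, without any modulus of continuity: \<open>L\<close> gains
      \<open>\<gamma>\<close> on differences of norm at most \<open>2 * Q\<close>.\<close>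
    define Q where "Q = C * (1 + R)"
    have Q: "Q \<ge> 0" using assms(17) R by (simp add: Q_def)
    have gQ: "g t \<in> pts (E \<gamma>) \<and> nrm (E \<gamma>) (g t) \<le> Q" if "t \<in> {0..T}" for t
    proof -
      have "nrm (E \<gamma>) (g t) \<le> C * (1 + nrm (E \<xi>) (u t))" unfolding g_def by (rule assms(18)[OF that um[OF that]])
      also have "\<dots> \<le> Q" unfolding Q_def using R(2)[OF that] assms(17) by (intro mult_left_mono) auto
      finally show ?thesis using f_mem[OF that um[OF that]] by (simp add: g_def)
    qed
    show ?thesis
    proof (rule exI[of _ "d * (2 * Q)"], rule conjI, goal_cases)
      case 1
      show ?case using d Q by simp
    next
      case 2
      show ?case
      proof (intro exI[of _ \<gamma>] conjI allI impI)
      fix s t assume st: "\<epsilon> \<le> s" "s < t" "t \<le> T"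
      have m: "g s \<in> pts (E \<gamma>)" "g t \<in> pts (E \<gamma>)" and n: "nrm (E \<gamma>) (g s) \<le> Q" "nrm (E \<gamma>) (g t) \<le> Q"
        using gQ[of s] gQ[of t] st eps by auto
      have "norm (L (t - s) (g s - g t)) \<le> d * (t - s) powr (\<gamma> - 1) * nrm (E \<gamma>) (g s - g t)"
        using st eps by (intro d G.diff_mem m) auto
      also have "\<dots> \<le> d * (t - s) powr (\<gamma> - 1) * (2 * Q)"
        using G.nrm_diff[OF m] n d(1) by (intro mult_left_mono) auto
      finally show "norm (L (t - s) (g s - g t)) \<le> d * (2 * Q) * (t - s) powr (\<gamma> - 1)" by (simp add: mult_ac)
    qed (use \<gamma> assms(13) in auto)
    qed
  next
    case True
    obtain \<theta>0 where \<theta>0: "0 < \<theta>0" "\<theta>0 < 1" and hol: "\<forall>R>0. \<exists>L>0. \<forall>t\<in>{0..T}. \<forall>s\<in>{0..T}.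
                \<forall>u\<in>{u \<in> pts (E \<xi>). nrm (E \<xi>) u \<le> R}. \<forall>v\<in>{v \<in> pts (E \<xi>). nrm (E \<xi>) v \<le> R}.
                  nrm E0 (f t u - f s v) \<le> L * (\<bar>t - s\<bar> powr \<theta>0 + nrm (E \<xi>) (u - v) powr \<theta>0)"
      using assms(19)[OF True] by blast
    obtain l where l: "l > 0" "\<And>t s. t \<in> {0..T} \<Longrightarrow> s \<in> {0..T} \<Longrightarrow>
        norm (g t - g s) \<le> l * (\<bar>t - s\<bar> powr \<theta>0 + nrm (E \<xi>) (u t - u s) powr \<theta>0)"
    proof -
      \<comment> \<open>The radius is \<open>R + 1\<close> because the hypothesis speaks of positive
        radii and \<open>R\<close> may be \<open>0\<close>.\<close>
      obtain l where "l > 0" and l: "\<forall>t\<in>{0..T}. \<forall>s\<in>{0..T}.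
                \<forall>u\<in>{u \<in> pts (E \<xi>). nrm (E \<xi>) u \<le> R + 1}. \<forall>v\<in>{v \<in> pts (E \<xi>). nrm (E \<xi>) v \<le> R + 1}.
                  nrm E0 (f t u - f s v) \<le> l * (\<bar>t - s\<bar> powr \<theta>0 + nrm (E \<xi>) (u - v) powr \<theta>0)"
        using hol[rule_format, of "R + 1"] R(1) by auto
      show thesis
      proof (rule that[OF \<open>l > 0\<close>])
        fix t s assume ts: "t \<in> {0..T}" "s \<in> {0..T}"
        have "u t \<in> {u \<in> pts (E \<xi>). nrm (E \<xi>) u \<le> R + 1}" "u s \<in> {u \<in> pts (E \<xi>). nrm (E \<xi>) u \<le> R + 1}"
          using um R(2)[OF ts(1)] R(2)[OF ts(2)] ts by auto
        with l ts have "nrm E0 (f t (u t) - f s (u s)) \<le> l * (\<bar>t - s\<bar> powr \<theta>0 + nrm (E \<xi>) (u t - u s) powr \<theta>0)"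
          by blast
        then show "norm (g t - g s) \<le> l * (\<bar>t - s\<bar> powr \<theta>0 + nrm (E \<xi>) (u t - u s) powr \<theta>0)"
          by (simp add: g_def E0)
      qed
    qed
    obtain Q where Q: "\<And>s. s \<in> {0..T} \<Longrightarrow> norm (g s) \<le> Q"
      using compact_imp_bounded[OF compact_continuous_image[OF gc]] unfolding bounded_iff by fastforce
    have Q0: "Q \<ge> 0" using order_trans[OF norm_ge_zero Q[of 0]] T by simp
    \<comment> \<open>The first summand bounds increments of the orbit of \<open>u0\<close>, whose
      Hoelder estimate degenerates at \<open>0\<close>, hence the power of
      \<open>\<epsilon>\<close>; the second is the uniform bound for convolutions.\<close>
    define H where "H = N * \<epsilon> powr (- (\<xi> + \<mu>)) * norm u0 + X.hoelder_const * Q"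
    have H: "H \<ge> 0" using X.N X.hoelder_const_bounds(2) Q0 by (simp add: H_def)
    have uhol: "nrm (E \<xi>) (u t - u s) \<le> H * (t - s) powr \<mu>" if st: "\<epsilon> \<le> s" "s < t" "t \<le> T" for s t
    proof -
      have st0: "s \<in> {0..T}" "t \<in> {0..T}" "0 < s" using st eps by auto
      have gt: "continuous_on {0..t} g" by (rule continuous_on_subset[OF gc]) (use st in auto)
      have m1: "U (t - s) (U s u0) - U s u0 \<in> pts (E \<xi>)"
        using X.U_orbit_mem[OF u0, of t] X.U_orbit_mem[OF u0, of s] S.U_add[of "t - s" s u0] st st0 X.Y.diff_mem by auto
      have m2: "mild g t - mild g s \<in> pts (E \<xi>)"
      proof (rule X.Y.diff_mem)
        show "mild g t \<in> pts (E \<xi>)" "mild g s \<in> pts (E \<xi>)"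
          using X.mild_continuous[OF gc] st0 unfolding X.Y.continuous_map_iff by blast+
      qed
      have "u t - u s = (U (t - s) (U s u0) - U s u0) + (mild g t - mild g s)"
        using ug[OF st0(1)] ug[OF st0(2)] S.U_add[of "t - s" s u0] st st0 by simp
      then have "nrm (E \<xi>) (u t - u s) \<le> nrm (E \<xi>) (U (t - s) (U s u0) - U s u0) + nrm (E \<xi>) (mild g t - mild g s)"
        using X.Y.nrm_add[OF m1 m2] by simp
      also have "\<dots> \<le> N * (t - s) powr \<mu> * s powr (- (\<xi> + \<mu>)) * norm u0 + X.hoelder_const * (t - s) powr \<mu> * Q"
        using st st0 Q gt by (intro add_mono X.U_smooth_diff X.mild_hoelder) auto
      also have "\<dots> \<le> N * (t - s) powr \<mu> * \<epsilon> powr (- (\<xi> + \<mu>)) * norm u0 + X.hoelder_const * (t - s) powr \<mu> * Q"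
        using st eps X.N X.exps by (intro add_right_mono mult_right_mono mult_left_mono powr_mono2') auto
      also have "\<dots> = H * (t - s) powr \<mu>" by (simp add: H_def algebra_simps)
      finally show ?thesis .
    qed
    \<comment> \<open>The Hoelder exponent \<open>\<mu>\<close> of the solution composed with the
      exponent \<open>\<theta>0\<close> of \<open>f\<close>. Against the bound \<open>M / t\<close>
      on \<open>L\<close> any positive exponent is enough.\<close>
    define \<kappa> where "\<kappa> = \<mu> * \<theta>0"
    have mu1: "0 < \<mu>" "\<mu> < 1" using X.exps by auto
    have "0 < \<kappa>" "\<kappa> \<le> 1 * \<theta>0"
      unfolding \<kappa>_def using mu1 \<theta>0 by (simp, intro mult_right_mono) auto
    then have \<kappa>: "0 < \<kappa>" "\<kappa> \<le> \<theta>0" "\<kappa> \<le> 1" using \<theta>0 by auto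
    define W where "W = l * (T powr (\<theta>0 - \<kappa>) + H powr \<theta>0)"
    have W: "W \<ge> 0" using l by (simp add: W_def)
    have ghol: "norm (g s - g t) \<le> W * (t - s) powr \<kappa>" if st: "\<epsilon> \<le> s" "s < t" "t \<le> T" for s t
    proof -
      have st0: "s \<in> {0..T}" "t \<in> {0..T}" using st eps by auto
      have "norm (g s - g t) \<le> l * ((t - s) powr \<theta>0 + nrm (E \<xi>) (u t - u s) powr \<theta>0)"
        using l(2)[OF st0(2,1)] st by (simp add: norm_minus_commute)
      also have "\<dots> \<le> l * (T powr (\<theta>0 - \<kappa>) * (t - s) powr \<kappa> + H powr \<theta>0 * (t - s) powr \<kappa>)"
      proof (intro mult_left_mono add_mono)
        have "(t - s) powr \<theta>0 = (t - s) powr (\<theta>0 - \<kappa>) * (t - s) powr \<kappa>" by (simp add: powr_add[symmetric])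
        also have "\<dots> \<le> T powr (\<theta>0 - \<kappa>) * (t - s) powr \<kappa>"
          using st eps \<kappa> by (intro mult_right_mono powr_mono2) auto
        finally show "(t - s) powr \<theta>0 \<le> T powr (\<theta>0 - \<kappa>) * (t - s) powr \<kappa>" .
        have "nrm (E \<xi>) (u t - u s) powr \<theta>0 \<le> (H * (t - s) powr \<mu>) powr \<theta>0"
          using \<theta>0 uhol[OF st] X.Y.nrm_nonneg[OF X.Y.diff_mem[OF um um]] st0 by (intro powr_mono2) auto
        also have "\<dots> = H powr \<theta>0 * (t - s) powr \<kappa>"
          using H by (simp add: powr_mult powr_powr \<kappa>_def)
        finally show "nrm (E \<xi>) (u t - u s) powr \<theta>0 \<le> H powr \<theta>0 * (t - s) powr \<kappa>" .
      qed (use l in auto)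
      also have "\<dots> = W * (t - s) powr \<kappa>" by (simp add: W_def algebra_simps)
      finally show ?thesis .
    qed
    show ?thesis
    proof (rule exI[of _ "M * W"], rule conjI, goal_cases)
      case 1
      show ?case using M W by simp
    next
      case 2
      show ?case
      proof (intro exI[of _ \<kappa>] conjI allI impI)
      fix s t assume st: "\<epsilon> \<le> s" "s < t" "t \<le> T"
      have "norm (L (t - s) (g s - g t)) \<le> M / (t - s) * norm (g s - g t)"
        using st eps by (intro norm_L_apply) auto
      also have "\<dots> \<le> M / (t - s) * (W * (t - s) powr \<kappa>)"
        using ghol[OF st] st M by (intro mult_left_mono) auto
      also have "\<dots> = M * W * (t - s) powr (\<kappa> - 1)"
        using st by (simp add: powr_diff)
      finally show "norm (L (t - s) (g s - g t)) \<le> M * W * (t - s) powr (\<kappa> - 1)" .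
    qed (use \<kappa> in auto)
    qed
  qed
  note regular = mild_solution_regular[OF gc mc ug reg]
  have uD: "u t \<in> pts E1" if "t \<in> {0<..T}" for t by (rule regular(1)[OF _ _ that])
  have Auc: "continuous_on {0<..T} (\<lambda>t. A (u t))" by (rule regular(2))
  have der: "(u has_vector_derivative A (u t) + g t) (at t within {0<..T})" if "t \<in> {0<..T}" for t
    by (rule regular(3)[OF _ _ that])
  have uc0: "continuous_on {0<..T} u"
    unfolding continuous_on_eq_continuous_within using der has_vector_derivative_continuous by blast
  show ?thesis
  proof (rule exI[of _ u], rule exI[of _ "\<lambda>t. A (u t) + g t"], intro conjI ballI)
    show "(u has_vector_derivative A (u t) + g t) (at t within {0<..T})" if "t \<in> {0<..T}" for t by (rule der[OF that])
    show "continuous_on {0<..T} (\<lambda>t. A (u t) + g t)"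
      by (intro continuous_intros Auc continuous_on_subset[OF gc]) auto
    show "A (u t) + g t = A (u t) + f t (u t)" if "t \<in> {0<..T}" for t by (simp add: g_def)
    show "u 0 = u0" using ug[of 0] T by simp
    \<comment> \<open>The solution was built in \<open>E \<xi>\<close>; continuity in
      \<open>E \<alpha>\<close> is read off the formula, since the convolution smooths into
      \<open>E \<alpha>\<close> as well and \<open>u0\<close> lies there.\<close>
    have "continuous_map (top_of_set {0..T}) (ntop (E \<alpha>)) (\<lambda>t. U t u0 + mild g t)"
      by (rule Y.continuous_map_add_mild[OF assms(22) gc])
    then show "continuous_map (top_of_set {0..T}) (ntop (E \<alpha>)) u"
      by (rule continuous_map_eq) (use ug in auto)
    show "continuous_map (top_of_set {0<..T}) (ntop E1) u"
      unfolding E1.continuous_map_iff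
    proof (intro conjI ballI allI impI uD)
      \<comment> \<open>By equivalence with the graph norm, continuity in \<open>E1\<close> is
        ambient continuity of \<open>u\<close> and of \<open>A\<close> along
        \<open>u\<close>.\<close>
      obtain k where k: "k \<ge> 1" "\<And>x. x \<in> pts E1 \<Longrightarrow> nrm E1 x \<le> k * (norm x + norm (A x))"
      proof (rule graph_norm, goal_cases)
        case (1 c)
        show ?case by (rule that[OF 1(2,3)])
      qed
      fix t e :: real assume t: "t \<in> {0<..T}" and e: "e > 0"
      have cc: "continuous_on {0<..T} (\<lambda>s. norm (u s - u t) + norm (A (u s) - A (u t)))"
        by (intro continuous_intros uc0 Auc)
      have "e / k > 0" using e k by simp
      then obtain r where r: "r > 0" "\<And>s. s \<in> {0<..T} \<Longrightarrow> \<bar>s - t\<bar> < r \<Longrightarrow>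
          norm (u s - u t) + norm (A (u s) - A (u t)) < e / k"
        using cc[unfolded continuous_on_iff, rule_format, OF t] by (force simp: dist_real_def)
      show "\<exists>d>0. \<forall>s\<in>{0<..T}. \<bar>s - t\<bar> < d \<longrightarrow> nrm E1 (u s - u t) < e"
      proof (intro exI[of _ r] conjI ballI impI r(1))
        fix s assume s: "s \<in> {0<..T}" "\<bar>s - t\<bar> < r"
        have d: "u s - u t \<in> pts E1 \<and> A (u s - u t) = A (u s) - A (u t)" by (rule S.A_diff[OF uD[OF s(1)] uD[OF t]])
        have "nrm E1 (u s - u t) \<le> k * (norm (u s - u t) + norm (A (u s) - A (u t)))"
          using k(2)[of "u s - u t"] d by simp
        also have "\<dots> < k * (e / k)" using r(2)[OF s] k by (intro mult_strict_left_mono) auto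
        also have "\<dots> = e" using k by simp
        finally show "nrm E1 (u s - u t) < e" .
      qed
    qed
  qed
qed

end
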